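(* For every $n\geq 1$, the orbifold $\mathcal{A}(n)^{GL(n)}$ has a minimal strong generating set $\{h^0,h^1,\dots,h^{2n-1}\}$, where $h^k=\sum_{i=1}^n :e^i\,\partial^k f^i:$, and is therefore of type $\mathcal{W}(2,3,\dots,2n+1)$.
   Context: The rank $n$ symplectic fermion algebra $\mathcal{A}(n)$ is the vertex (super)algebra over $\mathbb{C}$ freely generated by odd elements $e^i,f^i$, $i=1,\dots,n$, with operator product expansions $e^i(z)f^j(w)\sim\delta_{i,j}(z-w)^{-2}$, $f^j(z)e^i(w)\sim-\delta_{i,j}(z-w)^{-2}$, $e^i(z)e^j(w)\sim 0$, $f^i(z)f^j(w)\sim 0$. Its conformal vector is $L=-\sum_i :e^if^i:$, for which $e^i,f^i$ are primary of weight one. The full automorphism group is $Sp(2n)$, acting linearly on the span of the generators. The subgroup $GL(n)\subset Sp(2n)$ acts so that $\{e^i\}$ spans the standard module $\mathbb{C}^n$ and $\{f^i\}$ spans the dual module $(\mathbb{C}^n)^*$ (with dual basis). For a group $G$ of automorphisms, $\mathcal{V}^G$ is the subalgebra of $G$-invariants. A subset $\{a_i\}$ of a vertex algebra strongly generates it if the algebra is spanned by the iterated Wick products $:\partial^{k_1}a_{i_1}\cdots\partial^{k_t}a_{i_t}:$ with $k_1,\dots,k_t\geq 0$. A strong generating set is minimal if no proper subset of it is a strong generating set. A vertex algebra is of type $\mathcal{W}(d_1,\dots,d_r)$ if it has a minimal strong generating set consisting of $r$ elements, one in each of the conformal weights $d_1,\dots,d_r$. The element $h^k$ has weight $k+2$.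 *)

theory Defs
  imports
    "HOL-Library.Groups_Big_Fun"
    "Jordan_Normal_Form.Matrix"
begin

text \<open>
  The underlying space is the whole type \<open>'v\<close>. The component \<open>homog V p\<close> is the
  even part for \<open>p = False\<close> and the odd part for \<open>p = True\<close>; \<open>nprod V a k b\<close> is
  the product \<open>a\<^sub>(\<^sub>k\<^sub>)b\<close>, i.e. the coefficient of \<open>z^(-k-1)\<close> in \<open>Y(a,z)b\<close>.
\<close>

record 'v vsa =
  scal :: "complex \<Rightarrow> 'v \<Rightarrow> 'v"
  homog :: "bool \<Rightarrow> 'v set"
  vacuum :: 'v
  nprod :: "'v \<Rightarrow> int \<Rightarrow> 'v \<Rightarrow> 'v"

text \<open>
  The last axiom is the Borcherds identity. By truncation each of its sums has only finitely
  many nonzero terms, so that \<open>Sum_any\<close> is the intended sum over all natural numbers.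
\<close>

locale vertex_superalgebra = vector_space "scal V"
  for V :: "('v :: ab_group_add) vsa" +
  assumes homog_subspace: "module.subspace (scal V) (homog V p)"
    and homog_Int: "homog V False \<inter> homog V True = {0}"
    and homog_sum: "\<exists>a\<in>homog V False. \<exists>b\<in>homog V True. v = a + b"
    and vacuum_even: "vacuum V \<in> homog V False"
    and nprod_homog:
      "\<lbrakk>a \<in> homog V p; b \<in> homog V q\<rbrakk> \<Longrightarrow> nprod V a k b \<in> homog V (p \<noteq> q)"
    and nprod_linear_left: "Vector_Spaces.linear (scal V) (scal V) (\<lambda>a. nprod V a k b)"
    and nprod_linear_right: "Vector_Spaces.linear (scal V) (scal V) (\<lambda>b. nprod V a k b)"
    and truncation: "\<exists>N. \<forall>k\<ge>N. nprod V a k b = 0"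
    and vacuum_left: "nprod V (vacuum V) k b = (if k = -1 then b else 0)"
    and vacuum_right: "nprod V a (-1) (vacuum V) = a"
    and vacuum_right_nonneg: "k \<ge> 0 \<Longrightarrow> nprod V a k (vacuum V) = 0"
    and borcherds:
      "\<lbrakk>a \<in> homog V p; b \<in> homog V q\<rbrakk> \<Longrightarrow>
        Sum_any (\<lambda>j. scal V (of_int m gchoose j)
            (nprod V (nprod V a (r + int j) b) (m + k - int j) c))
        = Sum_any (\<lambda>j. scal V ((-1) ^ j * (of_int r gchoose j))
            (nprod V a (m + r - int j) (nprod V b (k + int j) c)
              - scal V ((if p \<and> q then -1 else 1) * (-1) powi r)
                  (nprod V b (k + r - int j) (nprod V a (m + int j) c))))"

definition deriv_op :: "'v vsa \<Rightarrow> 'v \<Rightarrow> 'v" where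
  "deriv_op V a = nprod V a (-2) (vacuum V)"

text \<open>Iterated Wick products are nested to the right; the empty one is the vacuum.\<close>

definition wick :: "'v vsa \<Rightarrow> 'v list \<Rightarrow> 'v" where
  "wick V as = foldr (\<lambda>a b. nprod V a (-1) b) as (vacuum V)"

definition strongly_generates :: "('v :: ab_group_add) vsa \<Rightarrow> 'v set \<Rightarrow> 'v set \<Rightarrow> bool" where
  "strongly_generates V W S \<longleftrightarrow>
    S \<subseteq> W \<and>
    module.span (scal V)
      {wick V (map (\<lambda>(a, k). (deriv_op V ^^ k) a) w) | w. fst ` set w \<subseteq> S} = W"

definition minimal_strong_generating_set ::
    "('v :: ab_group_add) vsa \<Rightarrow> 'v set \<Rightarrow> 'v set \<Rightarrow> bool" where
  "minimal_strong_generating_set V W S \<longleftrightarrow>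
    strongly_generates V W S \<and> (\<forall>S'. S' \<subset> S \<longrightarrow> \<not> strongly_generates V W S')"

text \<open>
  Words indexing the PBW monomials in \<open>g 0, \<dots>, g (N - 1)\<close>; the letter \<open>(i, k)\<close> stands
  for the \<open>k\<close>-th derivative of \<open>g i\<close>. Derivatives of the same generator occur in decreasing
  order, strictly decreasing if the generator is odd.
\<close>

definition pbw_words :: "'v vsa \<Rightarrow> nat \<Rightarrow> (nat \<Rightarrow> 'v) \<Rightarrow> (nat \<times> nat) list set" where
  "pbw_words V N g =
    {w. fst ` set w \<subseteq> {..<N} \<and>
        sorted_wrt (\<lambda>(i, k) (j, l).
          i < j \<or> i = j \<and> (if g i \<in> homog V True then l < k else l \<le> k)) w}"

definition pbw_monomial :: "'v vsa \<Rightarrow> (nat \<Rightarrow> 'v) \<Rightarrow> (nat \<times> nat) list \<Rightarrow> 'v" where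
  "pbw_monomial V g w = wick V (map (\<lambda>(i, k). (deriv_op V ^^ k) (g i)) w)"

definition freely_generated :: "('v :: ab_group_add) vsa \<Rightarrow> nat \<Rightarrow> (nat \<Rightarrow> 'v) \<Rightarrow> bool" where
  "freely_generated V N g \<longleftrightarrow>
    inj_on (pbw_monomial V g) (pbw_words V N g) \<and>
    \<not> module.dependent (scal V) (pbw_monomial V g ` pbw_words V N g) \<and>
    module.span (scal V) (pbw_monomial V g ` pbw_words V N g) = UNIV"

text \<open>
  The operator product expansion \<open>a(z)b(w) \<sim> \<Sum>\<^sub>k (a\<^sub>(\<^sub>k\<^sub>)b)(w)(z-w)^(-k-1)\<close>, with
  \<open>k\<close> ranging over the nonnegative integers, is recorded by the products \<open>a\<^sub>(\<^sub>k\<^sub>)b\<close>.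
  Generators are indexed by \<open>0, \<dots>, n - 1\<close>.
\<close>

locale symplectic_fermion_algebra = vertex_superalgebra V
  for V :: "('v :: ab_group_add) vsa" +
  fixes n :: nat and e f :: "nat \<Rightarrow> 'v"
  assumes e_odd: "i < n \<Longrightarrow> e i \<in> homog V True"
    and f_odd: "i < n \<Longrightarrow> f i \<in> homog V True"
    and ope_ef: "\<lbrakk>i < n; j < n; k \<ge> 0\<rbrakk> \<Longrightarrow>
      nprod V (e i) k (f j) = (if i = j \<and> k = 1 then vacuum V else 0)"
    and ope_fe: "\<lbrakk>i < n; j < n; k \<ge> 0\<rbrakk> \<Longrightarrow>
      nprod V (f j) k (e i) = (if i = j \<and> k = 1 then - vacuum V else 0)"
    and ope_ee: "\<lbrakk>i < n; j < n; k \<ge> 0\<rbrakk> \<Longrightarrow> nprod V (e i) k (e j) = 0"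
    and ope_ff: "\<lbrakk>i < n; j < n; k \<ge> 0\<rbrakk> \<Longrightarrow> nprod V (f i) k (f j) = 0"
    and free: "freely_generated V (2 * n) (\<lambda>i. if i < n then e i else f (i - n))"

definition conformal_vector ::
    "('v :: ab_group_add) vsa \<Rightarrow> nat \<Rightarrow> (nat \<Rightarrow> 'v) \<Rightarrow> (nat \<Rightarrow> 'v) \<Rightarrow> 'v" where
  "conformal_vector V n e f = - (\<Sum>i<n. wick V [e i, f i])"

text \<open>The operator \<open>L\<^sub>0\<close> is the product \<open>L\<^sub>(\<^sub>1\<^sub>)\<close> with the conformal vector \<open>L\<close>.\<close>

definition has_weight :: "'v vsa \<Rightarrow> 'v \<Rightarrow> 'v \<Rightarrow> nat \<Rightarrow> bool" where
  "has_weight V L a d \<longleftrightarrow> nprod V L 1 a = scal V (of_nat d) a"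

definition of_type_W ::
    "('v :: ab_group_add) vsa \<Rightarrow> 'v \<Rightarrow> 'v set \<Rightarrow> nat list \<Rightarrow> bool" where
  "of_type_W V L W ds \<longleftrightarrow>
    (\<exists>as. distinct as \<and> minimal_strong_generating_set V W (set as) \<and>
      list_all2 (has_weight V L) as ds)"

definition automorphism :: "('v :: ab_group_add) vsa \<Rightarrow> ('v \<Rightarrow> 'v) \<Rightarrow> bool" where
  "automorphism V \<phi> \<longleftrightarrow>
    bij \<phi> \<and> Vector_Spaces.linear (scal V) (scal V) \<phi> \<and>
    (\<forall>p. \<phi> ` homog V p = homog V p) \<and>
    \<phi> (vacuum V) = vacuum V \<and>
    (\<forall>a k b. \<phi> (nprod V a k b) = nprod V (\<phi> a) k (\<phi> b))"

definition invariants :: "('v \<Rightarrow> 'v) set \<Rightarrow> 'v set" where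
  "invariants G = {v. \<forall>\<phi>\<in>G. \<phi> v = v}"

text \<open>
  The automorphisms for which \<open>e\<close> transforms as the standard basis of the standard
  \<open>GL(n)\<close>-module and \<open>f\<close> as the dual basis of its dual; here \<open>B\<close> is the inverse of \<open>A\<close>.
\<close>

definition GL_group ::
    "('v :: ab_group_add) vsa \<Rightarrow> nat \<Rightarrow> (nat \<Rightarrow> 'v) \<Rightarrow> (nat \<Rightarrow> 'v) \<Rightarrow> ('v \<Rightarrow> 'v) set" where
  "GL_group V n e f =
    {\<phi>. automorphism V \<phi> \<and>
      (\<exists>A\<in>carrier_mat n n. \<exists>B\<in>carrier_mat n n. A * B = 1\<^sub>m n \<and> B * A = 1\<^sub>m n \<and>
        (\<forall>i<n. \<phi> (e i) = (\<Sum>j<n. scal V (A $$ (j, i)) (e j))) \<and>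
        (\<forall>i<n. \<phi> (f i) = (\<Sum>j<n. scal V (B $$ (i, j)) (f j))))}"

definition h_field ::
    "('v :: ab_group_add) vsa \<Rightarrow> nat \<Rightarrow> (nat \<Rightarrow> 'v) \<Rightarrow> (nat \<Rightarrow> 'v) \<Rightarrow> nat \<Rightarrow> 'v" where
  "h_field V n e f k = (\<Sum>i<n. wick V [e i, (deriv_op V ^^ k) (f i)])"

end

theory Submission
  imports Defs "HOL-Computational_Algebra.Polynomial" "HOL-Library.Multiset"
begin

text \<open>
  The modes of the generators make the algebra a fermionic Fock space, that is, the exterior
  algebra in \<open>x\<^sub>i\<^sub>,\<^sub>k = e\<^sub>i(-k-1)\<close> and \<open>y\<^sub>i\<^sub>,\<^sub>k = f\<^sub>i(-k-1)\<close>. Invariants are polynomials in the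
  commuting operators \<open>q\<^sub>k\<^sub>,\<^sub>l = \<Sum>\<^sub>i x\<^sub>i\<^sub>,\<^sub>k y\<^sub>i\<^sub>,\<^sub>l\<close> (\<open>qop\<close>): the operator \<open>\<Sum> q\<^sub>k\<^sub>,\<^sub>l q\<^sub>k\<^sub>,\<^sub>l\<^sup>*\<close> lies
  in the ideal they generate, and on invariants it is the Casimir operator of \<open>gl(n)\<close> acting on the \<open>x\<close> alone,
  which has the form \<open>\<Sum> T\<^sup>* T\<close> for a positive definite form and is injective in positive weight.

  Multiplication by \<open>q\<^sub>k\<^sub>,\<^sub>l\<close> and the Wick product with the vector \<open>q\<^sub>k\<^sub>,\<^sub>l \<Omega>\<close> differ by a derivation
  whose coefficients are positive when \<open>k\<close> and \<open>l\<close> are even. Since the \<open>x\<^sub>i\<^sub>,\<^sub>0\<close> anticommute,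
  \<open>q\<^sub>0\<^sub>,\<^sub>l q\<^sub>0\<^sub>,\<^sub>0\<^sup>n = 0\<close>; rewriting this product in terms of Wick products yields a positive multiple
  of \<open>h\<close> with index \<open>2n + l\<close> plus Wick products of lower fields, so all \<open>h\<^sup>m\<close> with \<open>m \<ge> 2n\<close> are redundant.

  Below weight \<open>2n + 2\<close> there are no relations between the \<open>q\<^sub>k\<^sub>,\<^sub>l\<close>, and reordering a Wick product
  produces only derivatives in the linear part; hence no \<open>h\<^sup>k\<close> with \<open>k < 2n\<close> can be omitted.
\<close>

section \<open>Vertex superalgebras\<close>

text \<open>Two difficulties shape the argument. \<open>GL_group\<close> is a set of automorphisms
  that might a priori be small, so invariance is a usable condition only once every invertible
  matrix is realised by an automorphism. Freeness achieves this: on the PBW basis any anticommuting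
  operators may be substituted for the creation operators. Transvections, through a polynomial in
  their parameter, and diagonal matrices with one entry 2 then give all constraints on invariants
  that are used. The other difficulty is that Wick products neither commute nor associate, so the
  linear term of a relation could be lost when it is rewritten. For generation that term is followed
  in a cone, \<open>pos\<close>, where sums cannot cancel. For minimality it is read by
  \<open>linpart\<close>, whose coefficients (-1)^k/(k! l!) are forced up to a scalar by vanishing
  on derivatives of the q_{k,l}; that it also vanishes on the vectors \<open>qbracket\<close> is a
  computation with factorials. The bound 2n is the weight of q_{0,0}^n.\<close>

lemma Sum_any_single:
  assumes "\<And>j. j \<noteq> i \<Longrightarrow> F j = 0"
  shows "Sum_any F = F i"
proof -
  have "Sum_any F = sum F {i}"
    by (rule Sum_any.expand_superset) (use assms in auto)
  then show ?thesis by simp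
qed

lemma Sum_any_eventually:
  assumes "\<And>j. j \<ge> (N :: nat) \<Longrightarrow> F j = 0"
  shows "Sum_any F = (\<Sum>j<N. F j)"
proof (rule Sum_any.expand_superset)
  show "{a. F a \<noteq> 0} \<subseteq> {..<N}"
  proof
    fix a assume "a \<in> {a. F a \<noteq> 0}"
    then have "\<not> a \<ge> N" using assms by blast
    then show "a \<in> {..<N}" by simp
  qed
qed simp

lemma linear_scaleI:
  assumes "vector_space s" "\<And>x y. f (x + y) = f x + f y" "\<And>c x. f (s c x) = s c (f x)"
  shows "Vector_Spaces.linear s s f"
  using assms
  by (simp add: Vector_Spaces.linear_def module_hom_def module_hom_axioms_def module_iff_vector_space)

section \<open>Commutators, iterates and translation from the Borcherds identity\<close>

context vertex_superalgebra
begin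

abbreviation sc :: "complex \<Rightarrow> 'v \<Rightarrow> 'v" where "sc \<equiv> scal V"
abbreviation np :: "'v \<Rightarrow> int \<Rightarrow> 'v \<Rightarrow> 'v" where "np \<equiv> nprod V"
abbreviation Om :: 'v where "Om \<equiv> vacuum V"
abbreviation der :: "'v \<Rightarrow> 'v" where "der \<equiv> deriv_op V"
abbreviation lin :: "('v \<Rightarrow> 'v) \<Rightarrow> bool" where "lin \<equiv> Vector_Spaces.linear sc sc"

lemma linI:
  assumes "\<And>x y. F (x + y) = F x + F y" "\<And>c x. F (sc c x) = sc c (F x)"
  shows "lin F"
  using assms vector_space_axioms by (intro linear_scaleI)

lemma lin_hom: "lin F \<Longrightarrow> module_hom sc sc F"
  by (simp add: Vector_Spaces.linear_def)

lemmas lin_add = module_hom.add[OF lin_hom]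
  and lin_scale = module_hom.scale[OF lin_hom]
  and lin_zero = module_hom.zero[OF lin_hom]
  and lin_minus = module_hom.neg[OF lin_hom]
  and lin_diff = module_hom.diff[OF lin_hom]
  and lin_sum = module_hom.sum[OF lin_hom]

lemmas np_left_simps =
  lin_add[OF nprod_linear_left] lin_scale[OF nprod_linear_left] lin_zero[OF nprod_linear_left]
  lin_minus[OF nprod_linear_left] lin_diff[OF nprod_linear_left] lin_sum[OF nprod_linear_left]

lemmas np_right_simps =
  lin_add[OF nprod_linear_right] lin_scale[OF nprod_linear_right] lin_zero[OF nprod_linear_right]
  lin_minus[OF nprod_linear_right] lin_diff[OF nprod_linear_right] lin_sum[OF nprod_linear_right]

lemmas np_simps [simp] = np_left_simps np_right_simps

lemma homog_induct [case_names homog add]: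
  assumes "\<And>p a. a \<in> homog V p \<Longrightarrow> P a" "\<And>a b. P a \<Longrightarrow> P b \<Longrightarrow> P (a + b)"
  shows "P v"
  using homog_sum[of v] assms by metis

text \<open>Borcherds identity at r = 0, where \<open>0 gchoose j\<close> leaves only j = 0 on the
  right-hand side.\<close>

lemma commutator:
  assumes "a \<in> homog V p" "b \<in> homog V q"
  shows "np a m (np b k c) = sc (if p \<and> q then -1 else 1) (np b k (np a m c))
    + Sum_any (\<lambda>j. sc (of_int m gchoose j) (np (np a (int j) b) (m + k - int j) c))"
proof -
  have 0: "((0::complex) gchoose j) = 0" if "j \<noteq> 0" for j
    using that by (cases j) simp_all
  have single: "Sum_any (\<lambda>j. sc ((-1) ^ j * (0 gchoose j)) (F j)) = F 0" for F
    by (subst Sum_any_single[where i = 0]) (simp_all add: 0)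
  have "Sum_any (\<lambda>j. sc (of_int m gchoose j) (np (np a (int j) b) (m + k - int j) c))
      + sc (if p \<and> q then -1 else 1) (np b k (np a m c)) = np a m (np b k c)"
    using borcherds[OF assms, of m 0 k c] unfolding of_int_0 single
    by (simp only: add_0_left add_0_right of_nat_0 diff_zero power_int_0_right mult_1_right power_0
        gbinomial_0 mult_1 scale_one eq_diff_eq)
  then show ?thesis
    by (subst add.commute) (rule sym)
qed

lemma iterate_Sum_any:
  assumes "a \<in> homog V p" "b \<in> homog V q"
  shows "np (np a r b) k c = Sum_any (\<lambda>j. sc ((-1) ^ j * (of_int r gchoose j))
            (np a (r - int j) (np b (k + int j) c)
              - sc ((if p \<and> q then -1 else 1) * (-1) powi r)
                  (np b (k + r - int j) (np a (int j) c))))"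
proof -
  have 0: "((0::complex) gchoose j) = 0" if "j \<noteq> 0" for j
    using that by (cases j) simp_all
  have single: "Sum_any (\<lambda>j. sc (0 gchoose j) (F j)) = F 0" for F
    by (subst Sum_any_single[where i = 0]) (simp_all add: 0)
  show ?thesis
    using borcherds[OF assms, of 0 r k c] unfolding of_int_0 single
    by (simp only: add_0_left add_0_right of_nat_0 diff_zero)
qed

text \<open>Borcherds identity at m = 0. Any sufficiently large N is allowed, so that the expansions
  of two different vectors can be taken with a common bound, as in \<open>act_np\<close>.\<close>

lemma iterate:
  assumes "a \<in> homog V p" "b \<in> homog V q"
  shows "\<exists>N0. \<forall>N\<ge>N0. np (np a r b) k c = (\<Sum>j<N. sc ((-1) ^ j * (of_int r gchoose j))
            (np a (r - int j) (np b (k + int j) c)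
              - sc ((if p \<and> q then -1 else 1) * (-1) powi r)
                  (np b (k + r - int j) (np a (int j) c))))"
proof -
  obtain N1 where N1: "\<And>k. k \<ge> N1 \<Longrightarrow> np b k c = 0" using truncation[of b c] by blast
  obtain N2 where N2: "\<And>k. k \<ge> N2 \<Longrightarrow> np a k c = 0" using truncation[of a c] by blast
  show ?thesis
  proof (intro exI[of _ "nat (N1 - k) + nat N2"] allI impI)
    fix N assume N: "N \<ge> nat (N1 - k) + nat N2"
    have z: "np b (k + int j) c = 0" "np a (int j) c = 0" if "j \<ge> N" for j
      using that N by (auto intro!: N1 N2)
    show "np (np a r b) k c = (\<Sum>j<N. sc ((-1) ^ j * (of_int r gchoose j))
            (np a (r - int j) (np b (k + int j) c)
              - sc ((if p \<and> q then -1 else 1) * (-1) powi r)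
                  (np b (k + r - int j) (np a (int j) c))))"
      unfolding iterate_Sum_any[OF assms]
      by (rule Sum_any_eventually) (simp add: z)
  qed
qed

lemma gchoose_minus2: "((-2::complex) gchoose j) = (-1) ^ j * of_nat (Suc j)"
proof -
  have "((-2::complex) gchoose j) = (-1) ^ j * ((1 + of_nat j) gchoose j)"
    by (subst gbinomial_minus) simp
  also have "((1 + of_nat j :: complex) gchoose j) = of_nat (Suc j choose j)"
    by (simp add: binomial_gbinomial del: binomial_Suc_n)
  finally show ?thesis by simp
qed

text \<open>Iterate formula with b the vacuum and r = -2. Only the mode -1 of the vacuum is nonzero,
  so a single summand survives: from the first product if k < 0, from the second if k > 0, and none
  if k = 0.\<close>

lemma np_deriv_left: "np (der a) k c = sc (- of_int k) (np a (k - 1) c)"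
proof (induction a rule: homog_induct)
  case (homog p a)
  let ?F = "\<lambda>j. sc ((-1) ^ j * (of_int (-2) gchoose j))
            (np a (-2 - int j) (np Om (k + int j) c)
              - sc ((if p \<and> False then -1 else 1) * (-1) powi (-2))
                  (np Om (k + (-2) - int j) (np a (int j) c)))"
  have eq: "np (der a) k c = Sum_any ?F"
    unfolding deriv_op_def by (rule iterate_Sum_any[OF homog vacuum_even])
  have sgn: "((-1)::complex) ^ j * ((-1) ^ j * x) = x" for j x
    by (metis mult.assoc mult_1 power_mult_distrib minus_mult_minus mult_1_right power_one)
  consider "k < 0" | "k = 0" | "k > 0" by linarith
  then show ?case
  proof cases
    case 1
    have "Sum_any ?F = ?F (nat (-1 - k))"
      by (rule Sum_any_single) (use 1 in \<open>auto simp: vacuum_left\<close>)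
    then show ?thesis unfolding eq using 1
      by (simp add: vacuum_left gchoose_minus2 sgn of_nat_nat)
  next
    case 2
    have "Sum_any ?F = 0" using 2 by (simp add: vacuum_left)
    then show ?thesis unfolding eq using 2 by simp
  next
    case 3
    have "Sum_any ?F = ?F (nat (k - 1))"
      by (rule Sum_any_single) (use 3 in \<open>auto simp: vacuum_left\<close>)
    then show ?thesis unfolding eq using 3
      by (simp add: vacuum_left gchoose_minus2 sgn of_nat_nat algebra_simps power_int_minus)
  qed
next
  case (add a b)
  then show ?case by (simp add: deriv_op_def scale_right_distrib)
qed

lemma lin_deriv: "lin der"
  unfolding deriv_op_def by (rule nprod_linear_left)

lemmas deriv_simps [simp] =
  lin_add[OF lin_deriv] lin_scale[OF lin_deriv] lin_zero[OF lin_deriv]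
  lin_minus[OF lin_deriv] lin_diff[OF lin_deriv] lin_sum[OF lin_deriv]

lemma deriv_vacuum [simp]: "der Om = 0"
  by (simp add: deriv_op_def vacuum_left)

lemma deriv_np': "der (np a k b) = np a k (der b) - sc (of_int k) (np a (k - 1) b)"
proof (induction a rule: homog_induct)
  case (homog p a)
  show ?case
  proof (induction b rule: homog_induct)
    case (homog q b)
    let ?F = "\<lambda>j. sc ((-1) ^ j * (of_int k gchoose j))
            (np a (k - int j) (np b (-2 + int j) Om)
              - sc ((if p \<and> q then -1 else 1) * (-1) powi k)
                  (np b (-2 + k - int j) (np a (int j) Om)))"
    have "der (np a k b) = Sum_any ?F"
      unfolding deriv_op_def by (rule iterate_Sum_any[OF \<open>a \<in> _\<close> homog])
    also have "\<dots> = sum ?F {..<2}"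
      by (rule Sum_any_eventually) (simp add: vacuum_right_nonneg)
    also have "{..<2::nat} = {0, 1}" by auto
    finally show ?case
      by (simp add: vacuum_right_nonneg vacuum_right deriv_op_def)
  qed (simp add: scale_right_distrib)
qed (simp add: scale_right_distrib)

lemma deriv_np: "der (np a k b) = np (der a) k b + np a k (der b)"
  by (simp add: deriv_np' np_deriv_left)

lemma deriv_mode_vac: "der (np a (- int k - 1) Om) = sc (of_nat (Suc k)) (np a (- int (Suc k) - 1) Om)"
proof -
  have e: "- int k - 1 - 1 = - int (Suc k) - 1" by simp
  have c: "- of_int (- int k - 1) = (of_nat (Suc k) :: complex)" by simp
  have "der (np a (- int k - 1) Om) = - sc (of_int (- int k - 1)) (np a (- int k - 1 - 1) Om)"
    by (simp only: deriv_np' deriv_vacuum lin_zero[OF nprod_linear_right] diff_0)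
  then show ?thesis
    by (simp only: e c scale_minus_left[symmetric])
qed

text \<open>The vector on the left is the divided power T^k a / k! of the translation T =
  \<open>der\<close>, so its modes follow by iterating \<open>np_deriv_left\<close>.\<close>

lemma mode_vac_mode:
  "np (np a (- int k - 1) Om) p c = sc ((-1) ^ k * (of_int p gchoose k)) (np a (p - int k) c)"
proof (induction k arbitrary: p)
  case 0
  then show ?case by (simp add: vacuum_right)
next
  case (Suc k)
  have "np (np a (- int (Suc k) - 1) Om) p c
     = sc (1 / of_nat (Suc k)) (np (der (np a (- int k - 1) Om)) p c)"
    unfolding deriv_mode_vac by (simp del: of_nat_Suc)
  also have "\<dots> = sc (1 / of_nat (Suc k) * (- of_int p * ((-1) ^ k * (of_int (p - 1) gchoose k))))
      (np a (p - 1 - int k) c)"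
    unfolding np_deriv_left Suc by simp
  also have "1 / of_nat (Suc k) * (- of_int p * ((-1) ^ k * (of_int (p - 1) gchoose k)))
     = (-1) ^ Suc k * (of_int p gchoose Suc k :: complex)"
    using gbinomial_absorption[of k "of_int p :: complex"]
    by (simp add: field_simps del: of_nat_Suc)
  finally show ?case by (simp add: algebra_simps)
qed

lemma deriv_pow: "(der ^^ k) a = sc (fact k) (np a (- int k - 1) Om)"
proof (induction k)
  case 0
  then show ?case by (simp add: vacuum_right)
next
  case (Suc k)
  then show ?case using deriv_mode_vac[of a k]
    by (simp add: algebra_simps)
qed

text \<open>Dictionary between Wick products with derivatives and negative modes; it turns PBW
  monomials into products of creation operators.\<close>

lemma deriv_pow_mode: "np ((der ^^ k) a) (-1) c = sc (fact k) (np a (- int k - 1) c)"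
proof -
  have "((-1)::complex) ^ k * (of_int (-1) gchoose k) = 1"
    by (simp add: gbinomial_minus[of 1] binomial_gbinomial[symmetric] power_mult_distrib[symmetric]
        flip: mult.assoc)
  moreover have "np a (- 1 - int k) c = np a (- int k - 1) c"
    by (rule arg_cong[where f = "\<lambda>m. np a m c"]) simp
  ultimately show ?thesis
    using mode_vac_mode[of a k "-1" c] unfolding deriv_pow by simp
qed

lemma np_neg: "np a (- int k - 1) c = sc (1 / fact k) (np ((der ^^ k) a) (-1) c)"
  by (simp add: deriv_pow_mode)

lemma homog_add: "a \<in> homog V p \<Longrightarrow> b \<in> homog V p \<Longrightarrow> a + b \<in> homog V p"
  and homog_scale: "a \<in> homog V p \<Longrightarrow> sc c a \<in> homog V p"
  and homog_sum': "(\<And>i. i \<in> A \<Longrightarrow> g i \<in> homog V p) \<Longrightarrow> sum g A \<in> homog V p"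
  using homog_subspace[of p]
  by (auto intro: subspace_add subspace_scale subspace_sum)

lemma homog_deriv: "a \<in> homog V p \<Longrightarrow> der a \<in> homog V p"
  unfolding deriv_op_def using nprod_homog[of a p Om False "-2"] vacuum_even by simp

end

section \<open>Fermionic Fock spaces\<close>

definition sorted_words :: "'i set \<Rightarrow> ('i \<Rightarrow> 'i \<Rightarrow> bool) \<Rightarrow> 'i list set" where
  "sorted_words I R = {w. set w \<subseteq> I \<and> sorted_wrt R w}"

text \<open>The coordinates \<open>coef\<close> belong to the data along with the canonical
  anticommutation relations, so that the signs of reordering can be treated apart from vertex
  algebras.\<close>

locale fock_space = vector_space scale
  for scale :: "complex \<Rightarrow> 'v \<Rightarrow> ('v :: ab_group_add)" +
  fixes I :: "'i set" and R :: "'i \<Rightarrow> 'i \<Rightarrow> bool"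
    and cr an :: "'i \<Rightarrow> 'v \<Rightarrow> 'v" and vac :: 'v and coef :: "'i list \<Rightarrow> 'v \<Rightarrow> complex"
  assumes R_total: "\<lbrakk>i \<in> I; j \<in> I; i \<noteq> j\<rbrakk> \<Longrightarrow> R i j \<or> R j i"
    and R_irrefl: "\<not> R i i"
    and R_trans: "\<lbrakk>R i j; R j k\<rbrakk> \<Longrightarrow> R i k"
    and cr_add: "cr i (u + v) = cr i u + cr i v"
    and cr_scale: "cr i (scale c v) = scale c (cr i v)"
    and an_add: "an i (u + v) = an i u + an i v"
    and an_scale: "an i (scale c v) = scale c (an i v)"
    and cr_cr: "\<lbrakk>i \<in> I; j \<in> I\<rbrakk> \<Longrightarrow> cr i (cr j v) = - cr j (cr i v)"
    and an_cr: "\<lbrakk>i \<in> I; j \<in> I\<rbrakk> \<Longrightarrow> an i (cr j v) = (if i = j then v else 0) - cr j (an i v)"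
    and an_vac: "i \<in> I \<Longrightarrow> an i vac = 0"
    and coef_add: "coef w (u + v) = coef w u + coef w v"
    and coef_scale: "coef w (scale c v) = c * coef w v"
    and coef_word: "\<lbrakk>w \<in> sorted_words I R; w' \<in> sorted_words I R\<rbrakk> \<Longrightarrow>
      coef w (foldr cr w' vac) = (if w = w' then 1 else 0)"
    and span_words: "span ((\<lambda>w. foldr cr w vac) ` sorted_words I R) = UNIV"
begin

abbreviation words :: "'i list set" where "words \<equiv> sorted_words I R"
abbreviation word :: "'i list \<Rightarrow> 'v" where "word w \<equiv> foldr cr w vac"

abbreviation supp :: "'v \<Rightarrow> 'i list set" where "supp v \<equiv> {w. w \<in> words \<and> coef w v \<noteq> 0}"

lemma coef_zero [simp]: "coef w 0 = 0"
  using coef_scale[of w 0 0] by simp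

lemma coef_minus: "coef w (- v) = - coef w v"
  using coef_add[of w v "- v"] by (simp add: add_eq_0_iff)

lemma coef_diff: "coef w (u - v) = coef w u - coef w v"
  using coef_add[of w u "- v"] by (simp add: coef_minus)

lemma coef_sum: "coef w (sum g A) = (\<Sum>i\<in>A. coef w (g i))"
  by (induction A rule: infinite_finite_induct) (simp_all add: coef_add)

lemma cr_zero [simp]: "cr i 0 = 0"
  using cr_scale[of i 0 0] by simp

lemma cr_minus: "cr i (- v) = - cr i v"
  using cr_add[of i v "- v"] by (simp add: add_eq_0_iff)

lemma an_zero [simp]: "an i 0 = 0"
  using an_scale[of i 0 0] by simp

lemma an_minus: "an i (- v) = - an i v"
  using an_add[of i v "- v"] by (simp add: add_eq_0_iff)

lemma word_induct [case_names word add scale]: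
  assumes "\<And>w. w \<in> words \<Longrightarrow> P (word w)"
    and "\<And>u v. P u \<Longrightarrow> P v \<Longrightarrow> P (u + v)"
    and "\<And>c v. P v \<Longrightarrow> P (scale c v)"
  shows "P v"
proof -
  have Nil: "[] \<in> words" by (simp add: sorted_words_def)
  have "v \<in> span (word ` words)" using span_words by simp
  then show ?thesis
  proof (induction rule: span_induct_alt)
    case base
    then show ?case using assms(3)[OF assms(1)[OF Nil], of 0] by simp
  next
    case (step c x y)
    then show ?case using assms by auto
  qed
qed

lemma finite_support: "finite (supp v)"
proof (induction v rule: word_induct)
  case (word w)
  have "{w' \<in> words. coef w' (word w) \<noteq> 0} \<subseteq> {w}"
    using word by (auto simp: coef_word split: if_splits)
  then show ?case by (rule finite_subset) simp
next
  case (add u v)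
  have "supp (u + v) \<subseteq> supp u \<union> supp v"
    by (auto simp: coef_add)
  then show ?case by (rule finite_subset) (use add in simp)
next
  case (scale c v)
  have "supp (scale c v) \<subseteq> supp v"
    by (auto simp: coef_scale)
  then show ?case by (rule finite_subset) (use scale in simp)
qed

text \<open>Substitution of the operators c for the creation operators on basis words. The action of
  GL(n) is built from it.\<close>

definition lift :: "('i \<Rightarrow> 'v \<Rightarrow> 'v) \<Rightarrow> 'v \<Rightarrow> 'v" where
  "lift c v = (\<Sum>w\<in>supp v. scale (coef w v) (foldr c w vac))"

lemma lift_superset:
  assumes "finite F" "supp v \<subseteq> F" "F \<subseteq> words"
  shows "lift c v = (\<Sum>w\<in>F. scale (coef w v) (foldr c w vac))"
  unfolding lift_def by (rule sum.mono_neutral_left) (use assms in auto)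

lemma lift_add: "lift c (u + v) = lift c u + lift c v"
proof -
  let ?F = "supp u \<union> supp v"
  have F: "finite ?F" using finite_support[of u] finite_support[of v] by simp
  have "lift c (u + v) = (\<Sum>w\<in>?F. scale (coef w (u + v)) (foldr c w vac))"
    by (rule lift_superset[OF F]) (auto simp: coef_add)
  also have "\<dots> = (\<Sum>w\<in>?F. scale (coef w u) (foldr c w vac)) + (\<Sum>w\<in>?F. scale (coef w v) (foldr c w vac))"
    by (simp add: coef_add scale_left_distrib sum.distrib)
  also have "(\<Sum>w\<in>?F. scale (coef w u) (foldr c w vac)) = lift c u"
    by (rule lift_superset[OF F, symmetric]) auto
  also have "(\<Sum>w\<in>?F. scale (coef w v) (foldr c w vac)) = lift c v"
    by (rule lift_superset[OF F, symmetric]) auto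
  finally show ?thesis .
qed

lemma lift_scale: "lift c (scale a v) = scale a (lift c v)"
proof -
  have "lift c (scale a v) = (\<Sum>w\<in>supp v. scale (coef w (scale a v)) (foldr c w vac))"
    by (rule lift_superset[OF finite_support]) (auto simp: coef_scale)
  then show ?thesis
    by (simp add: lift_def coef_scale scale_sum_right)
qed

lemma lift_word: "w \<in> words \<Longrightarrow> lift c (word w) = foldr c w vac"
  by (subst lift_superset[of "{w}"]) (auto simp: coef_word split: if_splits)

lemma expand: "v = (\<Sum>w\<in>supp v. scale (coef w v) (word w))"
proof -
  have "lift cr v = v"
    by (induction v rule: word_induct) (simp_all add: lift_word lift_add lift_scale)
  then show ?thesis by (simp add: lift_def)
qed

lemma coef_ext: "(\<And>w. w \<in> words \<Longrightarrow> coef w u = coef w v) \<Longrightarrow> u = v"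
proof -
  assume *: "\<And>w. w \<in> words \<Longrightarrow> coef w u = coef w v"
  have "coef w (u - v) = 0" if "w \<in> words" for w using *[OF that] by (simp add: coef_diff)
  then have e: "supp (u - v) = {}" by blast
  have "u - v = 0" using expand[of "u - v"] unfolding e by simp
  then show ?thesis by simp
qed

definition anticommuting :: "('i \<Rightarrow> 'v \<Rightarrow> 'v) \<Rightarrow> bool" where
  "anticommuting c \<longleftrightarrow> (\<forall>i\<in>I. \<forall>u v. c i (u + v) = c i u + c i v)
    \<and> (\<forall>i\<in>I. \<forall>a v. c i (scale a v) = scale a (c i v))
    \<and> (\<forall>i\<in>I. \<forall>j\<in>I. \<forall>v. c i (c j v) = - c j (c i v))"

lemma anticommutingD:
  assumes "anticommuting c" "i \<in> I"
  shows "c i (u + v) = c i u + c i v" "c i (scale a v) = scale a (c i v)"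
    "j \<in> I \<Longrightarrow> c i (c j v) = - c j (c i v)"
  using assms unfolding anticommuting_def by blast+

lemma anticommuting_square:
  assumes "anticommuting c" "i \<in> I"
  shows "c i (c i v) = 0"
proof -
  have "c i (c i v) = - c i (c i v)" using assms unfolding anticommuting_def by blast
  then have "c i (c i v) + c i (c i v) = 0" by (simp add: eq_neg_iff_add_eq_0)
  then have "scale 2 (c i (c i v)) = 0" using scale_left_distrib[of 1 1 "c i (c i v)"] by simp
  then show ?thesis by simp
qed

lemma anticommuting_cr: "anticommuting cr"
  unfolding anticommuting_def using cr_add cr_scale cr_cr by blast

lemma anticommuting_zero:
  assumes "anticommuting c" "i \<in> I"
  shows "c i 0 = 0"
proof -
  have "c i (scale 0 0) = scale 0 (c i 0)" using assms unfolding anticommuting_def by blast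
  then show ?thesis by simp
qed

lemma anticommuting_word_mem:
  assumes "anticommuting c" "set w \<subseteq> I" "i \<in> set w"
  shows "c i (foldr c w v) = 0"
  using assms(2,3)
proof (induction w)
  case (Cons j w)
  have iI: "i \<in> I" using Cons.prems by auto
  show ?case
  proof (cases "i = j")
    case True
    then show ?thesis using anticommuting_square[OF assms(1) iI] by simp
  next
    case False
    then have "c i (c j (foldr c w v)) = - c j (c i (foldr c w v))"
      using Cons.prems by (intro anticommutingD(3)[OF assms(1) iI]) simp
    also have "c i (foldr c w v) = 0" using Cons False by auto
    also have "c j 0 = 0"
      using anticommuting_zero[OF assms(1)] Cons.prems by simp
    finally show ?thesis by simp
  qed
qed simp

text \<open>
  The sign \<open>s\<close> is the same for every anticommuting family \<open>c\<close>. Hence the linear map given by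
  \<open>c\<close> on sorted words intertwines \<open>cr\<close> with \<open>c\<close>.
\<close>

lemma insert_word:
  assumes "w \<in> words" "i \<in> I" "i \<notin> set w"
  obtains w' s where "w' \<in> words" "set w' = insert i (set w)" "s = 1 \<or> s = - 1"
    "\<And>c v. anticommuting c \<Longrightarrow> c i (foldr c w v) = scale s (foldr c w' v)"
proof -
  have "\<exists>w' s. w' \<in> words \<and> set w' = insert i (set w) \<and> (s = 1 \<or> s = - 1) \<and>
    (\<forall>c v. anticommuting c \<longrightarrow> c i (foldr c w v) = scale s (foldr c w' v))"
    using assms
  proof (induction w)
    case Nil
    then show ?case by (intro exI[of _ "[i]"] exI[of _ 1]) (auto simp: sorted_words_def)
  next
    case (Cons j w)
    have w: "w \<in> words" "j \<in> I" "i \<noteq> j" "i \<notin> set w" "\<forall>k\<in>set w. R j k"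
      using Cons.prems by (auto simp: sorted_words_def)
    show ?case
    proof (cases "R i j")
      case True
      then have "i # j # w \<in> words"
        using w Cons.prems R_trans by (auto simp: sorted_words_def)
      then show ?thesis by (intro exI[of _ "i # j # w"] exI[of _ 1]) auto
    next
      case False
      then have ji: "R j i" using R_total w Cons.prems by blast
      obtain w' s where IH: "w' \<in> words" "set w' = insert i (set w)" "s = 1 \<or> s = - 1"
        "\<And>c v. anticommuting c \<Longrightarrow> c i (foldr c w v) = scale s (foldr c w' v)"
        using Cons.IH[OF w(1) Cons.prems(2) w(4)] by blast
      have "j # w' \<in> words" using IH w ji by (auto simp: sorted_words_def)
      moreover have "c i (foldr c (j # w) v) = scale (- s) (foldr c (j # w') v)"
        if c: "anticommuting c" for c v
      proof -
        have "c i (foldr c (j # w) v) = - c j (c i (foldr c w v))"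
          using anticommutingD(3)[OF c Cons.prems(2) w(2)] by simp
        also have "c i (foldr c w v) = scale s (foldr c w' v)" by (rule IH(4)[OF c])
        also have "c j (scale s (foldr c w' v)) = scale s (foldr c (j # w') v)"
          using anticommutingD(2)[OF c w(2)] by simp
        finally show ?thesis by simp
      qed
      ultimately show ?thesis using IH(2,3)
        by (intro exI[of _ "j # w'"] exI[of _ "- s"]) auto
    qed
  qed
  then show ?thesis using that by blast
qed

lemma insert_word_cr:
  assumes "w \<in> words" "i \<in> I" "i \<notin> set w"
  obtains w' s where "w' \<in> words" "set w' = insert i (set w)" "s = 1 \<or> s = - 1"
    "cr i (word w) = scale s (word w')"
proof -
  obtain w' s where w': "w' \<in> words" "set w' = insert i (set w)" "s = 1 \<or> s = - 1"
    "\<And>c v. anticommuting c \<Longrightarrow> c i (foldr c w v) = scale s (foldr c w' v)"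
    using insert_word[OF assms] by blast
  show ?thesis by (rule that[OF w'(1-3) w'(4)[OF anticommuting_cr]])
qed

text \<open>R is a strict total order on I, so a sorted word is the enumeration of its letters in
  that order.\<close>

lemma words_eqI:
  assumes "w \<in> words" "w' \<in> words" "set w = set w'"
  shows "w = w'"
  using assms
proof (induction w arbitrary: w')
  case (Cons i w)
  then obtain j w2 where w': "w' = j # w2" by (cases w') auto
  have asym: "\<not> (R a b \<and> R b a)" for a b using R_trans R_irrefl by blast
  have "i = j"
  proof (rule ccontr)
    assume "i \<noteq> j"
    then have "i \<in> set w2" "j \<in> set w" using Cons.prems(3) unfolding w' by auto
    then have "R j i" "R i j" using Cons.prems unfolding w' by (auto simp: sorted_words_def)
    then show False using asym by blast
  qed
  moreover have "i \<notin> set w" "j \<notin> set w2"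
    using Cons.prems R_irrefl unfolding w' by (auto simp: sorted_words_def)
  ultimately have "set w = set w2" using Cons.prems unfolding w' by auto
  moreover have "w \<in> words" "w2 \<in> words" using Cons.prems unfolding w' by (auto simp: sorted_words_def)
  ultimately have "w = w2" using Cons.IH by blast
  with \<open>i = j\<close> show ?case by (simp add: w')
qed simp

text \<open>Deleting i and inserting it again gives a sorted word with the same letters, hence w
  itself; the sign is that of the insertion.\<close>

lemma remove_word:
  assumes "w \<in> words" "i \<in> set w"
  obtains w' s where "w' \<in> words" "set w' = set w - {i}" "s = 1 \<or> s = - 1"
    "word w = scale s (cr i (word w'))"
proof -
  let ?w = "filter (\<lambda>j. j \<noteq> i) w"
  have w: "?w \<in> words" using assms by (auto simp: sorted_words_def sorted_wrt_filter)
  have iI: "i \<in> I" using assms by (auto simp: sorted_words_def)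
  obtain w' s where w': "w' \<in> words" "set w' = insert i (set ?w)" "s = 1 \<or> s = - 1"
    "\<And>c v. anticommuting c \<Longrightarrow> c i (foldr c ?w v) = scale s (foldr c w' v)"
    using insert_word[OF w iI] by auto
  have "w' = w" using w'(1,2) assms by (intro words_eqI) auto
  then have "cr i (word ?w) = scale s (word w)" using w'(4)[OF anticommuting_cr] by simp
  then have "word w = scale s (cr i (word ?w))" using w'(3) by auto
  then show ?thesis using that[OF w _ w'(3)] by auto
qed

lemma an_word_notin:
  assumes "set w \<subseteq> I" "i \<in> I" "i \<notin> set w"
  shows "an i (word w) = 0"
  using assms by (induction w) (auto simp: an_vac an_cr)

lemma an_remove_word:
  assumes "w \<in> words" "i \<in> set w"
  obtains w' s where "w' \<in> words" "set w' = set w - {i}" "s = 1 \<or> s = - 1"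
    "word w = scale s (cr i (word w'))" "an i (word w) = scale s (word w')"
proof -
  obtain w' s where w': "w' \<in> words" "set w' = set w - {i}" "s = 1 \<or> s = - 1"
    "word w = scale s (cr i (word w'))"
    using remove_word[OF assms] .
  have iI: "i \<in> I" using assms by (auto simp: sorted_words_def)
  have "an i (word w') = 0" by (rule an_word_notin) (use w' iI in \<open>auto simp: sorted_words_def\<close>)
  then have "an i (word w) = scale s (word w')"
    unfolding w'(4) an_scale using iI by (simp add: an_cr)
  then show ?thesis using that w' by blast
qed

lemma lift_vac: "lift c vac = vac"
  using lift_word[of "[]" c] by (simp add: sorted_words_def)

text \<open>On a word without i both sides reorder with the same sign; on a word containing i both
  vanish, since anticommuting operators square to zero.\<close>

lemma lift_cr:
  assumes c: "anticommuting c" and i: "i \<in> I"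
  shows "lift c (cr i v) = c i (lift c v)"
proof (induction v rule: word_induct)
  case (word w)
  have wI: "set w \<subseteq> I" using word by (auto simp: sorted_words_def)
  show ?case
  proof (cases "i \<in> set w")
    case True
    have "lift c 0 = 0" using lift_scale[of c 0 0] by simp
    then show ?thesis
      using anticommuting_word_mem[OF c wI True, of vac] anticommuting_word_mem[OF anticommuting_cr wI True, of vac]
      by (simp add: lift_word[OF word])
  next
    case False
    obtain w' s where w': "w' \<in> words" "set w' = insert i (set w)" "s = 1 \<or> s = - 1"
      "\<And>c v. anticommuting c \<Longrightarrow> c i (foldr c w v) = scale s (foldr c w' v)"
      using insert_word[OF word i False] by blast
    then show ?thesis
      by (simp add: w'(4)[OF anticommuting_cr] w'(4)[OF c] lift_scale lift_word word)
  qed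
next
  case (add u v)
  then show ?case using c i by (simp add: anticommutingD(1) cr_add lift_add)
next
  case (scale a v)
  then show ?case using c i by (simp add: anticommutingD(2) cr_scale lift_scale)
qed

section \<open>The hermitian form with orthonormal words\<close>

definition ip :: "'v \<Rightarrow> 'v \<Rightarrow> complex" where
  "ip u v = (\<Sum>w\<in>supp u. cnj (coef w u) * coef w v)"

lemma ip_superset:
  assumes "finite F" "supp u \<subseteq> F" "F \<subseteq> words"
  shows "ip u v = (\<Sum>w\<in>F. cnj (coef w u) * coef w v)"
  unfolding ip_def by (rule sum.mono_neutral_left) (use assms in auto)

lemma ip_add_right: "ip u (v + w) = ip u v + ip u w"
  and ip_scale_right: "ip u (scale c v) = c * ip u v"
  by (simp_all add: ip_def coef_add coef_scale sum.distrib sum_distrib_left algebra_simps)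

lemma ip_zero [simp]: "ip 0 v = 0" "ip v 0 = 0"
  by (simp_all add: ip_def)

lemma ip_sum_right: "ip u (sum g A) = (\<Sum>i\<in>A. ip u (g i))"
  by (induction A rule: infinite_finite_induct) (simp_all add: ip_add_right)

lemma ip_add_left: "ip (u + v) w = ip u w + ip v w"
proof -
  let ?F = "supp u \<union> supp v"
  have F: "finite ?F" using finite_support[of u] finite_support[of v] by simp
  have "ip (u + v) w = (\<Sum>x\<in>?F. cnj (coef x (u + v)) * coef x w)"
    by (rule ip_superset[OF F]) (auto simp: coef_add)
  also have "\<dots> = (\<Sum>x\<in>?F. cnj (coef x u) * coef x w) + (\<Sum>x\<in>?F. cnj (coef x v) * coef x w)"
    by (simp add: coef_add algebra_simps sum.distrib)
  also have "(\<Sum>x\<in>?F. cnj (coef x u) * coef x w) = ip u w"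
    by (rule ip_superset[OF F, symmetric]) auto
  also have "(\<Sum>x\<in>?F. cnj (coef x v) * coef x w) = ip v w"
    by (rule ip_superset[OF F, symmetric]) auto
  finally show ?thesis .
qed

lemma ip_scale_left: "ip (scale c u) v = cnj c * ip u v"
proof -
  have "ip (scale c u) v = (\<Sum>x | x \<in> words \<and> coef x u \<noteq> 0. cnj (coef x (scale c u)) * coef x v)"
    by (rule ip_superset[OF finite_support]) (auto simp: coef_scale)
  then show ?thesis by (simp add: ip_def coef_scale sum_distrib_left algebra_simps)
qed

lemma ip_self: "ip v v = of_real (\<Sum>w\<in>supp v. (cmod (coef w v))\<^sup>2)"
  unfolding ip_def of_real_sum by (intro sum.cong refl) (simp only: complex_norm_square mult.commute)

lemma ip_self_nonneg: "ip v v = of_real (Re (ip v v))" "Re (ip v v) \<ge> 0"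
  by (simp_all add: ip_self sum_nonneg del: of_real_sum of_real_power)

lemma ip_self_eq_0:
  assumes "Re (ip v v) = 0"
  shows "v = 0"
proof -
  have "(\<Sum>w\<in>supp v. (cmod (coef w v))\<^sup>2) = 0"
    using assms by (simp add: ip_self del: of_real_sum of_real_power)
  then have "\<forall>w\<in>supp v. (cmod (coef w v))\<^sup>2 = 0"
    using finite_support[of v] by (subst (asm) sum_nonneg_eq_0_iff) auto
  then have "coef w v = 0" if "w \<in> words" for w using that by auto
  then show ?thesis by (intro coef_ext) simp
qed

lemma ip_word: "w \<in> words \<Longrightarrow> w' \<in> words \<Longrightarrow> ip (word w) (word w') = (if w = w' then 1 else 0)"
  by (subst ip_superset[of "{w}"]) (auto simp: coef_word split: if_splits)

text \<open>Between words w and x both sides vanish unless x arises from w by adding the letter i,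
  and then the sign of inserting i equals the sign of removing it.\<close>

lemma ip_adjoint:
  assumes i: "i \<in> I"
  shows "ip (cr i u) v = ip u (an i v)"
proof (induction u rule: word_induct)
  case (word w)
  show ?case
  proof (induction v rule: word_induct)
    case (word x)
    note w = \<open>w \<in> words\<close> and x = \<open>x \<in> words\<close>
    have wI: "set w \<subseteq> I" "set x \<subseteq> I" using w x by (auto simp: sorted_words_def)
    show ?case
    proof (cases "i \<in> set x")
      case False
      then have 0: "an i (word x) = 0" using an_word_notin i wI by blast
      show ?thesis
      proof (cases "i \<in> set w")
        case True
        then show ?thesis using 0 anticommuting_word_mem[OF anticommuting_cr wI(1) True, of vac] by simp
      next
        case False2: False
        obtain w' s where w': "w' \<in> words" "set w' = insert i (set w)"
          "cr i (word w) = scale s (word w')"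
          using insert_word_cr[OF w i False2] by blast
        have "w' \<noteq> x" using w' False by auto
        then show ?thesis using 0 w' x by (simp add: ip_scale_left ip_word)
      qed
    next
      case True
      obtain y t where y: "y \<in> words" "set y = set x - {i}" "t = 1 \<or> t = - 1"
        "word x = scale t (cr i (word y))" "an i (word x) = scale t (word y)"
        using an_remove_word[OF x True] .
      show ?thesis
      proof (cases "i \<in> set w")
        case True
        then have "w \<noteq> y" using y by auto
        then show ?thesis using y w anticommuting_word_mem[OF anticommuting_cr wI(1) True, of vac]
          by (simp add: ip_scale_right ip_word)
      next
        case False
        obtain w' s where w': "w' \<in> words" "set w' = insert i (set w)" "s = 1 \<or> s = - 1"
          "cr i (word w) = scale s (word w')"
          using insert_word_cr[OF w i False] by blast
        show ?thesis
        proof (cases "w = y")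
          case True
          then have xw: "x = w'" using w' y x \<open>i \<in> set x\<close> by (intro words_eqI) auto
          \<comment> \<open>Removing i and inserting it again reproduces x, which forces the two
            signs to agree.\<close>
          have "word x = scale t (scale s (word x))"
            using y(4) w'(4) True xw by simp
          then have "coef x (word x) = coef x (scale t (scale s (word x)))"
            by (rule arg_cong)
          then have "coef x (word x) = t * s * coef x (word x)"
            by (simp add: coef_scale)
          then have "t * s = 1" using x by (simp add: coef_word)
          then have "s = t" using w'(3) y(3) by auto
          then show ?thesis using w' y True xw x w'(3)
            by (auto simp: ip_scale_right ip_scale_left ip_word)
        next
          case False2: False
          have "w' \<noteq> x"
          proof
            assume "w' = x"
            then have "set w = set y" using w' y False by auto
            then show False using words_eqI[OF w y(1)] False2 by simp
          qed
          then show ?thesis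
            unfolding w'(4) y(5) using False2 x w w'(1) y(1)
            by (simp add: ip_scale_right ip_scale_left ip_word)
        qed
      qed
    qed
  qed (simp_all add: an_add an_scale ip_add_right ip_scale_right)
qed (simp_all add: cr_add cr_scale ip_add_left ip_scale_left)

end

section \<open>Modes of the generators\<close>

lemma gchoose_neg: "((of_int (- int u - 1) :: complex) gchoose k) = (-1) ^ k * of_nat ((u + k) choose k)"
proof -
  have "(of_int (- int u - 1) :: complex) = - of_nat (Suc u)" by simp
  then have "((of_int (- int u - 1) :: complex) gchoose k)
      = (-1) ^ k * ((of_nat (Suc u) + of_nat k - 1) gchoose k)"
    by (simp only: gbinomial_minus)
  also have "(of_nat (Suc u) + of_nat k - 1 :: complex) = of_nat (u + k)" by simp
  finally show ?thesis by (simp only: binomial_gbinomial)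
qed

context vertex_superalgebra
begin

lemma lin_span:
  assumes "x \<in> span S" "lin F" "subspace T" "\<And>s. s \<in> S \<Longrightarrow> F s \<in> T"
  shows "F x \<in> T"
  using assms(1)
proof (induction rule: span_induct_alt)
  case base
  show ?case by (simp add: lin_zero[OF assms(2)] subspace_0[OF assms(3)])
next
  case (step c x y)
  then show ?case
    using assms(4) by (simp add: lin_add[OF assms(2)] lin_scale[OF assms(2)] subspace_add[OF assms(3)]
        subspace_scale[OF assms(3)])
qed

end

context symplectic_fermion_algebra
begin

section \<open>Clifford relations of the modes\<close>

definition gen :: "nat \<Rightarrow> 'v" where
  "gen = (\<lambda>i. if i < n then e i else f (i - n))"

definition pairing :: "nat \<Rightarrow> nat \<Rightarrow> complex" where
  "pairing a b = (if b = a + n then 1 else if a = b + n then -1 else 0)"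

lemma gen_odd: "a < 2 * n \<Longrightarrow> gen a \<in> homog V True"
  using e_odd[of a] f_odd[of "a - n"] by (auto simp: gen_def)

lemma ope_gen:
  assumes "a < 2 * n" "b < 2 * n" "k \<ge> 0"
  shows "np (gen a) k (gen b) = (if k = 1 then sc (pairing a b) Om else 0)"
  using assms by (auto simp: gen_def pairing_def ope_ee ope_ff ope_ef ope_fe)

text \<open>Generators have at most a double pole and no simple one, so only j = 1 survives in the
  commutator formula, and it is a multiple of the identity.\<close>

lemma gen_anticommute:
  assumes "a < 2 * n" "b < 2 * n"
  shows "np (gen a) m (np (gen b) k v)
    = sc (if m + k = 0 then of_int m * pairing a b else 0) v - np (gen b) k (np (gen a) m v)"
proof -
  have "Sum_any (\<lambda>j. sc (of_int m gchoose j) (np (np (gen a) (int j) (gen b)) (m + k - int j) v))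
      = sc (of_int m gchoose 1) (np (np (gen a) (int 1) (gen b)) (m + k - int 1) v)"
    by (rule Sum_any_single) (simp add: ope_gen assms)
  also have "\<dots> = sc (if m + k = 0 then of_int m * pairing a b else 0) v"
    by (simp add: ope_gen assms vacuum_left)
  finally show ?thesis
    using commutator[OF gen_odd[OF assms(1)] gen_odd[OF assms(2)], of m k v] by simp
qed

definition idx :: "(nat \<times> nat) set" where "idx = {..<2 * n} \<times> UNIV"

definition before :: "nat \<times> nat \<Rightarrow> nat \<times> nat \<Rightarrow> bool" where
  "before = (\<lambda>(i, k) (j, l). i < j \<or> i = j \<and> l < k)"

definition cr :: "nat \<times> nat \<Rightarrow> 'v \<Rightarrow> 'v" where
  "cr p v = np (gen (fst p)) (- int (snd p) - 1) v"

definition dual :: "nat \<Rightarrow> nat" where "dual a = (if a < n then a + n else a - n)"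

text \<open>A positive mode of the conjugate generator. The factor 1/(k+1) and the sign of the
  symplectic form make its anticommutator with \<open>cr p\<close> exactly 1.\<close>

definition an :: "nat \<times> nat \<Rightarrow> 'v \<Rightarrow> 'v" where
  "an p v = sc (pairing (dual (fst p)) (fst p) / of_nat (Suc (snd p)))
     (np (gen (dual (fst p))) (int (Suc (snd p))) v)"

lemma idx_iff [simp]: "(a, k) \<in> idx \<longleftrightarrow> a < 2 * n"
  by (simp add: idx_def)

lemma dual_less [simp]: "a < 2 * n \<Longrightarrow> dual a < 2 * n"
  by (auto simp: dual_def)

lemma pbw_words_eq: "pbw_words V (2 * n) gen = sorted_words idx before"
proof -
  have "sorted_wrt (\<lambda>(i, k) (j, l). i < j \<or> i = j \<and> (if gen i \<in> homog V True then l < k else l \<le> k)) w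
      \<longleftrightarrow> sorted_wrt before w" if w: "fst ` set w \<subseteq> {..<2 * n}" for w
  proof (rule iffI; erule sorted_wrt_mono_rel[rotated])
    fix p q assume pq: "p \<in> set w" "q \<in> set w"
    have p: "fst p < 2 * n" using pq(1) w by auto
    show "before p q" if "(\<lambda>(i, k) (j, l). i < j \<or> i = j \<and> (if gen i \<in> homog V True then l < k else l \<le> k)) p q"
      using that p gen_odd[OF p] by (auto simp: before_def split: prod.splits if_splits)
    show "(\<lambda>(i, k) (j, l). i < j \<or> i = j \<and> (if gen i \<in> homog V True then l < k else l \<le> k)) p q" if "before p q"
      using that p gen_odd[OF p] by (auto simp: before_def split: prod.splits if_splits)
  qed
  moreover have "fst ` set w \<subseteq> {..<2 * n} \<longleftrightarrow> set w \<subseteq> idx" for w :: "(nat \<times> nat) list"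
    by (auto simp: idx_def)
  ultimately show ?thesis unfolding pbw_words_def sorted_words_def by blast
qed

definition word_fact :: "(nat \<times> nat) list \<Rightarrow> complex" where
  "word_fact w = prod_list (map (\<lambda>p. fact (snd p)) w)"

lemma word_fact_nonzero: "word_fact w \<noteq> 0"
  by (induction w) (auto simp: word_fact_def)

lemma pbw_monomial_eq: "pbw_monomial V gen w = sc (word_fact w) (foldr cr w Om)"
proof (induction w)
  case Nil
  then show ?case by (simp add: pbw_monomial_def wick_def word_fact_def)
next
  case (Cons p w)
  have "pbw_monomial V gen (p # w) = np ((der ^^ snd p) (gen (fst p))) (-1) (pbw_monomial V gen w)"
    by (simp add: pbw_monomial_def wick_def case_prod_unfold)
  also have "\<dots> = sc (fact (snd p)) (cr p (pbw_monomial V gen w))"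
    by (simp only: deriv_pow_mode cr_def)
  also have "\<dots> = sc (fact (snd p) * word_fact w) (cr p (foldr cr w Om))"
    unfolding Cons by (simp add: cr_def)
  finally show ?case by (simp add: word_fact_def)
qed

definition coef :: "(nat \<times> nat) list \<Rightarrow> 'v \<Rightarrow> complex" where
  "coef w v = word_fact w * representation (pbw_monomial V gen ` pbw_words V (2 * n) gen) v (pbw_monomial V gen w)"

lemma pbw:
  "inj_on (pbw_monomial V gen) (sorted_words idx before)"
  "independent (pbw_monomial V gen ` sorted_words idx before)"
  "span (pbw_monomial V gen ` sorted_words idx before) = UNIV"
  using free unfolding freely_generated_def gen_def[symmetric] pbw_words_eq by auto

lemma pairing_dual: "a < 2 * n \<Longrightarrow> b < 2 * n \<Longrightarrow> pairing (dual a) b = (if a = b then (if a < n then -1 else 1) else 0)"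
  by (auto simp: pairing_def dual_def)

text \<open>Words in the creation operators are the PBW monomials divided by
  \<open>word_fact\<close>, so freeness supplies the basis.\<close>

sublocale fk?: fock_space sc idx before cr an Om coef
proof unfold_locales
  show "before i j \<or> before j i" if "i \<in> idx" "j \<in> idx" "i \<noteq> j" for i j
    using that by (auto simp: before_def split: prod.splits)
  show "\<not> before i i" for i by (auto simp: before_def split: prod.splits)
  show "before i k" if "before i j" "before j k" for i j k
    using that by (auto simp: before_def split: prod.splits)
  show "cr i (u + v) = cr i u + cr i v" for i u v by (simp add: cr_def)
  show "cr i (sc c v) = sc c (cr i v)" for i c v by (simp add: cr_def)
  show "an i (u + v) = an i u + an i v" for i u v by (simp add: an_def scale_right_distrib)
  show "an i (sc c v) = sc c (an i v)" for i c v by (simp add: an_def mult.commute)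
  show "cr i (cr j v) = - cr j (cr i v)" if "i \<in> idx" "j \<in> idx" for i j v
    using that unfolding cr_def by (cases i; cases j) (subst gen_anticommute, auto)
  show "an i (cr j v) = (if i = j then v else 0) - cr j (an i v)" if ij: "i \<in> idx" "j \<in> idx" for i j v
  proof -
    obtain a k b l where [simp]: "i = (a, k)" "j = (b, l)" by (cases i; cases j) auto
    have ab: "a < 2 * n" "b < 2 * n" using ij by auto
    have "np (gen (dual a)) (int (Suc k)) (cr j v)
       = sc (if k = l then of_nat (Suc k) * pairing (dual a) b else 0) v
         - cr j (np (gen (dual a)) (int (Suc k)) v)"
      unfolding cr_def by (subst gen_anticommute) (use ab in auto)
    then show ?thesis unfolding an_def
      by (auto simp: pairing_dual ab cr_def scale_right_diff_distrib simp del: of_nat_Suc)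
  qed
  show "an i Om = 0" if "i \<in> idx" for i by (simp add: an_def vacuum_right_nonneg)
  show "coef w (u + v) = coef w u + coef w v" for w u v
    unfolding coef_def pbw_words_eq using pbw by (simp add: representation_add algebra_simps)
  show "coef w (sc c v) = c * coef w v" for w c v
    unfolding coef_def pbw_words_eq using pbw by (simp add: representation_scale)
  have word: "foldr cr w Om = sc (1 / word_fact w) (pbw_monomial V gen w)" for w
    using word_fact_nonzero[of w] by (simp add: pbw_monomial_eq)
  show "coef w (foldr cr w' Om) = (if w = w' then 1 else 0)"
    if w: "w \<in> sorted_words idx before" "w' \<in> sorted_words idx before" for w w'
  proof -
    have "representation (pbw_monomial V gen ` sorted_words idx before) (pbw_monomial V gen w')
        = (\<lambda>v. if v = pbw_monomial V gen w' then 1 else 0)"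
      using pbw w by (intro representation_basis) auto
    moreover have "pbw_monomial V gen w = pbw_monomial V gen w' \<longleftrightarrow> w = w'"
      using inj_on_eq_iff[OF pbw(1) w] .
    ultimately show ?thesis
      unfolding coef_def pbw_words_eq word using pbw word_fact_nonzero[of w] word_fact_nonzero[of w']
      by (simp add: representation_scale)
  qed
  show "span ((\<lambda>w. foldr cr w Om) ` sorted_words idx before) = UNIV"
  proof -
    have "pbw_monomial V gen ` sorted_words idx before
        \<subseteq> span ((\<lambda>w. foldr cr w Om) ` sorted_words idx before)"
      unfolding pbw_monomial_eq
      by (rule image_subsetI, rule span_scale, rule span_base, rule imageI)
    then have "span (pbw_monomial V gen ` sorted_words idx before)
        \<subseteq> span ((\<lambda>w. foldr cr w Om) ` sorted_words idx before)"
      by (intro span_minimal subspace_span)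
    then show ?thesis using pbw(3) by auto
  qed
qed

text \<open>The factor m in \<open>gen_anticommute\<close> makes zero modes anticommute with all
  creation operators, and they kill the vacuum. Thus up to scalars the nonzero modes are creation
  and annihilation operators.\<close>

lemma gen_zero_mode:
  assumes "a < 2 * n"
  shows "np (gen a) 0 v = 0"
proof (induction v rule: word_induct)
  case (word w)
  then have "set w \<subseteq> idx" by (simp add: sorted_words_def)
  then show ?case
  proof (induction w)
    case Nil
    then show ?case by (simp add: vacuum_right_nonneg)
  next
    case (Cons p w)
    obtain b k where [simp]: "p = (b, k)" by (cases p)
    have "b < 2 * n" using Cons.prems by simp
    then have "np (gen a) 0 (cr p (word w)) = - cr p (np (gen a) 0 (word w))"
      unfolding cr_def by (subst gen_anticommute) (use assms in auto)
    then show ?case using Cons by simp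
  qed
qed simp_all

section \<open>Quadratic operators and Wick multiplication by quadratic vectors\<close>

definition qop :: "nat \<times> nat \<Rightarrow> 'v \<Rightarrow> 'v" where
  "qop p v = (\<Sum>i<n. cr (i, fst p) (cr (n + i, snd p) v))"

definition qv :: "nat \<times> nat \<Rightarrow> 'v" where "qv p = qop p Om"

lemma qop_add: "qop p (u + v) = qop p u + qop p v"
  and qop_scale: "qop p (sc c v) = sc c (qop p v)"
  by (simp_all add: qop_def cr_add cr_scale sum.distrib scale_sum_right)

lemma lin_qop: "lin (qop p)" by (intro linI qop_add qop_scale)
lemma lin_cr: "lin (cr p)" by (intro linI cr_add cr_scale)
lemma lin_an: "lin (an p)" by (intro linI an_add an_scale)

lemma cr_Om: "cr (a, k) Om = np (gen a) (- int k - 1) Om"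
  by (simp add: cr_def)

lemma qv_even: "qv p \<in> homog V False"
proof -
  have "cr (i, fst p) (cr (n + i, snd p) Om) \<in> homog V False" if "i < n" for i
    using nprod_homog[OF gen_odd[of i] nprod_homog[OF gen_odd[of "n + i"] vacuum_even,
       of "- int (snd p) - 1"], of "- int (fst p) - 1"] that by (simp add: cr_def)
  then show ?thesis unfolding qv_def qop_def by (intro homog_sum') auto
qed

text \<open>Only the conjugate factor of q_{k,l} can be contracted, at exactly one pole order; the
  other factor is left over.\<close>

lemma gen_mode_qv:
  assumes i: "i < n"
  shows "np (gen i) (int j) (qv (k, l)) = (if j = Suc l then sc (- of_nat (Suc l)) (cr (i, k) Om) else 0)"
    and "np (gen (n + i)) (int j) (qv (k, l)) = (if j = Suc k then sc (- of_nat (Suc k)) (cr (n + i, l) Om) else 0)"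
proof -
  have gO: "np (gen a) (int j) Om = 0" for a by (simp add: vacuum_right_nonneg)
  have a1: "np (gen i) (int j) (cr (i', k) X) = - cr (i', k) (np (gen i) (int j) X)" if "i' < n" for i' X
    using gen_anticommute[of i i' "int j" "- int k - 1" X] i that by (simp add: cr_def pairing_def)
  have b1: "np (gen i) (int j) (cr (n + i', l) Om) = (if i' = i \<and> j = Suc l then sc (of_nat (Suc l)) Om else 0)"
    if "i' < n" for i'
    using gen_anticommute[of i "n + i'" "int j" "- int l - 1" Om] i that by (auto simp add: cr_def pairing_def gO)
  have 1: "np (gen i) (int j) (cr (i', k) (cr (n + i', l) Om))
      = (if i' = i then if j = Suc l then sc (- of_nat (Suc l)) (cr (i, k) Om) else 0 else 0)" if "i' < n" for i'
    using that by (simp add: a1 b1 cr_scale del: of_nat_Suc)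
  show "np (gen i) (int j) (qv (k, l)) = (if j = Suc l then sc (- of_nat (Suc l)) (cr (i, k) Om) else 0)"
    using i by (simp add: qv_def qop_def 1 sum.delta del: of_nat_Suc)
  have a2: "np (gen (n + i)) (int j) (cr (i', k) X)
      = sc (if i' = i \<and> j = Suc k then - of_nat (Suc k) else 0) X - cr (i', k) (np (gen (n + i)) (int j) X)"
    if "i' < n" for i' X
    using gen_anticommute[of "n + i" i' "int j" "- int k - 1" X] i that by (auto simp add: cr_def pairing_def)
  have b2: "np (gen (n + i)) (int j) (cr (n + i', l) Om) = 0" if "i' < n" for i'
    using gen_anticommute[of "n + i" "n + i'" "int j" "- int l - 1" Om] i that by (simp add: cr_def pairing_def gO)
  have 2: "np (gen (n + i)) (int j) (cr (i', k) (cr (n + i', l) Om))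
      = (if i' = i then if j = Suc k then sc (- of_nat (Suc k)) (cr (n + i, l) Om) else 0 else 0)" if "i' < n" for i'
    using that by (simp add: a2 b2 del: of_nat_Suc)
  show "np (gen (n + i)) (int j) (qv (k, l)) = (if j = Suc k then sc (- of_nat (Suc k)) (cr (n + i, l) Om) else 0)"
    using i by (simp add: qv_def qop_def 2 sum.delta del: of_nat_Suc)
qed

lemma gen_qv_commute:
  assumes i: "i < n"
  shows "np (gen i) m (np (qv (k, l)) p v) = np (qv (k, l)) p (np (gen i) m v)
      - sc (of_nat (Suc l) * (of_int m gchoose Suc l)) (np (cr (i, k) Om) (m + p - int (Suc l)) v)"
    and "np (gen (n + i)) m (np (qv (k, l)) p v) = np (qv (k, l)) p (np (gen (n + i)) m v)
      - sc (of_nat (Suc k) * (of_int m gchoose Suc k)) (np (cr (n + i, l) Om) (m + p - int (Suc k)) v)"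
proof -
  have letter: "i < 2 * n" "n + i < 2 * n" using i by auto
  have "Sum_any (\<lambda>j. sc (of_int m gchoose j) (np (np (gen i) (int j) (qv (k, l))) (m + p - int j) v))
      = sc (of_int m gchoose Suc l) (np (np (gen i) (int (Suc l)) (qv (k, l))) (m + p - int (Suc l)) v)"
    by (rule Sum_any_single) (simp add: gen_mode_qv[OF i])
  then show "np (gen i) m (np (qv (k, l)) p v) = np (qv (k, l)) p (np (gen i) m v)
      - sc (of_nat (Suc l) * (of_int m gchoose Suc l)) (np (cr (i, k) Om) (m + p - int (Suc l)) v)"
    unfolding commutator[OF gen_odd[OF letter(1)] qv_even]
    by (simp add: gen_mode_qv[OF i] mult.commute del: of_nat_Suc)
  have "Sum_any (\<lambda>j. sc (of_int m gchoose j) (np (np (gen (n + i)) (int j) (qv (k, l))) (m + p - int j) v))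
      = sc (of_int m gchoose Suc k) (np (np (gen (n + i)) (int (Suc k)) (qv (k, l))) (m + p - int (Suc k)) v)"
    by (rule Sum_any_single) (simp add: gen_mode_qv[OF i])
  then show "np (gen (n + i)) m (np (qv (k, l)) p v) = np (qv (k, l)) p (np (gen (n + i)) m v)
      - sc (of_nat (Suc k) * (of_int m gchoose Suc k)) (np (cr (n + i, l) Om) (m + p - int (Suc k)) v)"
    unfolding commutator[OF gen_odd[OF letter(2)] qv_even]
    by (simp add: gen_mode_qv[OF i] mult.commute del: of_nat_Suc)
qed

text \<open>The first binomial, with its factor l+1, comes from contracting the mode -u-1 with a
  factor of index l; the second from rewriting a mode of the remaining divided derivative of order k
  as a mode of the generator.\<close>

definition shift_coeff :: "nat \<Rightarrow> nat \<Rightarrow> nat \<Rightarrow> nat" where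
  "shift_coeff l k u = Suc l * ((u + Suc l) choose Suc l) * ((u + l + 2 + k) choose k)"

definition qA :: "nat \<times> nat \<Rightarrow> 'v \<Rightarrow> 'v" where "qA p v = np (qv p) (-1) v"

text \<open>The contraction leaves a creation operator of the same generator whose mode is raised by
  the weight k+l+2. The signs (-1)^l and (-1)^k disappear for even indices, which the positivity
  argument exploits.\<close>

lemma cr_qA:
  assumes i: "i < n"
  shows "cr (i, u) (qA (k, l) v) = qA (k, l) (cr (i, u) v)
      + sc ((-1) ^ l * of_nat (shift_coeff l k u)) (cr (i, u + k + l + 2) v)"
    and "cr (n + i, u) (qA (k, l) v) = qA (k, l) (cr (n + i, u) v)
      + sc ((-1) ^ k * of_nat (shift_coeff k l u)) (cr (n + i, u + k + l + 2) v)"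
proof -
  have s: "(-1::complex) ^ k * ((-1) ^ k * x) = x" for k x
    by (simp add: power_mult_distrib[symmetric] flip: mult.assoc)
  have g: "(of_int (- int u - 1) gchoose Suc l) * ((-1) ^ k * (of_int (- int u - 1 + - 1 - int (Suc l)) gchoose k))
     = (- 1 :: complex) ^ Suc l * of_nat (((u + Suc l) choose Suc l) * ((u + l + 2 + k) choose k))" for k l
  proof -
    have "- int u - 1 + - 1 - int (Suc l) = - int (u + l + 2) - 1" by simp
    then show ?thesis unfolding gchoose_neg by (simp only: gchoose_neg s of_nat_mult) (simp add: algebra_simps s)
  qed
  have sgn: "of_nat A * ((- 1) ^ Suc l * of_nat B) = - ((- 1 :: complex) ^ l * of_nat (A * B))" for A B l :: nat
    by simp
  have m: "- int u - 1 + - 1 - int (Suc l) - int k = - int (u + k + l + 2) - 1" for k l by simp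
  have m': "- int u - 1 + - 1 - int (Suc k) - int l = - int (u + k + l + 2) - 1" for k l by simp
  have "cr (i, u) (qA (k, l) v) = qA (k, l) (cr (i, u) v)
     - sc (of_nat (Suc l) * ((of_int (- int u - 1) gchoose Suc l) *
         ((-1) ^ k * (of_int (- int u - 1 + - 1 - int (Suc l)) gchoose k)))) (cr (i, u + k + l + 2) v)"
    unfolding cr_def qA_def fst_conv snd_conv gen_qv_commute[OF i]
    unfolding mode_vac_mode[of "gen i" k] m scale_scale by (simp only: mult.assoc)
  then show "cr (i, u) (qA (k, l) v) = qA (k, l) (cr (i, u) v)
      + sc ((-1) ^ l * of_nat (shift_coeff l k u)) (cr (i, u + k + l + 2) v)"
    unfolding g sgn unfolding shift_coeff_def
    by (simp only: scale_minus_left diff_minus_eq_add mult.assoc)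
  have "cr (n + i, u) (qA (k, l) v) = qA (k, l) (cr (n + i, u) v)
     - sc (of_nat (Suc k) * ((of_int (- int u - 1) gchoose Suc k) *
         ((-1) ^ l * (of_int (- int u - 1 + - 1 - int (Suc k)) gchoose l)))) (cr (n + i, u + k + l + 2) v)"
    unfolding cr_def qA_def fst_conv snd_conv gen_qv_commute[OF i]
    unfolding mode_vac_mode[of "gen (n + i)" l] m' scale_scale by (simp only: mult.assoc)
  then show "cr (n + i, u) (qA (k, l) v) = qA (k, l) (cr (n + i, u) v)
      + sc ((-1) ^ k * of_nat (shift_coeff k l u)) (cr (n + i, u + k + l + 2) v)"
    unfolding g sgn unfolding shift_coeff_def
    by (simp only: scale_minus_left diff_minus_eq_add mult.assoc)
qed

lemma lin_qA: "lin (qA p)" unfolding qA_def by (rule nprod_linear_right)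

lemma qA_Om: "qA p Om = qv p" by (simp add: qA_def vacuum_right)

lemma qop_qA:
  "qop (u, v) (qA (k, l) x) = qA (k, l) (qop (u, v) x)
     + sc ((-1) ^ l * of_nat (shift_coeff l k u)) (qop (u + k + l + 2, v) x)
     + sc ((-1) ^ k * of_nat (shift_coeff k l v)) (qop (u, v + k + l + 2) x)"
proof -
  have "cr (i, u) (cr (n + i, v) (qA (k, l) x)) = qA (k, l) (cr (i, u) (cr (n + i, v) x))
     + sc ((-1) ^ l * of_nat (shift_coeff l k u)) (cr (i, u + k + l + 2) (cr (n + i, v) x))
     + sc ((-1) ^ k * of_nat (shift_coeff k l v)) (cr (i, u) (cr (n + i, v + k + l + 2) x))" if "i < n" for i
    using that by (simp add: cr_qA cr_add cr_scale)
  then show ?thesis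
    by (simp add: qop_def lin_sum[OF lin_qA] scale_sum_right sum.distrib)
qed

lemma qop_commute: "qop p (qop q v) = qop q (qop p v)"
proof -
  have c: "cr (i, k) (cr (n + i, l) (cr (j, u) (cr (n + j, w) v)))
      = cr (j, u) (cr (n + j, w) (cr (i, k) (cr (n + i, l) v)))" if "i < n" "j < n" for i j k l u w
  proof -
    have "cr (i, k) (cr (n + i, l) (cr (j, u) (cr (n + j, w) v)))
       = - cr (i, k) (cr (j, u) (cr (n + i, l) (cr (n + j, w) v)))"
      using that cr_cr[of "(n + i, l)" "(j, u)"] by (simp add: cr_minus)
    also have "\<dots> = cr (j, u) (cr (i, k) (cr (n + i, l) (cr (n + j, w) v)))"
      using that cr_cr[of "(i, k)" "(j, u)"] by simp
    also have "\<dots> = - cr (j, u) (cr (i, k) (cr (n + j, w) (cr (n + i, l) v)))"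
      using that cr_cr[of "(n + i, l)" "(n + j, w)"] by (simp add: cr_minus)
    also have "\<dots> = cr (j, u) (cr (n + j, w) (cr (i, k) (cr (n + i, l) v)))"
      using that cr_cr[of "(i, k)" "(n + j, w)"] by (simp add: cr_minus)
    finally show ?thesis .
  qed
  show ?thesis
    unfolding qop_def lin_sum[OF lin_cr] by (subst sum.swap) (simp add: c)
qed

section \<open>Conformal weight\<close>

lemma conformal_vector_eq: "conformal_vector V n e f = - qv (0, 0)"
  by (simp add: conformal_vector_def qv_def qop_def wick_def cr_def gen_def)

abbreviation Lc :: 'v where "Lc \<equiv> conformal_vector V n e f"

lemma Lc_even: "Lc \<in> homog V False"
  unfolding conformal_vector_eq using homog_scale[OF qv_even, of "-1" "(0,0)"] by simp

lemma Lc_gen: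
  assumes "a < 2 * n"
  shows "np Lc p (np (gen a) m v) = np (gen a) m (np Lc p v) - sc (of_int m) (np (gen a) (m + p - 1) v)"
proof (cases "a < n")
  case True
  then show ?thesis
    unfolding conformal_vector_eq by (simp add: gen_qv_commute cr_Om vacuum_right)
next
  case False
  then obtain i where [simp]: "a = n + i" and i: "i < n" using assms le_Suc_ex[of n a] by auto
  show ?thesis using i
    unfolding conformal_vector_eq by (simp add: gen_qv_commute cr_Om vacuum_right)
qed

text \<open>Both operators have the same commutators with the modes of the generators and annihilate
  the vacuum.\<close>

lemma Lc_0: "np Lc 0 v = der v"
proof (induction v rule: word_induct)
  case (word w)
  then have "set w \<subseteq> idx" by (simp add: sorted_words_def)
  then show ?case
  proof (induction w)
    case (Cons q w)
    then show ?case
      by (cases q) (simp add: cr_def Lc_gen deriv_np')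
  qed (simp add: vacuum_right_nonneg)
qed simp_all

text \<open>Integer weights allow annihilation operators to be applied without case distinctions; by
  \<open>ws_neg\<close> the negative weight spaces are zero.\<close>

definition ws :: "int \<Rightarrow> 'v set" where "ws d = {v. np Lc 1 v = sc (of_int d) v}"

lemma subspace_ws: "subspace (ws d)"
  by (rule subspaceI) (auto simp: ws_def scale_right_distrib mult.commute)

lemma ws_np:
  assumes a: "a \<in> ws x" and b: "b \<in> ws y"
  shows "np a k b \<in> ws (x + y - k - 1)"
proof -
  have "np Lc 1 (np a k b) = np a k (np Lc 1 b) + np (der a) (k + 1) b + np (np Lc 1 a) k b" for a
  proof (induction a rule: homog_induct)
    case (homog p a)
    have "Sum_any (\<lambda>j. sc (of_int 1 gchoose j) (np (np Lc (int j) a) (1 + k - int j) b))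
        = (\<Sum>j<2. sc (of_int 1 gchoose j) (np (np Lc (int j) a) (1 + k - int j) b))"
    proof (rule Sum_any_eventually)
      fix j :: nat assume "j \<ge> 2"
      have "((1 :: complex) gchoose j) = of_nat (1 choose j)"
        by (simp only: binomial_gbinomial of_nat_1)
      also have "1 choose j = 0" using \<open>2 \<le> j\<close> by (intro binomial_eq_0) simp
      finally have "((1 :: complex) gchoose j) = 0" by simp
      then show "sc (of_int 1 gchoose j) (np (np Lc (int j) a) (1 + k - int j) b) = 0" by simp
    qed
    also have "\<dots> = np (der a) (k + 1) b + np (np Lc 1 a) k b"
      by (simp add: Lc_0 add.commute[of 1 k] numeral_2_eq_2)
    finally show ?case
      unfolding commutator[OF Lc_even homog] by (simp add: add.assoc)
  next
    case (add u v)
    then show ?case by simp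
  qed
  moreover have "sc (of_int y) X + sc (- of_int (k + 1)) X + sc (of_int x) X
      = sc (of_int (x + y - k - 1)) X" for X
    unfolding scale_left_distrib[symmetric] by (rule arg_cong[where f = "\<lambda>c. sc c X"]) simp
  ultimately show ?thesis using a b
    by (simp add: ws_def np_deriv_left)
qed

lemma Om_ws: "Om \<in> ws 0"
  by (simp add: ws_def vacuum_right_nonneg)

lemma cr_ws:
  assumes "v \<in> ws d" "a < 2 * n"
  shows "cr (a, k) v \<in> ws (d + int k + 1)"
proof -
  have "sc (of_int d) X - sc (of_int (- int k - 1)) X = sc (of_int (d + int k + 1)) X" for X
    unfolding scale_left_diff_distrib[symmetric] by (rule arg_cong[where f = "\<lambda>c. sc c X"]) simp
  then show ?thesis using assms
    by (simp add: ws_def cr_def Lc_gen)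
qed

end

section \<open>Invariants and automorphisms\<close>

context symplectic_fermion_algebra
begin

definition mon :: "(nat \<times> nat) list \<Rightarrow> 'v" where "mon ps = foldr qop ps Om"

text \<open>The weight of q_{k,l}. The same sum is the weight of the k-th derivative of h^j, so
  \<open>wt\<close> serves later for words in both alphabets.\<close>

definition qwt :: "nat \<times> nat \<Rightarrow> nat" where "qwt p = fst p + snd p + 2"

definition wt :: "(nat \<times> nat) list \<Rightarrow> nat" where "wt ps = sum_list (map qwt ps)"

lemma mon_Nil [simp]: "mon [] = Om" and mon_Cons [simp]: "mon (p # ps) = qop p (mon ps)"
  by (simp_all add: mon_def)

lemma wt_Nil [simp]: "wt [] = 0" and wt_Cons [simp]: "wt (p # ps) = qwt p + wt ps"
  by (simp_all add: wt_def)

lemma qop_ws: "v \<in> ws d \<Longrightarrow> qop p v \<in> ws (d + int (qwt p))"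
proof -
  assume v: "v \<in> ws d"
  have "cr (i, fst p) (cr (n + i, snd p) v) \<in> ws (d + int (qwt p))" if "i < n" for i
  proof -
    have eq: "d + int (snd p) + 1 + int (fst p) + 1 = d + int (qwt p)" by (simp add: qwt_def)
    have "cr (i, fst p) (cr (n + i, snd p) v) \<in> ws (d + int (snd p) + 1 + int (fst p) + 1)"
      by (intro cr_ws v) (use that in auto)
    then show ?thesis by (simp only: eq)
  qed
  then show ?thesis unfolding qop_def by (intro subspace_sum[OF subspace_ws]) auto
qed

lemma mon_ws: "mon ps \<in> ws (int (wt ps))"
proof (induction ps)
  case (Cons p ps)
  then show ?case using qop_ws[of "mon ps" "int (wt ps)" p] by (simp add: add.commute)
qed (simp add: Om_ws)

definition up1 :: "nat \<times> nat \<Rightarrow> nat \<times> nat \<Rightarrow> nat \<times> nat" where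
  "up1 p r = (fst r + qwt p, snd r)"
definition up2 :: "nat \<times> nat \<Rightarrow> nat \<times> nat \<Rightarrow> nat \<times> nat" where
  "up2 p r = (fst r, snd r + qwt p)"
definition co1 :: "nat \<times> nat \<Rightarrow> nat \<times> nat \<Rightarrow> complex" where
  "co1 p r = (-1) ^ snd p * of_nat (shift_coeff (snd p) (fst p) (fst r))"
definition co2 :: "nat \<times> nat \<Rightarrow> nat \<times> nat \<Rightarrow> complex" where
  "co2 p r = (-1) ^ fst p * of_nat (shift_coeff (fst p) (snd p) (snd r))"

lemma qop_qA': "qop r (qA p x) = qA p (qop r x) + sc (co1 p r) (qop (up1 p r) x) + sc (co2 p r) (qop (up2 p r) x)"
  using qop_qA[of "fst r" "snd r" "fst p" "snd p" x]
  by (simp add: co1_def co2_def up1_def up2_def qwt_def add.assoc)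

definition shifts :: "nat \<times> nat \<Rightarrow> (nat \<times> nat) list \<Rightarrow> nat \<Rightarrow> 'v" where
  "shifts p ps j = sc (co1 p (ps ! j)) (mon (ps[j := up1 p (ps ! j)]))
     + sc (co2 p (ps ! j)) (mon (ps[j := up2 p (ps ! j)]))"

lemma qop_shifts: "qop r (shifts p ps j) = shifts p (r # ps) (Suc j)"
  by (simp add: shifts_def qop_add qop_scale)

text \<open>\<open>qop p\<close> and \<open>qA p\<close> agree on the vacuum. The former commutes
  with every letter of the monomial; the latter passes a letter at the cost of two shift
  terms.\<close>

lemma qop_mon: "qop p (mon ps) = qA p (mon ps) + (\<Sum>j<length ps. shifts p ps j)"
proof (induction ps)
  case Nil
  then show ?case by (simp add: qA_Om qv_def)
next
  case (Cons r ps)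
  have "qop p (mon (r # ps)) = qop r (qop p (mon ps))"
    by (simp add: qop_commute[of p r])
  also have "\<dots> = qop r (qA p (mon ps)) + (\<Sum>j<length ps. shifts p (r # ps) (Suc j))"
    unfolding Cons by (simp add: qop_add lin_sum[OF lin_qop] qop_shifts)
  also have "qop r (qA p (mon ps)) = qA p (mon (r # ps)) + shifts p (r # ps) 0"
    by (simp add: qop_qA' shifts_def)
  finally show ?case
    by (simp only: length_Cons sum.lessThan_Suc_shift add.assoc)
qed

text \<open>Induction invariant for the pigeonhole relation: the vacuum is killed by any n+1
  operators x_{i,0}, since one repeats, and each factor q_{0,l} uses up one of them. For s = 0 the
  condition says v = 0.\<close>

definition killed :: "nat \<Rightarrow> 'v \<Rightarrow> bool" where
  "killed s v \<longleftrightarrow> (\<forall>xs. set xs \<subseteq> {..<n} \<longrightarrow> length xs = s \<longrightarrow> foldr cr (map (\<lambda>i. (i, 0)) xs) v = 0)"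

lemma foldr_cr_not_distinct:
  assumes "set w \<subseteq> idx" "\<not> distinct w"
  shows "foldr cr w v = 0"
  using assms
proof (induction w)
  case (Cons p w)
  show ?case
  proof (cases "p \<in> set w")
    case True
    then show ?thesis using anticommuting_word_mem[OF anticommuting_cr, of w p v] Cons.prems by simp
  qed (use Cons in auto)
qed simp

lemma foldr_cr_cr:
  assumes "set w \<subseteq> idx" "q \<in> idx"
  shows "\<exists>s. foldr cr w (cr q v) = sc s (cr q (foldr cr w v))"
  using assms(1)
proof (induction w)
  case Nil
  then show ?case by (auto intro!: exI[of _ 1])
next
  case (Cons p w)
  then obtain s where s: "foldr cr w (cr q v) = sc s (cr q (foldr cr w v))" by auto
  have "cr p (cr q (foldr cr w v)) = - cr q (cr p (foldr cr w v))"
    using cr_cr[of p q] Cons.prems assms(2) by simp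
  then have "foldr cr (p # w) (cr q v) = sc (- s) (cr q (foldr cr (p # w) v))"
    by (simp add: s cr_scale)
  then show ?case by blast
qed

lemma killed_cr:
  assumes "killed s v" "q \<in> idx"
  shows "killed s (cr q v)"
  unfolding killed_def
proof (intro allI impI)
  fix xs assume xs: "set xs \<subseteq> {..<n}" "length xs = s"
  have "set (map (\<lambda>i. (i, 0)) xs) \<subseteq> idx" using xs by (auto simp: idx_def)
  from foldr_cr_cr[OF this assms(2), of v] obtain c where
    "foldr cr (map (\<lambda>i. (i, 0)) xs) (cr q v) = sc c (cr q (foldr cr (map (\<lambda>i. (i, 0)) xs) v))" by blast
  also have "foldr cr (map (\<lambda>i. (i, 0)) xs) v = 0" using assms(1) xs unfolding killed_def by blast
  finally show "foldr cr (map (\<lambda>i. (i, 0)) xs) (cr q v) = 0" by simp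
qed

lemma foldr_cr_sum: "foldr cr w (sum g A) = (\<Sum>i\<in>A. foldr cr w (g i))"
  by (induction w) (simp_all add: lin_sum[OF lin_cr])

lemma killed_qop:
  assumes "killed (Suc s) v"
  shows "killed s (qop (0, l) v)"
  unfolding killed_def
proof (intro allI impI)
  fix xs assume xs: "set xs \<subseteq> {..<n}" "length xs = s"
  have "foldr cr (map (\<lambda>i. (i, 0)) xs) (cr (i, 0) (cr (n + i, l) v)) = 0" if i: "i < n" for i
  proof -
    have "killed (Suc s) (cr (n + i, l) v)" by (rule killed_cr[OF assms]) (use i in simp)
    then have "foldr cr (map (\<lambda>i. (i, 0)) (xs @ [i])) (cr (n + i, l) v) = 0"
      unfolding killed_def by (rule allE[of _ "xs @ [i]"]) (use xs i in auto)
    then show ?thesis by simp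
  qed
  then show "foldr cr (map (\<lambda>i. (i, 0)) xs) (qop (0, l) v) = 0"
    by (simp add: qop_def foldr_cr_sum)
qed

text \<open>The pigeonhole relation: only \<open>n\<close> of the odd elements \<open>e\<^sub>i\<close> are available.\<close>

lemma mon_eq_0:
  assumes "\<forall>p\<in>set ps. fst p = 0" "length ps = Suc n"
  shows "mon ps = 0"
proof -
  have "killed s (mon ps)" if "s + length ps = Suc n" "\<forall>p\<in>set ps. fst p = 0" for s ps
    using that
  proof (induction ps arbitrary: s)
    case Nil
    show ?case unfolding killed_def
    proof (intro allI impI)
      fix xs :: "nat list" assume xs: "set xs \<subseteq> {..<n}" "length xs = s"
      have "\<not> distinct xs"
      proof
        assume "distinct xs"
        then have "length xs = card (set xs)" by (simp add: distinct_card)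
        also have "\<dots> \<le> n" using card_mono[OF _ xs(1)] by simp
        finally show False using xs Nil by simp
      qed
      then have "\<not> distinct (map (\<lambda>i. (i, 0::nat)) xs)" by (simp add: distinct_map inj_on_def)
      then show "foldr cr (map (\<lambda>i. (i, 0)) xs) (mon []) = 0"
        by (intro foldr_cr_not_distinct) (use xs in \<open>auto simp: idx_def\<close>)
    qed
  next
    case (Cons p ps)
    then have "killed (Suc s) (mon ps)" by auto
    then show ?case using killed_qop[of s "mon ps" "snd p"] Cons.prems by (cases p) auto
  qed
  from this[of 0 ps] assms show ?thesis by (simp add: killed_def)
qed

section \<open>The invariant subalgebra\<close>

abbreviation GL :: "('v \<Rightarrow> 'v) set" where "GL \<equiv> GL_group V n e f"
abbreviation W :: "'v set" where "W \<equiv> invariants GL"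

lemma GL_D:
  assumes "\<phi> \<in> GL"
  shows "lin \<phi>" "\<phi> Om = Om" "\<phi> (np a k b) = np (\<phi> a) k (\<phi> b)"
  using assms by (auto simp: GL_group_def automorphism_def)

lemma subspace_W: "subspace W"
  by (rule subspaceI)
     (auto simp: invariants_def lin_add[OF GL_D(1)] lin_scale[OF GL_D(1)] lin_zero[OF GL_D(1)])

lemma W_np:
  assumes "a \<in> W" "b \<in> W"
  shows "np a k b \<in> W"
  unfolding invariants_def
proof (rule CollectI, rule ballI)
  fix \<phi> assume \<phi>: "\<phi> \<in> GL"
  then have "\<phi> a = a" "\<phi> b = b" using assms by (auto simp: invariants_def)
  then show "\<phi> (np a k b) = np a k b" by (simp add: GL_D(3)[OF \<phi>])
qed

lemma W_Om: "Om \<in> W" by (simp add: invariants_def GL_D(2))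

lemma W_der: "a \<in> W \<Longrightarrow> der a \<in> W"
  unfolding deriv_op_def by (intro W_np W_Om)

lemma mat_mult_entry:
  assumes "A \<in> carrier_mat n n" "B \<in> carrier_mat n n" "A * B = 1\<^sub>m n" "j < n" "l < n"
  shows "(\<Sum>i<n. A $$ (j, i) * B $$ (i, l)) = (if j = l then 1 else (0 :: complex))"
proof -
  have "(A * B) $$ (j, l) = (\<Sum>i = 0..<n. A $$ (j, i) * B $$ (i, l))"
    using assms(1,2,4,5) by (auto simp: scalar_prod_def)
  then show ?thesis using assms by (simp add: atLeast0LessThan)
qed

text \<open>The sum of e_i tensor f_i is GL(n)-invariant because A and B are mutually inverse. As k
  and l are arbitrary, this covers \<open>qop\<close> and, with positive modes, its adjoint.\<close>

lemma W_bilinear: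
  assumes v: "v \<in> W"
  shows "(\<Sum>i<n. np (gen i) k (np (gen (n + i)) l v)) \<in> W"
proof -
  have "\<phi> (\<Sum>i<n. np (e i) k (np (f i) l v)) = (\<Sum>i<n. np (e i) k (np (f i) l v))" if \<phi>: "\<phi> \<in> GL" for \<phi>
  proof -
    obtain A B where AB: "A \<in> carrier_mat n n" "B \<in> carrier_mat n n" "A * B = 1\<^sub>m n"
      "\<forall>i<n. \<phi> (e i) = (\<Sum>j<n. sc (A $$ (j, i)) (e j))"
      "\<forall>i<n. \<phi> (f i) = (\<Sum>j<n. sc (B $$ (i, j)) (f j))"
      using \<phi> by (auto simp: GL_group_def)
    have "\<phi> v = v" using v \<phi> by (simp add: invariants_def)
    then have "\<phi> (\<Sum>i<n. np (e i) k (np (f i) l v))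
      = (\<Sum>i<n. \<Sum>m<n. \<Sum>j<n. sc (A $$ (j, i) * B $$ (i, m)) (np (e j) k (np (f m) l v)))"
      using AB by (simp add: lin_sum[OF GL_D(1)[OF \<phi>]] GL_D(3)[OF \<phi>] scale_sum_right mult.commute)
    also have "\<dots> = (\<Sum>m<n. \<Sum>j<n. \<Sum>i<n. sc (A $$ (j, i) * B $$ (i, m)) (np (e j) k (np (f m) l v)))"
      by (subst sum.swap, rule sum.cong[OF refl], subst sum.swap, rule refl)
    also have "\<dots> = (\<Sum>m<n. \<Sum>j<n. sc (if j = m then 1 else 0) (np (e j) k (np (f m) l v)))"
      by (intro sum.cong refl) (simp add: mat_mult_entry[OF AB(1-3)] flip: scale_sum_left)
    also have "\<dots> = (\<Sum>j<n. np (e j) k (np (f j) l v))"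
      by (intro sum.cong refl) (simp add: if_distrib[of "\<lambda>c. sc c _"] sum.delta cong: if_cong)
    finally show ?thesis .
  qed
  then show ?thesis by (simp add: invariants_def gen_def)
qed

lemma W_qop: "v \<in> W \<Longrightarrow> qop p v \<in> W"
  unfolding qop_def cr_def fst_conv snd_conv by (rule W_bilinear)

lemma mon_W: "mon ps \<in> W"
  by (induction ps) (simp_all add: W_Om W_qop)

section \<open>Automorphisms attached to invertible matrices\<close>

definition block :: "complex mat \<Rightarrow> complex mat \<Rightarrow> nat \<Rightarrow> nat \<Rightarrow> complex" where
  "block A B c a = (if a < n \<and> c < n then A $$ (c, a) else if a \<ge> n \<and> c \<ge> n then B $$ (a - n, c - n) else 0)"

definition gen_img :: "complex mat \<Rightarrow> complex mat \<Rightarrow> nat \<Rightarrow> 'v" where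
  "gen_img A B a = (\<Sum>c<2 * n. sc (block A B c a) (gen c))"

lemma sum_double: "(\<Sum>c<2 * n. h c) = (\<Sum>c<n. h c) + (\<Sum>c<n. h (n + c))" for h :: "nat \<Rightarrow> 'b :: comm_monoid_add"
proof -
  have "{..<2 * n} = {..<n} \<union> {n..<2 * n}" by auto
  then have "(\<Sum>c<2 * n. h c) = (\<Sum>c\<in>{..<n} \<union> {n..<2 * n}. h c)"
    by (rule arg_cong)
  also have "\<dots> = (\<Sum>c<n. h c) + (\<Sum>c\<in>{n..<2 * n}. h c)"
    by (rule sum.union_disjoint) auto
  also have "(\<Sum>c\<in>{n..<2 * n}. h c) = (\<Sum>c<n. h (n + c))"
    by (rule sum.reindex_bij_witness[of _ "\<lambda>c. n + c" "\<lambda>c. c - n"]) auto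
  finally show ?thesis .
qed

lemma gen_img_e: "i < n \<Longrightarrow> gen_img A B i = (\<Sum>j<n. sc (A $$ (j, i)) (e j))"
  and gen_img_f: "i < n \<Longrightarrow> gen_img A B (n + i) = (\<Sum>j<n. sc (B $$ (i, j)) (f j))"
  by (simp_all add: gen_img_def sum_double block_def gen_def)

text \<open>The blocks are A and the transpose of its inverse; this is the embedding of GL(n) in
  Sp(2n).\<close>

lemma block_symplectic:
  assumes AB: "A \<in> carrier_mat n n" "B \<in> carrier_mat n n" "B * A = 1\<^sub>m n" and ab: "a < 2 * n" "b < 2 * n"
  shows "(\<Sum>c<2 * n. \<Sum>d<2 * n. block A B c a * block A B d b * pairing c d) = pairing a b"
proof -
  have e: "(\<Sum>c<n. A $$ (c, i) * B $$ (j, c)) = (if j = i then 1 else 0)" if "i < n" "j < n" for i j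
    using mat_mult_entry[OF AB(2,1,3) that(2,1)] by (simp add: mult.commute)
  have pairing: "pairing c d = 0" "pairing (n + c) (n + d) = 0" "pairing c (n + d) = (if d = c then 1 else 0)"
    "pairing (n + c) d = (if d = c then - 1 else 0)" if "c < n" "d < n" for c d
    using that by (auto simp: pairing_def)
  have "(\<Sum>c<2 * n. \<Sum>d<2 * n. block A B c a * block A B d b * pairing c d)
     = (\<Sum>c<n. block A B c a * block A B (n + c) b) - (\<Sum>c<n. block A B (n + c) a * block A B c b)"
    unfolding sum_double by (simp add: pairing if_distrib[of "\<lambda>x. _ * x"] sum.delta sum_negf cong: if_cong)
  also have "\<dots> = pairing a b"
  proof (cases "a < n")
    case True
    then show ?thesis
    proof (cases "b < n")
      case False
      then obtain j where j: "b = n + j" "j < n" using ab le_Suc_ex[of n b] by auto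
      then show ?thesis using True e[of a j] by (simp add: block_def pairing_def)
    qed (simp add: block_def pairing_def)
  next
    case False
    then obtain j where j: "a = n + j" "j < n" using ab le_Suc_ex[of n a] by auto
    then show ?thesis
    proof (cases "b < n")
      case True
      then show ?thesis using j e[of b j] by (simp add: block_def pairing_def mult.commute)
    qed (use ab in \<open>simp add: block_def pairing_def\<close>)
  qed
  finally show ?thesis .
qed

lemma gen_img_odd: "gen_img A B a \<in> homog V True"
  unfolding gen_img_def by (intro homog_sum' homog_scale gen_odd) auto

lemma gen_img_anticommute:
  assumes AB: "A \<in> carrier_mat n n" "B \<in> carrier_mat n n" "B * A = 1\<^sub>m n" and ab: "a < 2 * n" "b < 2 * n"
  shows "np (gen_img A B a) m (np (gen_img A B b) k v)
    = sc (if m + k = 0 then of_int m * pairing a b else 0) v - np (gen_img A B b) k (np (gen_img A B a) m v)"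
proof -
  have "np (gen_img A B a) m (np (gen_img A B b) k v)
     = (\<Sum>c<2 * n. \<Sum>d<2 * n. sc (block A B c a * block A B d b) (np (gen c) m (np (gen d) k v)))"
    by (subst sum.swap) (simp add: gen_img_def scale_sum_right mult.commute[of "block A B _ a"])
  also have "\<dots> = (\<Sum>c<2 * n. \<Sum>d<2 * n.
       sc ((if m + k = 0 then of_int m else 0) * (block A B c a * block A B d b * pairing c d)) v)
     - (\<Sum>c<2 * n. \<Sum>d<2 * n. sc (block A B d b * block A B c a) (np (gen d) k (np (gen c) m v)))"
    unfolding sum_subtractf[symmetric]
  proof (intro sum.cong refl)
    fix c d assume "c \<in> {..<2 * n}" "d \<in> {..<2 * n}"
    then have cd: "c < 2 * n" "d < 2 * n" by auto
    show "sc (block A B c a * block A B d b) (np (gen c) m (np (gen d) k v))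
      = sc ((if m + k = 0 then of_int m else 0) * (block A B c a * block A B d b * pairing c d)) v
        - sc (block A B d b * block A B c a) (np (gen d) k (np (gen c) m v))"
      unfolding gen_anticommute[OF cd] by (simp add: scale_right_diff_distrib mult_ac)
  qed
  also have "(\<Sum>c<2 * n. \<Sum>d<2 * n.
       sc ((if m + k = 0 then of_int m else 0) * (block A B c a * block A B d b * pairing c d)) v)
     = sc (if m + k = 0 then of_int m * pairing a b else 0) v"
    by (simp add: block_symplectic[OF AB ab] flip: scale_sum_left sum_distrib_left)
  also have "(\<Sum>c<2 * n. \<Sum>d<2 * n. sc (block A B d b * block A B c a) (np (gen d) k (np (gen c) m v)))
     = np (gen_img A B b) k (np (gen_img A B a) m v)"
    by (simp add: gen_img_def scale_sum_right mult.commute)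
  finally show ?thesis .
qed

definition act :: "complex mat \<Rightarrow> complex mat \<Rightarrow> 'v \<Rightarrow> 'v" where
  "act A B = lift (\<lambda>p. np (gen_img A B (fst p)) (- int (snd p) - 1))"

lemma lin_act: "lin (act A B)"
  unfolding act_def by (intro linI lift_add lift_scale)

lemma act_Om: "act A B Om = Om"
  unfolding act_def by (rule lift_vac)

context
  fixes A B :: "complex mat"
  assumes AB: "A \<in> carrier_mat n n" "B \<in> carrier_mat n n" "A * B = 1\<^sub>m n" "B * A = 1\<^sub>m n"
begin

lemma act_cr: "a < 2 * n \<Longrightarrow> act A B (cr (a, k) v) = np (gen_img A B a) (- int k - 1) (act A B v)"
proof -
  assume a: "a < 2 * n"
  have "anticommuting (\<lambda>p. np (gen_img A B (fst p)) (- int (snd p) - 1))"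
    unfolding anticommuting_def
  proof (intro conjI ballI allI)
    fix p q :: "nat \<times> nat" and v assume pq: "p \<in> idx" "q \<in> idx"
    then have "fst p < 2 * n" "fst q < 2 * n" by (auto simp: idx_def)
    then show "np (gen_img A B (fst p)) (- int (snd p) - 1) (np (gen_img A B (fst q)) (- int (snd q) - 1) v)
      = - np (gen_img A B (fst q)) (- int (snd q) - 1) (np (gen_img A B (fst p)) (- int (snd p) - 1) v)"
      by (subst gen_img_anticommute[OF AB(1,2,4)]) auto
  qed simp_all
  from lift_cr[OF this, of "(a, k)" v] a show ?thesis by (simp add: act_def)
qed

text \<open>Creation modes are covered by \<open>act_cr\<close>, and zero modes vanish. For m > 0
  the mode is moved through the word to the vacuum; the images of the generators have the same
  anticommutators, so both sides produce the same terms.\<close>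

lemma act_gen_mode:
  assumes a: "a < 2 * n"
  shows "act A B (np (gen a) m v) = np (gen_img A B a) m (act A B v)"
proof -
  consider "m < 0" | "m = 0" | "m > 0" by linarith
  then show ?thesis
  proof cases
    case 1
    then have "m = - int (nat (- m - 1)) - 1" by simp
    then show ?thesis using act_cr[OF a, of "nat (- m - 1)" v] by (simp add: cr_def)
  next
    case 2
    have "np (gen_img A B a) 0 x = 0" for x by (simp add: gen_img_def gen_zero_mode)
    then show ?thesis using 2 a by (simp add: gen_zero_mode lin_zero[OF lin_act])
  next
    case 3
    show ?thesis
    proof (induction v rule: word_induct)
      case (word w)
      then have "set w \<subseteq> idx" by (simp add: sorted_words_def)
      then show ?case
      proof (induction w)
        case Nil
        then show ?case using 3 by (simp add: vacuum_right_nonneg act_Om lin_zero[OF lin_act])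
      next
        case (Cons q w)
        obtain b k where q: "q = (b, k)" by (cases q)
        have b: "b < 2 * n" using Cons.prems by (simp add: q)
        have "np (gen a) m (cr (b, k) (word w)) =
           sc (if m + (- int k - 1) = 0 then of_int m * pairing a b else 0) (word w) - cr (b, k) (np (gen a) m (word w))"
          unfolding cr_def fst_conv snd_conv by (rule gen_anticommute[OF a b])
        then have "act A B (np (gen a) m (cr (b, k) (word w)))
           = sc (if m + (- int k - 1) = 0 then of_int m * pairing a b else 0) (act A B (word w))
             - np (gen_img A B b) (- int k - 1) (np (gen_img A B a) m (act A B (word w)))"
          using Cons by (simp add: lin_diff[OF lin_act] lin_scale[OF lin_act] act_cr[OF b])
        also have "\<dots> = np (gen_img A B a) m (np (gen_img A B b) (- int k - 1) (act A B (word w)))"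
          by (rule gen_img_anticommute[OF AB(1,2,4) a b, symmetric])
        finally show ?case by (simp add: q act_cr[OF b])
      qed
    qed (simp_all add: lin_add[OF lin_act] lin_scale[OF lin_act])
  qed
qed

lemma act_gen: "a < 2 * n \<Longrightarrow> act A B (gen a) = gen_img A B a"
  using act_gen_mode[of a "-1" Om] by (simp add: vacuum_right act_Om)

end

lemma word_homog: "set w \<subseteq> idx \<Longrightarrow> word w \<in> homog V (odd (length w))"
proof (induction w)
  case (Cons p w)
  obtain a k where p: "p = (a, k)" by (cases p)
  have "np (gen a) (- int k - 1) (word w) \<in> homog V (True \<noteq> odd (length w))"
    by (rule nprod_homog[OF gen_odd]) (use Cons p in auto)
  then show ?case by (simp add: p cr_def[of "(a, k)"])
qed (simp add: vacuum_even)

text \<open>The parity components are part of the record, so their description by word length must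
  be derived: the part of v of the wrong length parity lies in both components and is therefore
  0.\<close>

lemma homog_coef:
  assumes v: "v \<in> homog V p" and w: "w \<in> words" "coef w v \<noteq> 0"
  shows "odd (length w) = p"
proof -
  let ?S = "supp v"
  let ?T = "\<lambda>q. {w \<in> ?S. odd (length w) = q}"
  let ?v = "\<lambda>q. \<Sum>w\<in>?T q. sc (coef w v) (word w)"
  have fin: "finite ?S" by (rule finite_support)
  have h: "?v q \<in> homog V q" for q
  proof (intro homog_sum' homog_scale)
    fix w assume "w \<in> ?T q"
    then show "word w \<in> homog V q" using word_homog[of w] by (auto simp: sorted_words_def)
  qed
  have "v = (\<Sum>w\<in>?S. sc (coef w v) (word w))" by (rule expand)
  also have "\<dots> = (\<Sum>w\<in>?T p \<union> ?T (\<not> p). sc (coef w v) (word w))"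
    by (rule sum.cong) auto
  also have "\<dots> = ?v p + ?v (\<not> p)"
    by (rule sum.union_disjoint) (auto intro: finite_subset[OF _ fin])
  finally have e: "?v (\<not> p) = v + sc (-1) (?v p)" by (simp add: algebra_simps)
  have "?v (\<not> p) \<in> homog V p"
    unfolding e by (intro homog_add v homog_scale h)
  then have z: "?v (\<not> p) = 0" using h[of "\<not> p"] homog_Int by (cases p) auto
  show ?thesis
  proof (rule ccontr)
    assume "odd (length w) \<noteq> p"
    then have wT: "w \<in> ?T (\<not> p)" using w by auto
    have "coef w (?v (\<not> p)) = (\<Sum>w'\<in>?T (\<not> p). if w' = w then coef w v else 0)"
      unfolding coef_sum by (intro sum.cong refl) (use w in \<open>auto simp: coef_scale coef_word\<close>)
    also have "\<dots> = coef w v" using wT finite_subset[OF _ fin, of "?T (\<not> p)"] by (simp add: sum.delta subset_iff)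
    finally show False using z w by simp
  qed
qed

context
  fixes A B :: "complex mat"
  assumes AB: "A \<in> carrier_mat n n" "B \<in> carrier_mat n n" "A * B = 1\<^sub>m n" "B * A = 1\<^sub>m n"
begin

lemma act_word_homog: "set w \<subseteq> idx \<Longrightarrow> act A B (word w) \<in> homog V (odd (length w))"
proof (induction w)
  case (Cons p w)
  obtain a k where p: "p = (a, k)" by (cases p)
  have a: "a < 2 * n" using Cons.prems p by simp
  have "np (gen_img A B a) (- int k - 1) (act A B (word w)) \<in> homog V (True \<noteq> odd (length w))"
    by (rule nprod_homog[OF gen_img_odd]) (use Cons in auto)
  then show ?case by (simp add: p act_cr[OF AB a])
qed (simp add: vacuum_even act_Om)

lemma act_homog:
  assumes v: "v \<in> homog V p"
  shows "act A B v \<in> homog V p"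
proof -
  have "act A B v = (\<Sum>w\<in>supp v. sc (coef w v) (act A B (word w)))"
    by (subst expand[of v]) (simp only: lin_sum[OF lin_act] lin_scale[OF lin_act])
  also have "\<dots> \<in> homog V p"
  proof (intro homog_sum' homog_scale)
    fix w assume "w \<in> supp v"
    then show "act A B (word w) \<in> homog V p"
      using act_word_homog[of w] homog_coef[OF v, of w] by (auto simp: sorted_words_def)
  qed
  finally show ?thesis .
qed

text \<open>The iterate formula expresses the modes of \<open>np (gen a) r (word w)\<close> through
  those of the generator and of the shorter word, for which the claim is known.\<close>

lemma act_np: "act A B (np x k y) = np (act A B x) k (act A B y)"
proof (induction x arbitrary: k y rule: word_induct)
  case (word w)
  then have "set w \<subseteq> idx" by (simp add: sorted_words_def)
  then show ?case
  proof (induction w arbitrary: k y)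
    case Nil
    then show ?case by (simp add: act_Om vacuum_left lin_zero[OF lin_act])
  next
    case (Cons p w)
    obtain a r0 where p: "p = (a, r0)" by (cases p)
    have a: "a < 2 * n" using Cons.prems p by simp
    have wI: "set w \<subseteq> idx" using Cons.prems by simp
    define r where "r = - int r0 - 1"
    obtain N1 where N1: "\<forall>N\<ge>N1. np (np (gen a) r (word w)) k y = (\<Sum>j<N. sc ((-1) ^ j * (of_int r gchoose j))
            (np (gen a) (r - int j) (np (word w) (k + int j) y)
              - sc ((if True \<and> odd (length w) then -1 else 1) * (-1) powi r)
                  (np (word w) (k + r - int j) (np (gen a) (int j) y))))"
      using iterate[OF gen_odd[OF a] word_homog[OF wI]] by blast
    obtain N2 where N2: "\<forall>N\<ge>N2. np (np (gen_img A B a) r (act A B (word w))) k (act A B y)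
          = (\<Sum>j<N. sc ((-1) ^ j * (of_int r gchoose j))
            (np (gen_img A B a) (r - int j) (np (act A B (word w)) (k + int j) (act A B y))
              - sc ((if True \<and> odd (length w) then -1 else 1) * (-1) powi r)
                  (np (act A B (word w)) (k + r - int j) (np (gen_img A B a) (int j) (act A B y)))))"
      using iterate[OF gen_img_odd act_word_homog[OF wI]] by blast
    have "act A B (np (np (gen a) r (word w)) k y) = np (np (gen_img A B a) r (act A B (word w))) k (act A B y)"
      \<comment> \<open>A common truncation bound for the expansion and for that of its
        image.\<close>
      using N1[rule_format, of "max N1 N2"] N2[rule_format, of "max N1 N2"]
      by (simp add: lin_sum[OF lin_act] lin_scale[OF lin_act] lin_diff[OF lin_act]
          act_gen_mode[OF AB a] Cons.IH[OF wI])
    then show ?case by (simp add: p cr_def[of "(a, r0)"] r_def act_gen_mode[OF AB a])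
  qed
qed (simp_all add: lin_add[OF lin_act] lin_scale[OF lin_act])

end

text \<open>On generators this is the matrix identity A B = 1, and \<open>act_np\<close> carries it
  to words. It makes \<open>act A B\<close> bijective and maps the parity components onto
  themselves.\<close>

lemma act_act:
  assumes AB: "A \<in> carrier_mat n n" "B \<in> carrier_mat n n" "A * B = 1\<^sub>m n" "B * A = 1\<^sub>m n"
  shows "act A B (act B A v) = v"
proof -
  note AB1 = AB(1,2,3,4) and AB2 = AB(2,1,4,3)
  have gl_op: "act A B (gen_img B A a) = gen a" if a: "a < 2 * n" for a
  proof (cases "a < n")
    case True
    have "act A B (gen_img B A a) = (\<Sum>c<n. sc (B $$ (c, a)) (act A B (e c)))"
      using True by (simp add: gen_img_e lin_sum[OF lin_act] lin_scale[OF lin_act])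
    also have "\<dots> = (\<Sum>c<n. sc (B $$ (c, a)) (gen_img A B c))"
    proof (intro sum.cong refl)
      fix c assume "c \<in> {..<n}"
      then show "sc (B $$ (c, a)) (act A B (e c)) = sc (B $$ (c, a)) (gen_img A B c)"
        using act_gen[OF AB1, of c] by (simp add: gen_def)
    qed
    also have "\<dots> = (\<Sum>c<n. \<Sum>d<n. sc (A $$ (d, c) * B $$ (c, a)) (e d))"
      by (simp add: gen_img_e scale_sum_right mult.commute)
    also have "\<dots> = (\<Sum>d<n. sc (\<Sum>c<n. A $$ (d, c) * B $$ (c, a)) (e d))"
      by (subst sum.swap) (simp add: scale_sum_left)
    also have "\<dots> = gen a" using True
      by (simp add: mat_mult_entry[OF AB(1,2,3)] if_distrib[of "\<lambda>c. sc c _"] sum.delta gen_def cong: if_cong)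
    finally show ?thesis .
  next
    case False
    then obtain j where j: "a = n + j" "j < n" using a le_Suc_ex[of n a] by auto
    have "act A B (gen_img B A a) = (\<Sum>c<n. sc (A $$ (j, c)) (act A B (f c)))"
      using j by (simp add: gen_img_f lin_sum[OF lin_act] lin_scale[OF lin_act])
    also have "\<dots> = (\<Sum>c<n. sc (A $$ (j, c)) (gen_img A B (n + c)))"
    proof (intro sum.cong refl)
      fix c assume "c \<in> {..<n}"
      then show "sc (A $$ (j, c)) (act A B (f c)) = sc (A $$ (j, c)) (gen_img A B (n + c))"
        using act_gen[OF AB1, of "n + c"] by (simp add: gen_def)
    qed
    also have "\<dots> = (\<Sum>c<n. \<Sum>d<n. sc (A $$ (j, c) * B $$ (c, d)) (f d))"
      by (simp add: gen_img_f scale_sum_right)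
    also have "\<dots> = (\<Sum>d<n. sc (\<Sum>c<n. A $$ (j, c) * B $$ (c, d)) (f d))"
      by (subst sum.swap) (simp add: scale_sum_left)
    also have "\<dots> = gen a" using j
      by (simp add: mat_mult_entry[OF AB(1,2,3)] if_distrib[of "\<lambda>c. sc c _"] sum.delta gen_def cong: if_cong)
    finally show ?thesis .
  qed
  show ?thesis
  proof (induction v rule: word_induct)
    case (word w)
    then have "set w \<subseteq> idx" by (simp add: sorted_words_def)
    then show ?case
    proof (induction w)
      case (Cons p w)
      obtain a k where p: "p = (a, k)" by (cases p)
      have a: "a < 2 * n" using Cons.prems p by simp
      then show ?case using Cons gl_op[OF a]
        by (simp add: p act_cr[OF AB2 a] act_np[OF AB1]) (simp add: cr_def)
    qed (simp add: act_Om)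
  qed (simp_all add: lin_add[OF lin_act] lin_scale[OF lin_act])
qed

lemma act_GL:
  assumes AB: "A \<in> carrier_mat n n" "B \<in> carrier_mat n n" "A * B = 1\<^sub>m n" "B * A = 1\<^sub>m n"
  shows "act A B \<in> GL"
proof -
  note AB2 = AB(2,1,4,3)
  have bij: "bij (act A B)"
    by (rule bij_betw_byWitness[of _ "act B A"]) (auto simp: act_act[OF AB] act_act[OF AB2])
  have "act A B ` homog V p = homog V p" for p
  proof
    show "act A B ` homog V p \<subseteq> homog V p" using act_homog[OF AB] by blast
    show "homog V p \<subseteq> act A B ` homog V p"
    proof
      fix x assume x: "x \<in> homog V p"
      show "x \<in> act A B ` homog V p"
        using act_act[OF AB, of x, symmetric] act_homog[OF AB2 x] by (rule image_eqI)
    qed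
  qed
  then have "automorphism V (act A B)"
    using bij lin_act act_Om act_np[OF AB] by (simp add: automorphism_def)
  moreover have "act A B (e i) = (\<Sum>j<n. sc (A $$ (j, i)) (e j))"
    "act A B (f i) = (\<Sum>j<n. sc (B $$ (i, j)) (f j))" if "i < n" for i
    using that act_gen[OF AB, of i] act_gen[OF AB, of "n + i"] by (simp_all add: gen_def gen_img_e gen_img_f)
  ultimately show ?thesis using AB unfolding GL_group_def by blast
qed

lemma W_act:
  assumes "A \<in> carrier_mat n n" "B \<in> carrier_mat n n" "A * B = 1\<^sub>m n" "B * A = 1\<^sub>m n" "v \<in> W"
  shows "act A B v = v"
  using act_GL[OF assms(1-4)] assms(5) by (simp add: invariants_def)

end

section \<open>The first fundamental theorem\<close>

context vertex_superalgebra
begin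

text \<open>An injective endomorphism of a finite-dimensional space is onto. The ambient space may
  be infinite-dimensional, so the image of a basis of U is counted inside the span of that
  basis.\<close>

lemma finite_dim_surj:
  assumes F: "finite F" "U \<subseteq> span F" and U: "subspace U" and T: "lin T" "T ` U \<subseteq> U"
    and inj: "\<And>v. v \<in> U \<Longrightarrow> T v = 0 \<Longrightarrow> v = 0"
  shows "U \<subseteq> T ` U"
proof -
  obtain B where B: "B \<subseteq> U" "independent B" "U \<subseteq> span B"
    using maximal_independent_subset .
  have spB: "span B = U" using B U by (intro antisym span_minimal)
  have finB: "finite B" using independent_span_bound[OF F(1) B(2)] B(1) F(2) by blast
  interpret T: Vector_Spaces.linear sc sc T by (rule T(1))
  have injU: "inj_on T (span B)"
    using T.inj_on_iff_eq_0[OF U] inj unfolding spB by blast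
  have indep: "independent (T ` B)" by (rule T.independent_injective_image[OF B(2) injU])
  have TB: "T ` B \<subseteq> span B" using B(1) T(2) spB by blast
  have card: "card (T ` B) = card B"
    by (rule card_image) (rule inj_on_subset[OF injU span_superset])
  have "B \<subseteq> span (T ` B)"
  proof
    fix b assume b: "b \<in> B"
    show "b \<in> span (T ` B)"
    proof (rule ccontr)
      assume nb: "b \<notin> span (T ` B)"
      then have "independent (insert b (T ` B))" using indep by (simp add: independent_insert)
      moreover have "insert b (T ` B) \<subseteq> span B" using TB b span_base by blast
      ultimately have "card (insert b (T ` B)) \<le> card B" using independent_span_bound[OF finB] by blast
      moreover have "b \<notin> T ` B" using nb span_base by blast
      ultimately show False using card finB by simp
    qed
  qed
  then have "U \<subseteq> span (T ` B)" using B(3) span_minimal[OF _ subspace_span] by blast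
  also have "span (T ` B) = T ` span B" by (rule T.span_image)
  finally show ?thesis by (simp add: spB)
qed

end

context symplectic_fermion_algebra
begin

lemma an_an:
  assumes "p \<in> idx" "q \<in> idx"
  shows "an p (an q v) = - an q (an p v)"
proof -
  obtain a k b l where [simp]: "p = (a, k)" "q = (b, l)" by (cases p; cases q)
  have "dual a < 2 * n" "dual b < 2 * n" using assms by auto
  then have "np (gen (dual a)) (int (Suc k)) (np (gen (dual b)) (int (Suc l)) v)
      = - np (gen (dual b)) (int (Suc l)) (np (gen (dual a)) (int (Suc k)) v)"
    by (subst gen_anticommute) auto
  then show ?thesis by (simp add: an_def mult.commute)
qed

lemma gen_ws: "v \<in> ws d \<Longrightarrow> a < 2 * n \<Longrightarrow> np (gen a) m v \<in> ws (d - m)"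
proof -
  assume v: "v \<in> ws d" and a: "a < 2 * n"
  have "sc (of_int d) X - sc (of_int m) X = sc (of_int (d - m)) X" for X
    unfolding scale_left_diff_distrib[symmetric] by (rule arg_cong[where f = "\<lambda>c. sc c X"]) simp
  then show ?thesis using v a by (simp add: ws_def Lc_gen)
qed

lemma an_ws: "v \<in> ws d \<Longrightarrow> a < 2 * n \<Longrightarrow> an (a, k) v \<in> ws (d - int k - 1)"
proof -
  assume v: "v \<in> ws d" and a: "a < 2 * n"
  have "np (gen (dual a)) (int (Suc k)) v \<in> ws (d - int (Suc k))"
    by (intro gen_ws v) (use a in simp)
  then have "an (a, k) v \<in> ws (d - int (Suc k))"
    unfolding an_def fst_conv snd_conv by (rule subspace_scale[OF subspace_ws])
  moreover have "d - int (Suc k) = d - int k - 1" by simp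
  ultimately show ?thesis by (simp only:)
qed

lemma ip_cnj: "ip u v = cnj (ip v u)"
proof -
  let ?F = "supp u \<union> supp v"
  have F: "finite ?F" using finite_support[of u] finite_support[of v] by simp
  have "ip u v = (\<Sum>w\<in>?F. cnj (coef w u) * coef w v)" by (rule ip_superset[OF F]) auto
  also have "\<dots> = cnj (\<Sum>w\<in>?F. cnj (coef w v) * coef w u)" by (simp add: mult.commute)
  also have "(\<Sum>w\<in>?F. cnj (coef w v) * coef w u) = ip v u"
    by (rule ip_superset[OF F, symmetric]) auto
  finally show ?thesis .
qed

lemma ip_adjoint': "i \<in> idx \<Longrightarrow> ip u (cr i v) = ip (an i u) v"
  using ip_adjoint[of i v u] ip_cnj[of u "cr i v"] ip_cnj[of "an i u" v] by simp

lemma ip_sum_left: "ip (sum g A) v = (\<Sum>i\<in>A. ip (g i) v)"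
  by (induction A rule: infinite_finite_induct) (simp_all add: ip_add_left)

text \<open>The matrix unit E_ab of gl(2n), acting as a derivation. Mode k has weight k+1, so on
  weight N only k < N contributes and the truncated sum is exact.\<close>

definition gl_op :: "nat \<Rightarrow> nat \<Rightarrow> nat \<Rightarrow> 'v \<Rightarrow> 'v" where
  "gl_op a b N v = (\<Sum>k<N. cr (a, k) (an (b, k) v))"

lemma lin_gl_op: "lin (gl_op a b N)"
  by (intro linI) (simp_all add: gl_op_def an_add an_scale cr_add cr_scale sum.distrib scale_sum_right)

lemma gl_op_Om: "b < 2 * n \<Longrightarrow> gl_op a b N Om = 0"
  by (simp add: gl_op_def an_vac)

lemma gl_op_cr:
  assumes "a < 2 * n" "b < 2 * n" "p \<in> idx" "snd p < N"
  shows "gl_op a b N (cr p v) = cr p (gl_op a b N v) + (if fst p = b then cr (a, snd p) v else 0)"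
proof -
  have "cr (a, k) (an (b, k) (cr p v))
     = cr p (cr (a, k) (an (b, k) v)) + (if k = snd p then if fst p = b then cr (a, snd p) v else 0 else 0)" for k
  proof -
    have "an (b, k) (cr p v) = (if (b, k) = p then v else 0) - cr p (an (b, k) v)"
      by (rule an_cr) (use assms in auto)
    then have "cr (a, k) (an (b, k) (cr p v))
        = cr (a, k) (if (b, k) = p then v else 0) - cr (a, k) (cr p (an (b, k) v))"
      by (simp only: lin_diff[OF lin_cr])
    also have "cr (a, k) (cr p (an (b, k) v)) = - cr p (cr (a, k) (an (b, k) v))"
      by (rule cr_cr) (use assms in auto)
    finally show ?thesis by (cases p) auto
  qed
  then show ?thesis using assms(4)
    by (simp add: gl_op_def sum.distrib lin_sum[OF lin_cr] sum.delta)
qed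

lemma ip_gl_op:
  assumes "a < 2 * n" "b < 2 * n"
  shows "ip u (gl_op a b N v) = ip (gl_op b a N u) v"
  using assms by (simp add: gl_op_def ip_sum_right ip_sum_left ip_adjoint' ip_adjoint)

definition mode_wt :: "(nat \<times> nat) list \<Rightarrow> nat" where "mode_wt w = sum_list (map (\<lambda>p. Suc (snd p)) w)"

lemma word_ws: "set w \<subseteq> idx \<Longrightarrow> word w \<in> ws (int (mode_wt w))"
proof (induction w)
  case (Cons p w)
  obtain a k where p: "p = (a, k)" by (cases p)
  have "cr (a, k) (word w) \<in> ws (int (mode_wt w) + int k + 1)"
    by (intro cr_ws) (use Cons p in auto)
  moreover have "int (mode_wt w) + int k + 1 = int (mode_wt (p # w))" by (simp add: mode_wt_def p)
  ultimately show ?case by (simp only: p foldr.simps o_apply)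
qed (simp add: mode_wt_def Om_ws)

lemma wordsD: "w \<in> words \<Longrightarrow> set w \<subseteq> idx"
  by (simp add: sorted_words_def)

text \<open>Words are eigenvectors of L_(1), so weight spaces are cut out by coordinates; their
  finite dimension and the absence of negative weights follow.\<close>

lemma coef_Lc: "w \<in> words \<Longrightarrow> coef w (np Lc 1 v) = of_nat (mode_wt w) * coef w v"
proof (induction v rule: word_induct)
  case (word w')
  then show ?case using word_ws[OF wordsD, of w'] by (simp add: ws_def coef_scale coef_word)
qed (simp_all add: coef_add coef_scale algebra_simps)

lemma ws_coef: "v \<in> ws d \<Longrightarrow> w \<in> words \<Longrightarrow> coef w v \<noteq> 0 \<Longrightarrow> int (mode_wt w) = d"
proof -
  assume v: "v \<in> ws d" and w: "w \<in> words" "coef w v \<noteq> 0"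
  have "of_nat (mode_wt w) * coef w v = of_int d * coef w v"
    using coef_Lc[OF w(1), of v] v by (auto simp: ws_def coef_scale)
  then have "(of_int (int (mode_wt w)) :: complex) = of_int d" using w by simp
  then show ?thesis by (simp only: of_int_eq_iff)
qed

lemma ws_neg: "v \<in> ws d \<Longrightarrow> d < 0 \<Longrightarrow> v = 0"
  using ws_coef[of v d] by (intro coef_ext) fastforce

lemma ws_expand: "v \<in> ws (int d) \<Longrightarrow> v \<in> span (word ` {w \<in> words. mode_wt w = d})"
proof -
  assume v: "v \<in> ws (int d)"
  have "(\<Sum>w\<in>supp v. sc (coef w v) (word w)) \<in> span (word ` {w \<in> words. mode_wt w = d})"
    using ws_coef[OF v] by (intro span_sum span_scale span_base) auto
  then show ?thesis by (subst expand)
qed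

lemma mode_wt_mode: "p \<in> set w \<Longrightarrow> snd p < mode_wt w"
  using member_le_sum_list[of "Suc (snd p)" "map (\<lambda>p. Suc (snd p)) w"] by (auto simp: mode_wt_def)

lemma length_le_mode_wt: "length w \<le> mode_wt w"
  by (induction w) (auto simp: mode_wt_def)

lemma finite_words_mode_wt: "finite {w \<in> words. mode_wt w = d}"
proof (rule finite_subset)
  show "{w \<in> words. mode_wt w = d} \<subseteq> {w. set w \<subseteq> {..<2 * n} \<times> {..<d} \<and> length w \<le> d}"
    using mode_wt_mode length_le_mode_wt wordsD by (fastforce simp: idx_def)
  show "finite {w. set w \<subseteq> {..<2 * n} \<times> {..<d} \<and> length w \<le> d}"
    by (rule finite_lists_length_le) simp
qed

section \<open>Infinitesimal invariance\<close>

definition transvec :: "nat \<Rightarrow> nat \<Rightarrow> complex \<Rightarrow> complex mat" where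
  "transvec i j t = mat n n (\<lambda>(r, c). if r = c then 1 else if r = i \<and> c = j then t else 0)"

lemma transvec_sum:
  assumes ij: "i < n" "j < n" "i \<noteq> j" and r: "r < n"
  shows "(\<Sum>k<n. transvec i j t $$ (r, k) * X k) = X r + (if r = i then t * X j else 0)"
proof -
  have "(\<Sum>k<n. transvec i j t $$ (r, k) * X k)
      = (\<Sum>k<n. (if k = r then X k else 0) + (if k = j then if r = i then t * X k else 0 else 0))"
    by (intro sum.cong refl) (use ij r in \<open>auto simp: transvec_def\<close>)
  also have "\<dots> = X r + (if r = i then t * X j else 0)"
    using ij r by (simp add: sum.distrib sum.delta)
  finally show ?thesis .
qed

lemma transvec_mult:
  assumes ij: "i < n" "j < n" "i \<noteq> j"
  shows "transvec i j t * transvec i j (- t) = 1\<^sub>m n"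
proof (rule eq_matI)
  fix r c assume "r < dim_row (1\<^sub>m n)" "c < dim_col (1\<^sub>m n)"
  then have rc: "r < n" "c < n" by auto
  have "(transvec i j t * transvec i j (- t)) $$ (r, c) = (\<Sum>k<n. transvec i j t $$ (r, k) * transvec i j (- t) $$ (k, c))"
    using rc by (auto simp: transvec_def scalar_prod_def atLeast0LessThan)
  also have "\<dots> = transvec i j (- t) $$ (r, c) + (if r = i then t * transvec i j (- t) $$ (j, c) else 0)"
    by (rule transvec_sum[OF ij rc(1)])
  also have "\<dots> = 1\<^sub>m n $$ (r, c)"
    using rc ij by (auto simp: transvec_def)
  finally show "(transvec i j t * transvec i j (- t)) $$ (r, c) = 1\<^sub>m n $$ (r, c)" .
qed (auto simp: transvec_def)

definition transvec_act :: "nat \<Rightarrow> nat \<Rightarrow> complex \<Rightarrow> 'v \<Rightarrow> 'v" where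
  "transvec_act i j t = act (transvec i j t) (transvec i j (- t))"

text \<open>The part linear in t of the image of a creation operator under the transvection: e_j
  moves to e_i and, dually, f_i to -f_j.\<close>

definition transvec_cr :: "nat \<Rightarrow> nat \<Rightarrow> nat \<times> nat \<Rightarrow> 'v \<Rightarrow> 'v" where
  "transvec_cr i j p v = (if fst p = j then cr (i, snd p) v else if fst p = n + i then - cr (n + j, snd p) v else 0)"

lemma lin_transvec_cr: "lin (transvec_cr i j p)"
  by (intro linI) (simp_all add: transvec_cr_def cr_add cr_scale)

text \<open>E_ij on the e's minus its transpose on the f's: the Lie algebra element generating the
  transvections.\<close>

definition gl_diff :: "nat \<Rightarrow> nat \<Rightarrow> nat \<Rightarrow> 'v \<Rightarrow> 'v" where
  "gl_diff i j N v = gl_op i j N v - gl_op (n + j) (n + i) N v"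

lemma lin_gl_diff: "lin (gl_diff i j N)"
  by (intro linI)
     (simp_all add: gl_diff_def lin_add[OF lin_gl_op] lin_scale[OF lin_gl_op] scale_right_diff_distrib)

lemma gl_diff_cr:
  assumes "i < n" "j < n" "p \<in> idx" "snd p < N"
  shows "gl_diff i j N (cr p v) = cr p (gl_diff i j N v) + transvec_cr i j p v"
  using assms by (auto simp: gl_diff_def gl_op_cr transvec_cr_def lin_diff[OF lin_cr])

lemma gen_img_transvec:
  assumes ij: "i < n" "j < n" "i \<noteq> j" and a: "a < 2 * n"
  shows "gen_img (transvec i j t) (transvec i j (- t)) a
    = gen a + sc t (if a = j then gen i else if a = n + i then - gen (n + j) else 0)"
proof (cases "a < n")
  case True
  have "gen_img (transvec i j t) (transvec i j (- t)) a = (\<Sum>c<n. sc (transvec i j t $$ (c, a)) (e c))"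
    by (rule gen_img_e[OF True])
  also have "\<dots> = (\<Sum>c<n. (if c = a then e c else 0) + (if c = i then if a = j then sc t (e c) else 0 else 0))"
    by (intro sum.cong refl) (use True ij in \<open>auto simp: transvec_def\<close>)
  also have "\<dots> = gen a + sc t (if a = j then gen i else if a = n + i then - gen (n + j) else 0)"
    using True ij by (simp add: sum.distrib sum.delta gen_def)
  finally show ?thesis .
next
  case False
  then obtain l where l: "a = n + l" "l < n" using a le_Suc_ex[of n a] by auto
  have "gen_img (transvec i j t) (transvec i j (- t)) (n + l) = (\<Sum>c<n. sc (transvec i j (- t) $$ (l, c)) (f c))"
    by (rule gen_img_f[OF l(2)])
  also have "\<dots> = (\<Sum>c<n. (if c = l then f c else 0) + (if c = j then if l = i then sc (- t) (f c) else 0 else 0))"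
    by (intro sum.cong refl) (use l ij in \<open>auto simp: transvec_def\<close>)
  also have "\<dots> = gen a + sc t (if a = j then gen i else if a = n + i then - gen (n + j) else 0)"
    using l ij by (simp add: sum.distrib sum.delta gen_def)
  finally show ?thesis by (simp only: l(1))
qed

lemma transvec_act_cr:
  assumes ij: "i < n" "j < n" "i \<noteq> j" and p: "p \<in> idx"
  shows "transvec_act i j t (cr p v) = cr p (transvec_act i j t v) + sc t (transvec_cr i j p (transvec_act i j t v))"
proof -
  obtain a k where ak: "p = (a, k)" by (cases p)
  have a: "a < 2 * n" using p ak by simp
  have m: "transvec i j t * transvec i j (- t) = 1\<^sub>m n" "transvec i j (- t) * transvec i j t = 1\<^sub>m n"
    using transvec_mult[OF ij, of t] transvec_mult[OF ij, of "- t"] by simp_all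
  have "transvec_act i j t (cr p v) = np (gen_img (transvec i j t) (transvec i j (- t)) a) (- int k - 1) (transvec_act i j t v)"
    unfolding transvec_act_def ak by (rule act_cr[OF _ _ m a]) (simp_all add: transvec_def)
  then show ?thesis unfolding gen_img_transvec[OF ij a] by (simp add: ak transvec_cr_def cr_def)
qed

lemma transvec_act_Om: "transvec_act i j t Om = Om" and lin_transvec_act: "lin (transvec_act i j t)"
  by (simp_all add: transvec_act_def act_Om lin_act)

text \<open>On each vector the one-parameter group \<open>transvec_act i j\<close> is polynomial in its parameter, with
  linear coefficient \<open>gl_diff i j N\<close>.\<close>

definition taylor :: "nat \<Rightarrow> nat \<Rightarrow> nat \<Rightarrow> 'v \<Rightarrow> bool" where
  "taylor i j N v \<longleftrightarrow> (\<exists>M r. (\<forall>m\<ge>M. r m = 0) \<and> (\<forall>t. transvec_act i j t v = (\<Sum>m<M. sc (t ^ m) (r m)))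
    \<and> r 0 = v \<and> r 1 = gl_diff i j N v)"

text \<open>The image of a letter is affine in t, so each letter raises the degree bound by one, and
  the linear coefficient obeys the product rule \<open>gl_diff_cr\<close>.\<close>

lemma taylor_word:
  assumes ij: "i < n" "j < n" "i \<noteq> j" and w: "set w \<subseteq> idx" "\<forall>p\<in>set w. snd p < N"
  shows "taylor i j N (word w)"
  using w
proof (induction w)
  case Nil
  have "gl_diff i j N Om = 0" using ij by (simp add: gl_diff_def gl_op_Om)
  then show ?case unfolding taylor_def
    by (intro exI[of _ 1] exI[of _ "\<lambda>m. if m = 0 then Om else 0"]) (simp add: transvec_act_Om)
next
  case (Cons p w)
  then obtain M r where r: "\<forall>m\<ge>M. r m = 0" "\<forall>t. transvec_act i j t (word w) = (\<Sum>m<M. sc (t ^ m) (r m))"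
    "r 0 = word w" "r 1 = gl_diff i j N (word w)" unfolding taylor_def by auto
  have p: "p \<in> idx" "snd p < N" using Cons.prems by auto
  \<comment> \<open>The coefficient of t^m after applying \<open>cr p\<close> plus t times
    \<open>transvec_cr i j p\<close> to the polynomial of the shorter word.\<close>
  define r' where "r' m = cr p (r m) + (case m of 0 \<Rightarrow> 0 | Suc m' \<Rightarrow> transvec_cr i j p (r m'))" for m
  have "transvec_act i j t (word (p # w)) = (\<Sum>m<Suc M. sc (t ^ m) (r' m))" for t
  proof -
    have "(\<Sum>m<Suc M. sc (t ^ m) (r' m)) = (\<Sum>m<Suc M. sc (t ^ m) (cr p (r m)))
        + (\<Sum>m<Suc M. sc (t ^ m) (case m of 0 \<Rightarrow> 0 | Suc m' \<Rightarrow> transvec_cr i j p (r m')))"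
      by (simp only: r'_def scale_right_distrib sum.distrib)
    also have "(\<Sum>m<Suc M. sc (t ^ m) (cr p (r m))) = cr p (transvec_act i j t (word w))"
      using r(1,2) by (simp add: lin_sum[OF lin_cr] cr_scale)
    also have "(\<Sum>m<Suc M. sc (t ^ m) (case m of 0 \<Rightarrow> 0 | Suc m' \<Rightarrow> transvec_cr i j p (r m')))
        = sc t (transvec_cr i j p (transvec_act i j t (word w)))"
      unfolding sum.lessThan_Suc_shift using r(2)
      by (simp add: lin_sum[OF lin_transvec_cr] lin_scale[OF lin_transvec_cr] scale_sum_right)
    finally show ?thesis by (simp add: transvec_act_cr[OF ij p(1)])
  qed
  moreover have "\<forall>m\<ge>Suc M. r' m = 0"
    using r(1) by (auto simp: r'_def lin_zero[OF lin_transvec_cr] split: nat.splits)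
  moreover have "r' 0 = word (p # w)" by (simp add: r'_def r(3))
  moreover have "r' 1 = gl_diff i j N (word (p # w))"
    using r(3,4) gl_diff_cr[OF ij(1,2) p] by (simp add: r'_def)
  ultimately show ?case unfolding taylor_def by blast
qed

lemma taylor_linear:
  assumes u: "taylor i j N u" and v: "taylor i j N v"
  shows "taylor i j N (sc c u + v)"
proof -
  obtain M1 r1 where r1: "\<forall>m\<ge>M1. r1 m = 0" "\<forall>t. transvec_act i j t u = (\<Sum>m<M1. sc (t ^ m) (r1 m))"
    "r1 0 = u" "r1 1 = gl_diff i j N u" using u unfolding taylor_def by auto
  obtain M2 r2 where r2: "\<forall>m\<ge>M2. r2 m = 0" "\<forall>t. transvec_act i j t v = (\<Sum>m<M2. sc (t ^ m) (r2 m))"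
    "r2 0 = v" "r2 1 = gl_diff i j N v" using v unfolding taylor_def by auto
  define M where "M = max M1 M2"
  have M1: "(\<Sum>m<M1. sc (t ^ m) (r1 m)) = (\<Sum>m<M. sc (t ^ m) (r1 m))" for t
    by (rule sum.mono_neutral_left) (use r1(1) in \<open>auto simp: M_def\<close>)
  have M2: "(\<Sum>m<M2. sc (t ^ m) (r2 m)) = (\<Sum>m<M. sc (t ^ m) (r2 m))" for t
    by (rule sum.mono_neutral_left) (use r2(1) in \<open>auto simp: M_def\<close>)
  have "transvec_act i j t (sc c u + v) = (\<Sum>m<M. sc (t ^ m) (sc c (r1 m) + r2 m))" for t
    using r1(2) r2(2) by (simp add: lin_add[OF lin_transvec_act] lin_scale[OF lin_transvec_act] M1 M2 scale_right_distrib
        sum.distrib scale_sum_right mult.commute)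
  then show ?thesis unfolding taylor_def
    using r1 r2 by (intro exI[of _ M] exI[of _ "\<lambda>m. sc c (r1 m) + r2 m"])
      (auto simp: M_def lin_add[OF lin_gl_diff] lin_scale[OF lin_gl_diff])
qed

text \<open>In each coordinate this is a complex polynomial with constant value, so its linear
  coefficient is zero.\<close>

lemma poly_coeff_eq_0:
  assumes "\<forall>t. (\<Sum>m<M. sc (t ^ m) (r m)) = r 0" "\<forall>m\<ge>M. r m = 0"
  shows "r 1 = 0"
proof (rule coef_ext)
  fix w assume "w \<in> words"
  define P where "P = (\<Sum>m<M. monom (coef w (r m)) m) - [:coef w (r 0):]"
  have "poly P t = 0" for t
    using arg_cong[OF assms(1)[rule_format, of t], of "coef w"]
    by (simp add: P_def poly_sum poly_monom coef_sum coef_scale mult.commute)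
  then have "P = 0" using poly_all_0_iff_0 by blast
  then have "coeff P 1 = 0" by simp
  moreover have "coeff P 1 = (if 1 < M then coef w (r 1) else 0)"
    by (simp add: P_def Polynomial.coeff_sum sum.delta)
  ultimately show "coef w (r 1) = coef w 0" using assms(2) by (auto split: if_splits)
qed

lemma W_gl_diff:
  assumes ij: "i < n" "j < n" "i \<noteq> j" and v: "v \<in> W" "v \<in> ws (int N)"
  shows "gl_diff i j N v = 0"
proof -
  have m: "transvec i j t * transvec i j (- t) = 1\<^sub>m n" "transvec i j (- t) * transvec i j t = 1\<^sub>m n" for t
    using transvec_mult[OF ij, of t] transvec_mult[OF ij, of "- t"] by simp_all
  have inv: "transvec_act i j t v = v" for t
    unfolding transvec_act_def by (rule W_act[OF _ _ m v(1)]) (simp_all add: transvec_def)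
  have t0: "taylor i j N 0"
    unfolding taylor_def by (intro exI[of _ 0] exI[of _ "\<lambda>_. 0"]) (simp add: lin_zero[OF lin_transvec_act] lin_zero[OF lin_gl_diff])
  have "taylor i j N v"
    using ws_expand[OF v(2)]
  proof (induction rule: span_induct_alt)
    case base
    then show ?case by (rule t0)
  next
    case (step c x y)
    then obtain w where w: "x = word w" "w \<in> words" "mode_wt w = N" by auto
    have "taylor i j N x" unfolding w(1)
      using wordsD[OF w(2)] mode_wt_mode[of _ w] w(3) by (intro taylor_word[OF ij]) auto
    then show ?case using taylor_linear step by blast
  qed
  then obtain M r where "\<forall>m\<ge>M. r m = 0" "\<forall>t. transvec_act i j t v = (\<Sum>m<M. sc (t ^ m) (r m))"
    "r 0 = v" "r 1 = gl_diff i j N v" unfolding taylor_def by auto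
  then show ?thesis using poly_coeff_eq_0[where M = M and r = r] inv by simp
qed

definition count_gen :: "nat \<Rightarrow> (nat \<times> nat) list \<Rightarrow> nat" where "count_gen a w = length (filter (\<lambda>p. fst p = a) w)"

lemma gl_op_word:
  assumes "a < 2 * n" "set w \<subseteq> idx" "\<forall>p\<in>set w. snd p < N"
  shows "gl_op a a N (word w) = sc (of_nat (count_gen a w)) (word w)"
  using assms(2,3)
proof (induction w)
  case Nil
  then show ?case using assms(1) by (simp add: gl_op_Om count_gen_def)
next
  case (Cons p w)
  then show ?case using assms(1)
    by (cases p) (auto simp: gl_op_cr count_gen_def cr_scale scale_left_distrib)
qed

lemma gl_op_expand:
  assumes "a < 2 * n" "v \<in> ws (int N)"
  shows "gl_op a a N v = (\<Sum>w\<in>supp v. sc (coef w v * of_nat (count_gen a w)) (word w))"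
proof -
  have "gl_op a a N v = gl_op a a N (\<Sum>w\<in>supp v. sc (coef w v) (word w))"
    by (rule arg_cong[OF expand])
  also have "\<dots> = (\<Sum>w\<in>supp v. sc (coef w v) (gl_op a a N (word w)))"
    by (simp add: lin_sum[OF lin_gl_op] lin_scale[OF lin_gl_op])
  also have "\<dots> = (\<Sum>w\<in>supp v. sc (coef w v * of_nat (count_gen a w)) (word w))"
  proof (intro sum.cong refl)
    fix w assume "w \<in> supp v"
    then have w: "w \<in> words" "mode_wt w = N" using ws_coef[OF assms(2)] by auto
    then have "gl_op a a N (word w) = sc (of_nat (count_gen a w)) (word w)"
      using mode_wt_mode[of _ w] by (intro gl_op_word[OF assms(1) wordsD]) auto
    then show "sc (coef w v) (gl_op a a N (word w)) = sc (coef w v * of_nat (count_gen a w)) (word w)"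
      by simp
  qed
  finally show ?thesis .
qed

definition scaling :: "nat \<Rightarrow> complex \<Rightarrow> complex mat" where
  "scaling i s = mat n n (\<lambda>(r, c). if r = c then if r = i then s else 1 else 0)"

lemma scaling_mult: "s * t = 1 \<Longrightarrow> scaling i s * scaling i t = 1\<^sub>m n"
proof (rule eq_matI)
  fix r c assume st: "s * t = 1" and "r < dim_row (1\<^sub>m n)" "c < dim_col (1\<^sub>m n)"
  then have rc: "r < n" "c < n" by auto
  have "(scaling i s * scaling i t) $$ (r, c) = (\<Sum>k<n. scaling i s $$ (r, k) * scaling i t $$ (k, c))"
    using rc by (auto simp: scaling_def scalar_prod_def atLeast0LessThan)
  also have "\<dots> = (\<Sum>k<n. if k = r then (if r = c then 1 else 0) else 0)"
    by (intro sum.cong refl) (use rc st in \<open>auto simp: scaling_def\<close>)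
  also have "\<dots> = 1\<^sub>m n $$ (r, c)" using rc by (simp add: sum.delta)
  finally show "(scaling i s * scaling i t) $$ (r, c) = 1\<^sub>m n $$ (r, c)" .
qed (auto simp: scaling_def)

lemma gen_img_scaling:
  assumes i: "i < n" and a: "a < 2 * n"
  shows "gen_img (scaling i 2) (scaling i (1/2)) a = sc (if a = i then 2 else if a = n + i then 1/2 else 1) (gen a)"
proof (cases "a < n")
  case True
  have "gen_img (scaling i 2) (scaling i (1/2)) a = (\<Sum>c<n. if c = a then sc (if a = i then 2 else 1) (e c) else 0)"
    unfolding gen_img_e[OF True] by (intro sum.cong refl) (use True in \<open>auto simp: scaling_def\<close>)
  then show ?thesis using True i by (simp add: sum.delta gen_def)
next
  case False
  then obtain l where l: "a = n + l" "l < n" using a le_Suc_ex[of n a] by auto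
  have "gen_img (scaling i 2) (scaling i (1/2)) a = (\<Sum>c<n. if c = l then sc (if l = i then 1/2 else 1) (f c) else 0)"
    unfolding l(1) gen_img_f[OF l(2)] by (intro sum.cong refl) (use l in \<open>auto simp: scaling_def\<close>)
  then show ?thesis using l i by (simp add: sum.delta gen_def)
qed

text \<open>Scaling e_i by 2 multiplies a word by 2 to the number of its e_i minus the number of its
  f_i. Powers of 2 are distinct, so this single value replaces a whole torus.\<close>

lemma W_count_gen:
  assumes i: "i < n" and v: "v \<in> W" and w: "w \<in> words" "coef w v \<noteq> 0"
  shows "count_gen i w = count_gen (n + i) w"
proof -
  have m: "scaling i 2 * scaling i (1/2) = 1\<^sub>m n" "scaling i (1/2) * scaling i 2 = 1\<^sub>m n"
    by (simp_all add: scaling_mult)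
  have c: "scaling i 2 \<in> carrier_mat n n" "scaling i (1/2) \<in> carrier_mat n n" by (simp_all add: scaling_def)
  let ?\<phi> = "act (scaling i 2) (scaling i (1/2))"
  have word: "?\<phi> (word w) = sc (2 ^ count_gen i w * (1/2) ^ count_gen (n + i) w) (word w)" if "set w \<subseteq> idx" for w
    using that
  proof (induction w)
    case Nil
    then show ?case by (simp add: act_Om count_gen_def)
  next
    case (Cons p w)
    obtain a k where p: "p = (a, k)" by (cases p)
    have a: "a < 2 * n" using Cons.prems p by simp
    have "?\<phi> (word (p # w)) = sc (if a = i then 2 else if a = n + i then 1/2 else 1) (cr p (?\<phi> (word w)))"
      using act_cr[OF c m a, of k "word w"] by (simp add: p gen_img_scaling[OF i a] cr_def[of "(a, k)"])
    then show ?case using Cons i by (simp add: cr_scale p count_gen_def)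
  qed
  have "coef w (?\<phi> x) = 2 ^ count_gen i w * (1/2) ^ count_gen (n + i) w * coef w x" for x
  proof (induction x rule: word_induct)
    case (word w')
    then show ?case using w(1) by (simp add: \<open>\<And>w. set w \<subseteq> idx \<Longrightarrow> ?\<phi> (word w) = _\<close>[OF wordsD] coef_scale coef_word)
  qed (simp_all add: lin_add[OF lin_act] lin_scale[OF lin_act] coef_add coef_scale algebra_simps)
  from this[of v] have "(2 :: complex) ^ count_gen i w * (1/2) ^ count_gen (n + i) w = 1"
    using W_act[OF c m v] w(2) by simp
  then have "(2 :: complex) ^ count_gen i w = 2 ^ count_gen (n + i) w" by (simp add: field_simps)
  then have "(of_nat (2 ^ count_gen i w) :: complex) = of_nat (2 ^ count_gen (n + i) w)" by simp
  then have "(2 :: nat) ^ count_gen i w = 2 ^ count_gen (n + i) w" by (simp only: of_nat_eq_iff)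
  then show ?thesis by simp
qed

text \<open>On invariants the action on the f's is traded for the transposed action on the e's: off
  the diagonal by transvections, on the diagonal by equality of letter counts.\<close>

lemma W_gl_op:
  assumes ij: "i < n" "j < n" and v: "v \<in> W" "v \<in> ws (int N)"
  shows "gl_op (n + i) (n + j) N v = gl_op j i N v"
proof (cases "i = j")
  case True
  then show ?thesis using ij v W_count_gen[OF ij(1) v(1)]
    by (simp add: gl_op_expand)
next
  case False
  then show ?thesis using W_gl_diff[of j i v N] ij v by (simp add: gl_diff_def)
qed

section \<open>The Casimir operator and generation by quadratics\<close>

definition qop_adj :: "nat \<times> nat \<Rightarrow> 'v \<Rightarrow> 'v" where
  "qop_adj p v = (\<Sum>j<n. an (n + j, snd p) (an (j, fst p) v))"

lemma lin_qop_adj: "lin (qop_adj p)"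
  by (intro linI) (simp_all add: qop_adj_def an_add an_scale sum.distrib scale_sum_right)

text \<open>Annihilating e_j is a positive mode of f_j and conversely, so this is again a
  contraction as in \<open>W_bilinear\<close>.\<close>

lemma qop_adj_W: "v \<in> W \<Longrightarrow> qop_adj p v \<in> W"
proof -
  assume v: "v \<in> W"
  have eq: "qop_adj p v = sc (- 1 / of_nat (Suc (snd p)) / of_nat (Suc (fst p)))
     (\<Sum>j<n. np (gen j) (int (Suc (snd p))) (np (gen (n + j)) (int (Suc (fst p))) v))"
    unfolding qop_adj_def scale_sum_right
  proof (intro sum.cong refl)
    fix j assume "j \<in> {..<n}"
    then show "an (n + j, snd p) (an (j, fst p) v) = sc (- 1 / of_nat (Suc (snd p)) / of_nat (Suc (fst p)))
        (np (gen j) (int (Suc (snd p))) (np (gen (n + j)) (int (Suc (fst p))) v))"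
      by (simp add: an_def dual_def pairing_def add.commute[of j n] del: of_nat_Suc)
  qed
  show ?thesis unfolding eq by (intro subspace_scale[OF subspace_W] W_bilinear v)
qed

lemma qop_adj_ws: "v \<in> ws d \<Longrightarrow> qop_adj p v \<in> ws (d - int (qwt p))"
proof -
  assume v: "v \<in> ws d"
  have eq: "d - int (fst p) - 1 - int (snd p) - 1 = d - int (qwt p)" by (simp add: qwt_def)
  have "an (n + j, snd p) (an (j, fst p) v) \<in> ws (d - int (fst p) - 1 - int (snd p) - 1)" if "j < n" for j
    by (intro an_ws v) (use that in auto)
  then show ?thesis unfolding qop_adj_def eq by (intro subspace_sum[OF subspace_ws]) auto
qed

definition casimir :: "nat \<Rightarrow> 'v \<Rightarrow> 'v" where
  "casimir d v = (\<Sum>k<d. \<Sum>l<d. qop (k, l) (qop_adj (k, l) v))"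

lemma lin_casimir: "lin (casimir d)"
  by (intro linI)
     (simp_all add: casimir_def lin_add[OF lin_qop_adj] lin_scale[OF lin_qop_adj] qop_add qop_scale sum.distrib scale_sum_right)

text \<open>Moving the annihilators of the e's next to their creators regroups the sum into matrix
  units on the e's and on the f's. They pass only operators of the f's, so no correction terms
  arise.\<close>

lemma casimir_eq: "casimir d v = (\<Sum>i<n. \<Sum>j<n. gl_op i j d (gl_op (n + i) (n + j) d v))"
proof -
  let ?T = "\<lambda>k l i j. cr (i, k) (an (j, k) (cr (n + i, l) (an (n + j, l) v)))"
  have T: "cr (i, k) (cr (n + i, l) (an (n + j, l) (an (j, k) v))) = ?T k l i j" if "i < n" "j < n" for i j k l
    using an_an[of "(n + j, l)" "(j, k)" v] an_cr[of "(j, k)" "(n + i, l)" "an (n + j, l) v"] that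
    by (simp add: cr_minus)
  have "casimir d v = (\<Sum>k<d. \<Sum>l<d. \<Sum>i<n. \<Sum>j<n. ?T k l i j)"
    unfolding casimir_def qop_def qop_adj_def fst_conv snd_conv
    by (intro sum.cong refl) (simp add: lin_sum[OF lin_cr] T)
  also have "\<dots> = (\<Sum>k<d. \<Sum>i<n. \<Sum>l<d. \<Sum>j<n. ?T k l i j)"
    by (rule sum.cong[OF refl], rule sum.swap)
  also have "\<dots> = (\<Sum>i<n. \<Sum>k<d. \<Sum>l<d. \<Sum>j<n. ?T k l i j)"
    by (rule sum.swap)
  also have "\<dots> = (\<Sum>i<n. \<Sum>k<d. \<Sum>j<n. \<Sum>l<d. ?T k l i j)"
    by (rule sum.cong[OF refl], rule sum.cong[OF refl], rule sum.swap)
  also have "\<dots> = (\<Sum>i<n. \<Sum>j<n. \<Sum>k<d. \<Sum>l<d. ?T k l i j)"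
    by (rule sum.cong[OF refl], rule sum.swap)
  also have "\<dots> = (\<Sum>i<n. \<Sum>j<n. gl_op i j d (gl_op (n + i) (n + j) d v))"
    unfolding gl_op_def by (simp add: lin_sum[OF lin_an] lin_sum[OF lin_cr])
  finally show ?thesis .
qed

text \<open>On invariants the operator \<open>casimir d\<close> is the Casimir operator of \<open>gl(n)\<close> acting on the \<open>e\<close>'s
  alone, hence a sum of operators of the form \<open>T\<^sup>* T\<close>.\<close>

lemma casimir_inj:
  assumes v: "v \<in> W" "v \<in> ws (int d)" and d: "d > 0" and z: "casimir d v = 0"
  shows "v = 0"
proof -
  have "ip v (casimir d v) = (\<Sum>i<n. \<Sum>j<n. ip (gl_op j i d v) (gl_op j i d v))"
    unfolding casimir_eq ip_sum_right
    by (intro sum.cong refl) (simp add: W_gl_op[OF _ _ v] ip_gl_op)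
  then have "0 = Re (\<Sum>i<n. \<Sum>j<n. ip (gl_op j i d v) (gl_op j i d v))" using z by simp
  also have "\<dots> = (\<Sum>i<n. \<Sum>j<n. Re (ip (gl_op j i d v) (gl_op j i d v)))" by simp
  finally have "(\<Sum>i<n. \<Sum>j<n. Re (ip (gl_op j i d v) (gl_op j i d v))) = 0" by simp
  then have "\<forall>i\<in>{..<n}. (\<Sum>j<n. Re (ip (gl_op j i d v) (gl_op j i d v))) = 0"
    by (subst (asm) sum_nonneg_eq_0_iff) (auto intro!: sum_nonneg ip_self_nonneg)
  then have "\<forall>i\<in>{..<n}. \<forall>j\<in>{..<n}. Re (ip (gl_op j i d v) (gl_op j i d v)) = 0"
    by (subst (asm) sum_nonneg_eq_0_iff) (auto intro!: ip_self_nonneg)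
  then have z: "gl_op i i d v = 0" if "i < n" for i using that ip_self_eq_0 by blast
  have "coef w v = 0" if w: "w \<in> words" for w
  proof (rule ccontr)
    assume c: "coef w v \<noteq> 0"
    \<comment> \<open>A diagonal matrix unit multiplies the coordinate at w by the number of letters
      e_i. With \<open>W_count_gen\<close> the f's are excluded too, and only the empty word, of
      weight 0, is left.\<close>
    have 0: "count_gen i w = 0" if i: "i < n" for i
    proof -
      have "0 = coef w (gl_op i i d v)" using z[OF i] by simp
      also have "\<dots> = (\<Sum>w'\<in>supp v. if w' = w then coef w v * of_nat (count_gen i w) else 0)"
        using i w by (simp add: gl_op_expand[OF _ v(2)] coef_sum coef_scale)
          (intro sum.cong refl, auto simp: coef_word)
      also have "\<dots> = coef w v * of_nat (count_gen i w)"
        using w c finite_support[of v] by (simp add: sum.delta)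
      finally show ?thesis using c by simp
    qed
    have "w = []"
    proof (rule ccontr)
      assume "w \<noteq> []"
      then obtain a k where ak: "(a, k) \<in> set w" by (cases w) auto
      then have a: "a < 2 * n" using wordsD[OF w] by auto
      have "filter (\<lambda>p. fst p = a) w \<noteq> []" using ak by (force simp: filter_empty_conv)
      then have ne: "count_gen a w \<noteq> 0" by (simp add: count_gen_def)
      show False
      proof (cases "a < n")
        case True
        then show ?thesis using ne 0 by simp
      next
        case False
        then obtain l where "a = n + l" "l < n" using a le_Suc_ex[of n a] by auto
        then show ?thesis using ne 0 W_count_gen[OF _ v(1) w c] by simp
      qed
    qed
    then show False using ws_coef[OF v(2) w c] d by (simp add: mode_wt_def)
  qed
  then show ?thesis by (intro coef_ext) simp
qed

lemma qop_span_mon: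
  assumes "x \<in> span (mon ` {ps. wt ps = d})"
  shows "qop p x \<in> span (mon ` {ps. wt ps = qwt p + d})"
  using assms lin_qop subspace_span
proof (rule lin_span)
  fix s assume "s \<in> mon ` {ps. wt ps = d}"
  then obtain ps where "s = mon ps" "wt ps = d" by auto
  then show "qop p s \<in> span (mon ` {ps. wt ps = qwt p + d})"
    by (intro span_base) (auto intro!: image_eqI[of _ _ "p # ps"])
qed

text \<open>In weight d > 0 injectivity makes \<open>casimir d\<close> surjective on invariants, so
  v is a sum of terms q (q* x), and each q* x is an invariant of smaller weight.\<close>

theorem first_fundamental_theorem:
  assumes "v \<in> W" "v \<in> ws (int d)"
  shows "v \<in> span (mon ` {ps. wt ps = d})"
  using assms
proof (induction d arbitrary: v rule: less_induct)
  case (less d)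
  show ?case
  proof (cases "d = 0")
    case True
    have "{w \<in> words. mode_wt w = d} \<subseteq> {[]}"
    proof
      fix w assume "w \<in> {w \<in> words. mode_wt w = d}"
      then show "w \<in> {[]}" using length_le_mode_wt[of w] True by simp
    qed
    then have "word ` {w \<in> words. mode_wt w = d} \<subseteq> word ` {[]}" by (rule image_mono)
    also have "word ` {[]} = mon ` {[]}" by simp
    also have "\<dots> \<subseteq> mon ` {ps. wt ps = d}" using True by (intro image_mono) simp
    finally have "word ` {w \<in> words. mode_wt w = d} \<subseteq> mon ` {ps. wt ps = d}" .
    then show ?thesis using ws_expand[OF less.prems(2)] span_mono by blast
  next
    case False
    let ?U = "W \<inter> ws (int d)"
    have "?U \<subseteq> casimir d ` ?U"
    proof (rule finite_dim_surj)
      show "finite (word ` {w \<in> words. mode_wt w = d})" using finite_words_mode_wt by simp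
      show "?U \<subseteq> span (word ` {w \<in> words. mode_wt w = d})" using ws_expand by blast
      show "subspace ?U" by (intro subspace_inter subspace_W subspace_ws)
      show "lin (casimir d)" by (rule lin_casimir)
      show "casimir d ` ?U \<subseteq> ?U"
      proof
        fix y assume "y \<in> casimir d ` ?U"
        then obtain x where x: "x \<in> W" "x \<in> ws (int d)" "y = casimir d x" by blast
        have "qop p (qop_adj p x) \<in> ws (int d)" for p
          using qop_ws[OF qop_adj_ws[OF x(2)], of p p] by simp
        then have "casimir d x \<in> W" "casimir d x \<in> ws (int d)" unfolding casimir_def
          by (auto intro!: subspace_sum[OF subspace_W] subspace_sum[OF subspace_ws] W_qop qop_adj_W x(1))
        then show "y \<in> ?U" using x by simp
      qed
      show "x = 0" if "x \<in> ?U" "casimir d x = 0" for x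
        using that False casimir_inj[of x d] by auto
    qed
    then obtain x where x: "x \<in> W" "x \<in> ws (int d)" "v = casimir d x" using less.prems by blast
    have "qop p (qop_adj p x) \<in> span (mon ` {ps. wt ps = d})" for p
    proof (cases "qwt p \<le> d")
      case True
      have "qop_adj p x \<in> ws (int (d - qwt p))" using qop_adj_ws[OF x(2), of p] True by (simp add: of_nat_diff)
      moreover have "d - qwt p < d" using True by (simp add: qwt_def)
      ultimately have "qop_adj p x \<in> span (mon ` {ps. wt ps = d - qwt p})"
        using less.IH qop_adj_W[OF x(1)] by blast
      from qop_span_mon[OF this, of p] True show ?thesis by simp
    next
      case False
      then have "qop_adj p x = 0" using ws_neg[OF qop_adj_ws[OF x(2), of p]] by simp
      then show ?thesis by (simp add: lin_zero[OF lin_qop] span_zero)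
    qed
    then show ?thesis unfolding x(3) casimir_def by (intro span_sum)
  qed
qed

end

section \<open>Strong generation\<close>

context symplectic_fermion_algebra
begin

abbreviation hh :: "nat \<Rightarrow> 'v" where "hh \<equiv> h_field V n e f"

lemma h_field_eq: "hh k = sc (fact k) (qv (0, k))"
proof -
  have "wick V [e i, (der ^^ k) (f i)] = sc (fact k) (cr (i, 0) (cr (n + i, k) Om))" if "i < n" for i
    using that by (simp add: wick_def deriv_pow_mode cr_def gen_def)
  then show ?thesis by (simp add: h_field_def qv_def qop_def scale_sum_right)
qed

lemma qv_h: "qv (0, k) = sc (1 / fact k) (hh k)"
  by (simp add: h_field_eq)

lemma qv_ws: "qv p \<in> ws (int (qwt p))"
  using mon_ws[of "[p]"] by (simp add: qv_def)

lemma qv_W: "qv p \<in> W"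
  using mon_W[of "[p]"] by (simp add: qv_def)

lemma der_cr: "der (cr (a, k) v) = cr (a, k) (der v) + sc (of_nat (Suc k)) (cr (a, Suc k) v)"
proof -
  have "- int k - 1 - 1 = - int (Suc k) - 1" by simp
  then have "der (cr (a, k) v) = cr (a, k) (der v) - sc (of_int (- int k - 1)) (cr (a, Suc k) v)"
    unfolding cr_def fst_conv snd_conv deriv_np' by (simp only:)
  also have "(of_int (- int k - 1) :: complex) = - of_nat (Suc k)" by simp
  finally show ?thesis by (simp only: scale_minus_left diff_minus_eq_add)
qed

lemma der_qv: "der (qv (k, l)) = sc (of_nat (Suc k)) (qv (Suc k, l)) + sc (of_nat (Suc l)) (qv (k, Suc l))"
  by (simp add: qv_def qop_def der_cr cr_add cr_scale sum.distrib scale_sum_right add.commute del: of_nat_Suc)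

lemma ws_der: "v \<in> ws d \<Longrightarrow> der v \<in> ws (d + 1)"
  unfolding deriv_op_def using ws_np[OF _ Om_ws, of v d "-2"] by (simp add: add.commute)

definition letter :: "nat \<times> nat \<Rightarrow> 'v" where "letter p = (der ^^ snd p) (hh (fst p))"

lemma letter_der: "der (letter (j, k)) = letter (j, Suc k)"
  by (simp add: letter_def)

lemma letter_der_pow: "(der ^^ m) (letter (j, k)) = letter (j, m + k)"
  by (simp add: letter_def funpow_add)

lemma h_ws: "hh j \<in> ws (int (j + 2))"
  using qv_ws[of "(0, j)"] subspace_scale[OF subspace_ws] by (simp add: h_field_eq qwt_def)

lemma letter_ws: "letter p \<in> ws (int (qwt p))"
proof -
  have "(der ^^ k) (hh j) \<in> ws (int (j + 2) + int k)" for j k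
  proof (induction k)
    case (Suc k)
    then show ?case using ws_der[of "(der ^^ k) (hh j)" "int (j + 2) + int k"] by (simp add: algebra_simps)
  qed (use h_ws[of j] in simp)
  from this[of "snd p" "fst p"] show ?thesis by (simp add: letter_def qwt_def algebra_simps)
qed

lemma letter_even: "letter p \<in> homog V False"
proof -
  have "(der ^^ k) (hh j) \<in> homog V False" for j k
  proof (induction k)
    case 0
    then show ?case by (simp add: h_field_eq homog_scale qv_even)
  qed (simp add: homog_deriv)
  then show ?thesis by (simp add: letter_def)
qed

lemma letter_W: "letter p \<in> W"
proof -
  have "(der ^^ k) (hh j) \<in> W" for j k
  proof (induction k)
    case 0
    then show ?case by (simp add: h_field_eq subspace_scale[OF subspace_W] qv_W)
  qed (simp add: W_der)
  then show ?thesis by (simp add: letter_def)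
qed

definition hword :: "(nat \<times> nat) list \<Rightarrow> 'v" where "hword xs = foldr (\<lambda>p. np (letter p) (-1)) xs Om"

lemma hword_Nil [simp]: "hword [] = Om" and hword_Cons [simp]: "hword (p # xs) = np (letter p) (-1) (hword xs)"
  by (simp_all add: hword_def)

lemma hword_ws: "hword xs \<in> ws (int (wt xs))"
proof (induction xs)
  case (Cons p xs)
  then show ?case using ws_np[OF letter_ws[of p] Cons, of "-1"] by simp
qed (simp add: Om_ws)

lemma hword_W: "hword xs \<in> W"
  by (induction xs) (simp_all add: W_Om W_np letter_W)

lemma hword_even: "hword xs \<in> homog V False"
proof (induction xs)
  case (Cons p xs)
  then show ?case using nprod_homog[OF letter_even[of p] Cons, of "-1"] by simp
qed (simp add: vacuum_even)

definition hspan :: "nat \<Rightarrow> 'v set" where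
  "hspan d = span (hword ` {xs. fst ` set xs \<subseteq> {..<2 * n} \<and> wt xs = d})"

lemma subspace_hspan: "subspace (hspan d)"
  by (simp add: hspan_def)

lemmas hspan_0 = subspace_0[OF subspace_hspan]
  and hspan_add = subspace_add[OF subspace_hspan]
  and hspan_diff = subspace_diff[OF subspace_hspan]
  and hspan_scale = subspace_scale[OF subspace_hspan]
  and hspan_sum = subspace_sum[OF subspace_hspan]

lemma hspan_hword: "fst ` set xs \<subseteq> {..<2 * n} \<Longrightarrow> hword xs \<in> hspan (wt xs)"
  unfolding hspan_def by (intro span_base) auto

lemma hspan_lin:
  assumes "v \<in> hspan d" "lin F" "\<And>xs. fst ` set xs \<subseteq> {..<2 * n} \<Longrightarrow> wt xs = d \<Longrightarrow> F (hword xs) \<in> hspan d'"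
  shows "F v \<in> hspan d'"
  by (rule lin_span[OF assms(1)[unfolded hspan_def] assms(2) subspace_hspan]) (use assms(3) in auto)

lemma hspan_letter:
  assumes "v \<in> hspan d" "fst p < 2 * n" "d' = qwt p + d"
  shows "np (letter p) (-1) v \<in> hspan d'"
proof (rule hspan_lin[OF assms(1) nprod_linear_right])
  fix xs :: "(nat \<times> nat) list" assume "fst ` set xs \<subseteq> {..<2 * n}" "wt xs = d"
  then show "np (letter p) (-1) (hword xs) \<in> hspan d'"
    using hspan_hword[of "p # xs"] assms(2,3) by simp
qed

lemma hspan_der: "v \<in> hspan d \<Longrightarrow> der v \<in> hspan (Suc d)"
proof (rule hspan_lin[OF _ lin_deriv])
  fix xs :: "(nat \<times> nat) list" assume "fst ` set xs \<subseteq> {..<2 * n}" "wt xs = d"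
  then show "der (hword xs) \<in> hspan (Suc d)"
  proof (induction xs arbitrary: d)
    case (Cons p xs)
    obtain j k where p: "p = (j, k)" by (cases p)
    have j: "j < 2 * n" "fst ` set xs \<subseteq> {..<2 * n}" using Cons.prems by (auto simp: p)
    have "np (letter (j, Suc k)) (-1) (hword xs) \<in> hspan (Suc d)"
      by (rule hspan_letter[OF hspan_hword[OF j(2)]]) (use j Cons.prems in \<open>auto simp: p qwt_def\<close>)
    moreover have "np (letter (j, k)) (-1) (der (hword xs)) \<in> hspan (Suc d)"
      by (rule hspan_letter[OF Cons.IH[OF j(2) refl]]) (use j Cons.prems in \<open>auto simp: p qwt_def\<close>)
    ultimately show ?case
      by (simp add: p deriv_np letter_der hspan_add)
  qed (simp add: hspan_0)
qed assumption

text \<open>By \<open>der_qv\<close>, q_{k+1,l} is a combination of the derivative of q_{k,l} and of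
  q_{k,l+1}; the recursion on k ends at the h's. The bound keeps their indices below 2n.\<close>

lemma qv_light:
  assumes "k + l < 2 * n"
  shows "qv (k, l) \<in> span (letter ` {p. fst p < 2 * n \<and> qwt p = k + l + 2})"
  using assms
proof (induction k arbitrary: l)
  case 0
  then have "hh l \<in> letter ` {p. fst p < 2 * n \<and> qwt p = 0 + l + 2}"
    by (intro image_eqI[of _ _ "(l, 0)"]) (auto simp: letter_def qwt_def)
  then show ?case unfolding qv_h by (intro span_scale span_base)
next
  case (Suc k)
  let ?T = "span (letter ` {p. fst p < 2 * n \<and> qwt p = Suc k + l + 2})"
  have der: "der x \<in> ?T" if "x \<in> span (letter ` {p. fst p < 2 * n \<and> qwt p = k + l + 2})" for x
    using that lin_deriv subspace_span
  proof (rule lin_span)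
    fix s assume "s \<in> letter ` {p. fst p < 2 * n \<and> qwt p = k + l + 2}"
    then obtain i m where im: "s = letter (i, m)" "i < 2 * n" "qwt (i, m) = k + l + 2" by auto
    show "der s \<in> ?T" unfolding im(1) letter_der using im(2,3)
      by (intro span_base imageI) (auto simp: qwt_def)
  qed
  have "qv (k, Suc l) \<in> ?T" using Suc.IH[of "Suc l"] Suc.prems by simp
  moreover have "der (qv (k, l)) \<in> ?T" using Suc.IH[of l] Suc.prems by (intro der) simp
  ultimately have "der (qv (k, l)) - sc (of_nat (Suc l)) (qv (k, Suc l)) \<in> ?T"
    by (intro span_diff span_scale)
  then have "sc (of_nat (Suc k)) (qv (Suc k, l)) \<in> ?T"
    by (simp add: der_qv del: of_nat_Suc)
  then have "sc (1 / of_nat (Suc k)) (sc (of_nat (Suc k)) (qv (Suc k, l))) \<in> ?T"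
    by (rule span_scale)
  moreover have "sc (1 / of_nat (Suc k)) (sc (of_nat (Suc k)) x) = x" for x
    by (simp del: of_nat_Suc)
  ultimately show ?case by (simp only:)
qed

lemma hspan_qA_light:
  assumes "fst p + snd p < 2 * n" "v \<in> hspan d" "d' = qwt p + d"
  shows "qA p v \<in> hspan d'"
proof -
  have "np x (-1) v \<in> hspan d'" if "x \<in> span (letter ` {q. fst q < 2 * n \<and> qwt q = qwt p})" for x
    using that nprod_linear_left subspace_hspan
  proof (rule lin_span)
    fix s assume "s \<in> letter ` {q. fst q < 2 * n \<and> qwt q = qwt p}"
    then obtain q where q: "s = letter q" "fst q < 2 * n" "qwt q = qwt p" by auto
    show "np s (-1) v \<in> hspan d'" unfolding q(1)
      by (rule hspan_letter[OF assms(2) q(2)]) (simp add: q(3) assms(3))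
  qed
  then show ?thesis using qv_light[of "fst p" "snd p"] assms(1) by (simp add: qA_def qwt_def)
qed

lemma wt_update: "j < length ps \<Longrightarrow> wt (ps[j := r]) + qwt (ps ! j) = wt ps + qwt r"
  by (induction ps arbitrary: j) (auto split: nat.splits)

lemma wt_up: "j < length ps \<Longrightarrow> wt (ps[j := up1 p (ps ! j)]) = wt ps + qwt p"
    "j < length ps \<Longrightarrow> wt (ps[j := up2 p (ps ! j)]) = wt ps + qwt p"
  using wt_update[of j ps "up1 p (ps ! j)"] wt_update[of j ps "up2 p (ps ! j)"]
  by (simp_all add: up1_def up2_def qwt_def)

lemma shift_coeff_pos: "shift_coeff l k u > 0"
  by (simp add: shift_coeff_def)

section \<open>The inductive step: weight d from all smaller weights\<close>

context
  fixes d :: nat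
  assumes below: "\<And>v x. v \<in> W \<Longrightarrow> v \<in> ws x \<Longrightarrow> x < int d \<Longrightarrow> v \<in> hspan (nat x)"
begin

text \<open>A cone modulo \<open>hspan d\<close> around q_{0,d-2}. It is closed under addition, so
  the coefficient obtained in the end is known to be nonzero without being computed.\<close>

definition pos :: "'v \<Rightarrow> bool" where
  "pos v \<longleftrightarrow> (\<exists>c > 0. v - sc (of_real c) (qv (0, d - 2)) \<in> hspan d)"

lemma pos_add: "pos u \<Longrightarrow> pos v \<Longrightarrow> pos (u + v)"
proof -
  assume "pos u" "pos v"
  then obtain b c where bc: "b > 0" "u - sc (of_real b) (qv (0, d - 2)) \<in> hspan d"
    "c > 0" "v - sc (of_real c) (qv (0, d - 2)) \<in> hspan d" unfolding pos_def by blast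
  have eq: "u + v - sc (of_real (b + c)) (qv (0, d - 2))
     = (u - sc (of_real b) (qv (0, d - 2))) + (v - sc (of_real c) (qv (0, d - 2)))"
    by (simp add: scale_left_distrib)
  have "u + v - sc (of_real (b + c)) (qv (0, d - 2)) \<in> hspan d"
    unfolding eq by (rule hspan_add[OF bc(2,4)])
  then show ?thesis unfolding pos_def using bc by (intro exI[of _ "b + c"]) auto
qed

lemma pos_scale: "pos u \<Longrightarrow> b > 0 \<Longrightarrow> pos (sc (of_real b) u)"
proof -
  assume "pos u" and b: "b > 0"
  then obtain c where c: "c > 0" "u - sc (of_real c) (qv (0, d - 2)) \<in> hspan d" unfolding pos_def by blast
  have "sc (of_real b) u - sc (of_real (b * c)) (qv (0, d - 2)) \<in> hspan d"
    using hspan_scale[OF c(2), of "of_real b"] by (simp add: scale_right_diff_distrib)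
  then show ?thesis unfolding pos_def using b c by (intro exI[of _ "b * c"]) auto
qed

lemma pos_hspan_add: "x \<in> hspan d \<Longrightarrow> pos u \<Longrightarrow> pos (x + u)"
proof -
  assume x: "x \<in> hspan d" and "pos u"
  then obtain c where c: "c > 0" "u - sc (of_real c) (qv (0, d - 2)) \<in> hspan d" unfolding pos_def by blast
  then have "x + u - sc (of_real c) (qv (0, d - 2)) \<in> hspan d"
    using hspan_add[OF x c(2)] by (simp add: algebra_simps)
  then show ?thesis unfolding pos_def using c by blast
qed

lemma pos_sum: "(\<And>j. j < Suc m \<Longrightarrow> pos (u j)) \<Longrightarrow> pos (\<Sum>j<Suc m. u j)"
  by (induction m) (auto intro: pos_add)

text \<open>Derivatives of vectors of weight d-1 lie in \<open>hspan d\<close>, so by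
  \<open>der_qv\<close> q_{k+1,l} is congruent to a negative multiple of q_{k,l+1}. Each unit of the
  first index costs a sign, and none remains for even k.\<close>

lemma qv_mod:
  assumes "k + l + 2 = d"
  shows "\<exists>c > 0. qv (k, l) - sc ((-1) ^ k * of_real c) (qv (0, d - 2)) \<in> hspan d"
  using assms
proof (induction k arbitrary: l)
  case 0
  then have "l = d - 2" by simp
  then show ?case by (intro exI[of _ 1]) (simp add: hspan_0)
next
  case (Suc k)
  then obtain c where c: "c > 0" "qv (k, Suc l) - sc ((-1) ^ k * of_real c) (qv (0, d - 2)) \<in> hspan d"
    using Suc.IH[of "Suc l"] by auto
  have "qv (k, l) \<in> hspan (nat (int (k + l + 2)))"
    using qv_ws[of "(k, l)"] Suc.prems by (intro below qv_W) (auto simp: qwt_def)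
  then have "qv (k, l) \<in> hspan (k + l + 2)" by (simp only: nat_int)
  then have "der (qv (k, l)) \<in> hspan d"
    using hspan_der[of "qv (k, l)" "k + l + 2"] Suc.prems by simp
  then have x: "der (qv (k, l)) - sc (of_nat (Suc l)) (qv (k, Suc l) - sc ((-1) ^ k * of_real c) (qv (0, d - 2))) \<in> hspan d"
    by (intro hspan_diff hspan_scale c(2))
  have "sc (1 / of_nat (Suc k)) (der (qv (k, l)) - sc (of_nat (Suc l))
        (qv (k, Suc l) - sc ((-1) ^ k * of_real c) (qv (0, d - 2))))
     = qv (Suc k, l) - sc ((-1) ^ Suc k * of_real (real (Suc l) * c / real (Suc k))) (qv (0, d - 2))"
    by (simp add: der_qv scale_right_distrib scale_right_diff_distrib mult_ac del: of_nat_Suc)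
  moreover have "real (Suc l) * c / real (Suc k) > 0" using c by simp
  ultimately show ?case using hspan_scale[OF x] by metis
qed

text \<open>Apart from \<open>l\<close> only even indices occur, so all coefficients are positive and nothing cancels.\<close>

lemma mon_pos:
  assumes "even k" "\<forall>p\<in>set ps. even (fst p) \<and> even (snd p)" "wt ((k, l) # ps) = d" "wt ps \<le> 2 * n"
  shows "pos (mon ((k, l) # ps))"
  using assms
proof (induction "length ps" arbitrary: k l ps)
  case 0
  then have "ps = []" "k + l + 2 = d" by (simp_all add: qwt_def)
  then show ?case using qv_mod[of k l] 0 by (simp add: pos_def qv_def)
next
  case (Suc m)
  then obtain p qs where ps: "ps = p # qs" by (cases ps) auto
  have m: "m = length qs" using Suc by (simp add: ps)
  have ev: "even (fst p)" "even (snd p)" "\<forall>p\<in>set qs. even (fst p) \<and> even (snd p)"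
    using Suc.prems by (auto simp: ps)
  have d: "d = qwt p + wt ((k, l) # qs)" and le: "qwt p + wt qs \<le> 2 * n"
    using Suc.prems by (simp_all add: ps)
  let ?r = "(k, l) # qs"
  have "mon ?r \<in> hspan (nat (int (wt ?r)))"
    using mon_ws[of ?r] d by (intro below mon_W) (auto simp: qwt_def)
  then have "mon ?r \<in> hspan (wt ?r)" by (simp only: nat_int)
  \<comment> \<open>As \<open>wt ps\<close> is at most 2n, the indices of p sum to at most 2n-2, so
    p is light.\<close>
  then have A: "qA p (mon ?r) \<in> hspan d"
    by (rule hspan_qA_light[rotated]) (use d le in \<open>auto simp: qwt_def\<close>)
  have co: "co1 p r = of_real (real (shift_coeff (snd p) (fst p) (fst r)))" "co2 p r = of_real (real (shift_coeff (fst p) (snd p) (snd r)))" for r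
    using ev by (simp_all add: co1_def co2_def)
  have "pos (shifts p ?r j)" if j: "j < Suc (length qs)" for j
  proof -
    have "pos (mon (?r[j := up1 p (?r ! j)])) \<and> pos (mon (?r[j := up2 p (?r ! j)]))"
    proof (cases j)
      \<comment> \<open>The shift hits the distinguished letter, whose first index stays even
        because \<open>qwt p\<close> is even.\<close>
      case 0
      have "pos (mon ((k + qwt p, l) # qs))" "pos (mon ((k, l + qwt p) # qs))"
        by (rule Suc.hyps(1)[OF m]; use Suc.prems ev d le in \<open>simp add: qwt_def\<close>)+
      then show ?thesis by (simp add: 0 up1_def up2_def)
    next
      \<comment> \<open>The weight of p moves into \<open>qs\<close>, so the tail keeps the weight
        of \<open>ps\<close> and with it the bound 2n.\<close>
      case (Suc j')
      have j': "j' < length qs" using j Suc by simp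
      have set: "set (qs[j' := u]) \<subseteq> insert u (set qs)" for u by (rule set_update_subset_insert)
      have q: "qs ! j' \<in> set qs" using j' by simp
      have 1: "\<forall>p\<in>set (qs[j' := up1 p (qs ! j')]). even (fst p) \<and> even (snd p)"
        using set[of "up1 p (qs ! j')"] ev q by (auto simp: up1_def qwt_def)
      have 2: "\<forall>p\<in>set (qs[j' := up2 p (qs ! j')]). even (fst p) \<and> even (snd p)"
        using set[of "up2 p (qs ! j')"] ev q by (auto simp: up2_def qwt_def)
      have "pos (mon ((k, l) # qs[j' := up1 p (qs ! j')]))"
        by (rule Suc.hyps(1)[OF _ Suc.prems(1) 1]) (use m d le wt_up[OF j', of p] in auto)
      moreover have "pos (mon ((k, l) # qs[j' := up2 p (qs ! j')]))"
        by (rule Suc.hyps(1)[OF _ Suc.prems(1) 2]) (use m d le wt_up[OF j', of p] in auto)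
      ultimately show ?thesis by (simp add: Suc)
    qed
    then show ?thesis unfolding shifts_def co using shift_coeff_pos by (intro pos_add pos_scale) auto
  qed
  then have "pos (\<Sum>j<Suc (length qs). shifts p ?r j)"
    by (rule pos_sum)
  then have "pos (qop p (mon ?r))"
    unfolding qop_mon using pos_hspan_add[OF A] by simp
  then show ?case by (simp add: ps qop_commute[of "(k, l)" p])
qed

text \<open>For indices below 2n the vector q_{0,d-2} is a generator up to a scalar. From 2n on, the
  monomial q_{0,l} q_{0,0}^n of weight d is zero and also \<open>pos\<close>, which puts q_{0,d-2}
  into \<open>hspan d\<close>.\<close>

lemma qv_hspan: "qwt p = d \<Longrightarrow> qv p \<in> hspan d"
proof -
  assume p: "qwt p = d"
  have 0: "qv (0, d - 2) \<in> hspan d"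
  proof (cases "d - 2 < 2 * n")
    case True
    have "Om \<in> hspan 0" using hspan_hword[of "[]"] by simp
    then show ?thesis using hspan_qA_light[of "(0, d - 2)" Om 0 d] True p by (simp add: qA_Om qwt_def)
  next
    case False
    define l where "l = d - 2 - 2 * n"
    have d: "d = l + 2 + 2 * n" using False p by (simp add: l_def qwt_def)
    have wtr: "wt (replicate m (0, 0)) = 2 * m" for m by (induction m) (simp_all add: qwt_def)
    have "pos (mon ((0, l) # replicate n (0, 0)))"
      by (rule mon_pos) (use d in \<open>auto simp: wtr qwt_def\<close>)
    moreover have "mon ((0, l) # replicate n (0, 0)) = 0"
      by (rule mon_eq_0) auto
    ultimately obtain c where c: "c > 0" "0 - sc (of_real c) (qv (0, d - 2)) \<in> hspan d"
      unfolding pos_def by auto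
    have "sc (- 1 / of_real c) (0 - sc (of_real c) (qv (0, d - 2))) \<in> hspan d"
      by (rule hspan_scale[OF c(2)])
    then show ?thesis using c(1) by simp
  qed
  obtain c where "qv p - sc ((-1) ^ fst p * of_real c) (qv (0, d - 2)) \<in> hspan d"
    using qv_mod[of "fst p" "snd p"] p by (auto simp: qwt_def)
  then have "(qv p - sc ((-1) ^ fst p * of_real c) (qv (0, d - 2))) + sc ((-1) ^ fst p * of_real c) (qv (0, d - 2)) \<in> hspan d"
    by (intro hspan_add hspan_scale 0)
  then show ?thesis by simp
qed

text \<open>Quasi-associativity of the Wick product: the correction terms have lower weight or involve
  shorter words.\<close>

lemma hword_mode:
  assumes "fst ` set xs \<subseteq> {..<2 * n}" "M \<in> W" "M \<in> ws m" "M \<in> hspan (nat m)" "int (wt xs) + m + int s = int d"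
  shows "np (hword xs) (- 1 - int s) M \<in> hspan d"
  using assms
proof (induction xs arbitrary: M m s)
  case Nil
  then show ?case by (cases "s = 0") (auto simp: vacuum_left hspan_0)
next
  case (Cons p xs)
  obtain i k where p: "p = (i, k)" by (cases p)
  have i: "i < 2 * n" "fst ` set xs \<subseteq> {..<2 * n}" using Cons.prems by (auto simp: p)
  obtain N where "np (np (letter p) (-1) (hword xs)) (- 1 - int s) M = (\<Sum>j<N. sc ((-1) ^ j * (of_int (-1) gchoose j))
            (np (letter p) (- 1 - int j) (np (hword xs) (- 1 - int s + int j) M)
              - sc ((if False \<and> False then -1 else 1) * (-1) powi (-1))
                  (np (hword xs) (- 1 - int s + - 1 - int j) (np (letter p) (int j) M))))"
    using iterate[OF letter_even[of p] hword_even[of xs]] by blast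
  also have "\<dots> \<in> hspan d"
  proof (intro hspan_sum hspan_scale hspan_diff)
    fix j :: nat
    let ?y = "np (hword xs) (- 1 - int s + int j) M"
    have y: "?y \<in> ws (int (wt xs) + m - (- 1 - int s + int j) - 1)"
      by (rule ws_np[OF hword_ws Cons.prems(3)])
    have letter: "int (wt xs) + m - (- 1 - int s + int j) - 1 = int d - int (qwt p) - int j"
      using Cons.prems by simp
    have "letter p \<in> homog V False" by (rule letter_even)
    have yS: "?y \<in> hspan (nat (int d - int (qwt p) - int j))"
      by (rule below[OF W_np[OF hword_W Cons.prems(2)] y[unfolded letter]]) (simp add: qwt_def)
    \<comment> \<open>The mode -1-j of a letter is a multiple of the Wick product with its j-th
      derivative, again a letter of the same generator.\<close>
    have "np (letter (i, j + k)) (-1) ?y \<in> hspan d"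
    proof (cases "int d - int (qwt p) - int j < 0")
      case True
      then have "?y = 0" using ws_neg[OF y[unfolded letter]] by simp
      then show ?thesis by (simp add: hspan_0)
    next
      case False
      show ?thesis by (rule hspan_letter[OF yS]) (use False i in \<open>auto simp: p qwt_def\<close>)
    qed
    then have "np (letter p) (- int j - 1) ?y \<in> hspan d"
      unfolding np_neg p letter_der_pow by (rule hspan_scale)
    moreover have "- int j - 1 = - 1 - int j" by simp
    ultimately show "np (letter p) (- 1 - int j) ?y \<in> hspan d" by (simp only:)
    let ?z = "np (letter p) (int j) M"
    have z: "?z \<in> ws (int (qwt p) + m - int j - 1)" by (rule ws_np[OF letter_ws Cons.prems(3)])
    have zW: "?z \<in> W" by (rule W_np[OF letter_W Cons.prems(2)])
    have zS: "?z \<in> hspan (nat (int (qwt p) + m - int j - 1))"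
      by (rule below[OF zW z]) (use Cons.prems in simp)
    \<comment> \<open>The weights of \<open>xs\<close> and z and the shift of the mode again add up
      to d, and the word is shorter; this is why s has to be arbitrary.\<close>
    have "np (hword xs) (- 1 - int (Suc (s + j))) ?z \<in> hspan d"
      by (rule Cons.IH[OF i(2) zW z zS]) (use Cons.prems in simp)
    moreover have "- 1 - int (Suc (s + j)) = - 1 - int s + - 1 - int j" by simp
    ultimately show "np (hword xs) (- 1 - int s + - 1 - int j) ?z \<in> hspan d" by (simp only:)
  qed
  finally show ?case by simp
qed

text \<open>By \<open>qop_mon\<close> the monomial is a Wick product of two factors of lower weight,
  treated by \<open>hword_mode\<close>, plus shorter monomials of the same weight.\<close>

lemma mon_hspan: "wt ps = d \<Longrightarrow> mon ps \<in> hspan d"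
proof (induction "length ps" arbitrary: ps rule: less_induct)
  case less
  show ?case
  proof (cases ps)
    case Nil
    then show ?thesis using hspan_hword[of "[]"] less.prems by simp
  next
    case (Cons p qs)
    show ?thesis
    proof (cases "qs = []")
      case True
      then show ?thesis using qv_hspan[of p] less.prems Cons by (simp add: qv_def)
    next
      case False
      then have qs: "wt qs > 0" by (cases qs) (auto simp: qwt_def)
      have d: "d = qwt p + wt qs" using less.prems Cons by simp
      have "qv p \<in> hspan (nat (int (qwt p)))" by (rule below[OF qv_W qv_ws]) (use d qs in simp)
      then have q: "qv p \<in> hspan (qwt p)" by (simp only: nat_int)
      have M: "mon qs \<in> hspan (nat (int (wt qs)))" by (rule below[OF mon_W mon_ws]) (use d in \<open>simp add: qwt_def\<close>)
      have "np (qv p) (-1) (mon qs) \<in> hspan d"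
        using q nprod_linear_left
      proof (rule hspan_lin)
        fix xs :: "(nat \<times> nat) list" assume xs: "fst ` set xs \<subseteq> {..<2 * n}" "wt xs = qwt p"
        show "np (hword xs) (-1) (mon qs) \<in> hspan d"
          using hword_mode[OF xs(1) mon_W mon_ws M, of 0] xs(2) d by simp
      qed
      then have "qA p (mon qs) \<in> hspan d" by (simp only: qA_def)
      moreover have "mon (qs[j := up1 p (qs ! j)]) \<in> hspan d" "mon (qs[j := up2 p (qs ! j)]) \<in> hspan d"
        if "j < length qs" for j
        by (rule less.hyps; use that Cons d in \<open>simp add: wt_up\<close>)+
      ultimately show ?thesis unfolding Cons mon_Cons qop_mon shifts_def
        by (intro hspan_add hspan_sum hspan_scale) auto
    qed
  qed
qed

end

lemma W_hspan: "v \<in> W \<Longrightarrow> v \<in> ws (int d) \<Longrightarrow> v \<in> hspan d"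
proof (induction d arbitrary: v rule: less_induct)
  case (less d)
  have below: "v \<in> hspan (nat x)" if "v \<in> W" "v \<in> ws x" "x < int d" for v x
  proof (cases "x < 0")
    case True
    then show ?thesis using ws_neg[OF that(2)] by (simp add: hspan_0)
  next
    case False
    then show ?thesis using less.IH[of "nat x" v] that by simp
  qed
  have "mon ` {ps. wt ps = d} \<subseteq> hspan d" using mon_hspan[OF below] by auto
  then have "span (mon ` {ps. wt ps = d}) \<subseteq> hspan d" by (rule span_minimal[OF _ subspace_hspan])
  then show ?case using first_fundamental_theorem[OF less.prems] by blast
qed

section \<open>Weight decomposition and the generating set\<close>

lemma ws_sum_zero:
  assumes "finite D" "\<And>d. d \<in> D \<Longrightarrow> u d \<in> ws (int d)" "(\<Sum>d\<in>D. u d) = 0" "d \<in> D"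
  shows "u d = 0"
proof (rule coef_ext)
  fix w assume w: "w \<in> words"
  show "coef w (u d) = coef w 0"
  proof (rule ccontr)
    assume "coef w (u d) \<noteq> coef w 0"
    then have nz: "coef w (u d) \<noteq> 0" by simp
    then have wd: "mode_wt w = d" using ws_coef[OF assms(2)[OF assms(4)] w] by simp
    have "0 = coef w (\<Sum>d\<in>D. u d)" using assms(3) by simp
    also have "\<dots> = (\<Sum>d'\<in>D. if d' = d then coef w (u d) else 0)"
      unfolding coef_sum
    proof (intro sum.cong refl)
      fix d' assume "d' \<in> D"
      then show "coef w (u d') = (if d' = d then coef w (u d) else 0)"
        using ws_coef[OF assms(2), of d' w] w wd by auto
    qed
    also have "\<dots> = coef w (u d)" using assms(1,4) by (simp add: sum.delta)
    finally show False using nz by simp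
  qed
qed

lemma ws_decompose: "\<exists>D u. finite D \<and> (\<forall>d\<in>D. u d \<in> ws (int d)) \<and> v = (\<Sum>d\<in>D. u d)"
proof -
  let ?S = "supp v"
  let ?u = "\<lambda>d. \<Sum>w\<in>{w \<in> ?S. mode_wt w = d}. sc (coef w v) (word w)"
  have fin: "finite ?S" using finite_support[of v] by simp
  have "v = (\<Sum>w\<in>?S. sc (coef w v) (word w))" by (rule expand)
  also have "\<dots> = (\<Sum>d\<in>mode_wt ` ?S. ?u d)" by (rule sum.image_gen[OF fin])
  finally have "v = (\<Sum>d\<in>mode_wt ` ?S. ?u d)" .
  moreover have "?u d \<in> ws (int d)" for d
  proof (intro subspace_sum[OF subspace_ws] subspace_scale[OF subspace_ws])
    fix w assume "w \<in> {w \<in> ?S. mode_wt w = d}"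
    then show "word w \<in> ws (int d)" using word_ws[OF wordsD, of w] by auto
  qed
  ultimately show ?thesis using fin by (intro exI[of _ "mode_wt ` ?S"] exI[of _ ?u]) blast
qed

text \<open>L is itself invariant, so group elements preserve its weight spaces and fix each weight
  component of an invariant.\<close>

lemma W_decompose: "v \<in> W \<Longrightarrow> \<exists>D u. finite D \<and> (\<forall>d\<in>D. u d \<in> W \<and> u d \<in> ws (int d)) \<and> v = (\<Sum>d\<in>D. u d)"
proof -
  assume v: "v \<in> W"
  obtain D u where u: "finite D" "\<forall>d\<in>D. u d \<in> ws (int d)" "v = (\<Sum>d\<in>D. u d)"
    using ws_decompose by blast
  have LcW: "Lc \<in> W" unfolding conformal_vector_eq using subspace_neg[OF subspace_W qv_W] .
  have "u d \<in> W" if d: "d \<in> D" for d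
    unfolding invariants_def
  proof (rule CollectI, rule ballI)
    fix \<phi> assume \<phi>: "\<phi> \<in> GL"
    note lin = GL_D(1)[OF \<phi>]
    have Lc: "\<phi> Lc = Lc" using LcW \<phi> by (simp add: invariants_def)
    have "\<phi> x \<in> ws y" if "x \<in> ws y" for x y
    proof -
      have "np Lc 1 (\<phi> x) = \<phi> (np Lc 1 x)" by (simp add: GL_D(3)[OF \<phi>] Lc)
      then show ?thesis using that by (simp add: ws_def lin_scale[OF lin])
    qed
    then have 1: "\<phi> (u d) - u d \<in> ws (int d)" if "d \<in> D" for d
      using u(2) that by (intro subspace_diff[OF subspace_ws]) auto
    have "\<phi> v = v" using v \<phi> by (simp add: invariants_def)
    then have "(\<Sum>d\<in>D. \<phi> (u d) - u d) = 0"
      unfolding u(3) by (simp add: lin_sum[OF lin] sum_subtractf)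
    from ws_sum_zero[OF u(1) 1 this d] show "\<phi> (u d) = u d" by simp
  qed
  then show ?thesis using u by blast
qed

lemma hword_eq_wick: "hword xs = wick V (map (\<lambda>(a, k). (der ^^ k) a) (map (\<lambda>p. (hh (fst p), snd p)) xs))"
  by (induction xs) (simp_all add: wick_def letter_def)

lemma W_wick: "set as \<subseteq> W \<Longrightarrow> wick V as \<in> W"
  by (induction as) (simp_all add: wick_def W_Om W_np)

lemma W_der_pow: "a \<in> W \<Longrightarrow> (der ^^ k) a \<in> W"
  by (induction k) (simp_all add: W_der)

lemma h_W: "hh k \<in> W"
  using letter_W[of "(k, 0)"] by (simp add: letter_def)

lemma strongly_generates_h:
  assumes n: "n \<ge> 1"
  shows "strongly_generates V W (hh ` {0..2 * n - 1})"
proof -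
  let ?G = "{wick V (map (\<lambda>(a, k). (der ^^ k) a) w) | w. fst ` set w \<subseteq> hh ` {0..2 * n - 1}}"
  have "?G \<subseteq> W"
  proof
    fix x assume "x \<in> ?G"
    then obtain w where w: "x = wick V (map (\<lambda>(a, k). (der ^^ k) a) w)" "fst ` set w \<subseteq> hh ` {0..2 * n - 1}" by blast
    have "set (map (\<lambda>(a, k). (der ^^ k) a) w) \<subseteq> W"
    proof
      fix y assume "y \<in> set (map (\<lambda>(a, k). (der ^^ k) a) w)"
      then obtain a k where "(a, k) \<in> set w" "y = (der ^^ k) a" by auto
      moreover from this have "a \<in> hh ` {0..2 * n - 1}" using w(2) by force
      ultimately show "y \<in> W" using W_der_pow h_W by auto
    qed
    then show "x \<in> W" unfolding w(1) by (rule W_wick)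
  qed
  then have 1: "span ?G \<subseteq> W" by (rule span_minimal[OF _ subspace_W])
  have hspan: "hspan d \<subseteq> span ?G" for d
    unfolding hspan_def
  proof (intro span_mono image_subsetI)
    fix xs :: "(nat \<times> nat) list" assume "xs \<in> {xs. fst ` set xs \<subseteq> {..<2 * n} \<and> wt xs = d}"
    then have "fst ` set (map (\<lambda>p. (hh (fst p), snd p)) xs) \<subseteq> hh ` {0..2 * n - 1}"
      using n by fastforce
    then show "hword xs \<in> ?G" unfolding hword_eq_wick by blast
  qed
  have 2: "W \<subseteq> span ?G"
  proof
    fix v assume "v \<in> W"
    then obtain D u where u: "finite D" "\<forall>d\<in>D. u d \<in> W \<and> u d \<in> ws (int d)" "v = (\<Sum>d\<in>D. u d)"
      using W_decompose by blast
    show "v \<in> span ?G" unfolding u(3)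
      by (intro span_sum) (use u(2) W_hspan hspan in blast)
  qed
  have "hh ` {0..2 * n - 1} \<subseteq> W" using h_W by auto
  then show ?thesis unfolding strongly_generates_def using 1 2 by blast
qed

end

section \<open>Minimality\<close>

context symplectic_fermion_algebra
begin

abbreviation vac_coef :: "'v \<Rightarrow> complex" where "vac_coef \<equiv> coef []"

lemma Nil_words: "[] \<in> words"
  by (simp add: sorted_words_def)

lemma vac_coef_Om: "vac_coef Om = 1"
  using coef_word[OF Nil_words Nil_words] by simp

lemma vac_coef_cr: "p \<in> idx \<Longrightarrow> vac_coef (cr p v) = 0"
proof (induction v rule: word_induct)
  case (word w)
  show ?case
  proof (cases "p \<in> set w")
    case True
    then show ?thesis
      using anticommuting_word_mem[OF anticommuting_cr wordsD[OF word(1)], of p Om] by simp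
  next
    case False
    obtain w' s where "w' \<in> words" "set w' = insert p (set w)" "cr p (word w) = sc s (word w')"
      using insert_word_cr[OF word(1,2) False] by blast
    then show ?thesis using Nil_words by (auto simp: coef_scale coef_word)
  qed
qed (simp_all add: cr_add cr_scale coef_add coef_scale)

section \<open>Contractions as coordinates of monomials\<close>

definition an_pair :: "nat \<times> nat \<times> nat \<Rightarrow> 'v \<Rightarrow> 'v" where
  "an_pair x v = an (n + fst x, snd (snd x)) (an (fst x, fst (snd x)) v)"

text \<open>A triple (i, k, l) asks that colour i carry the letter q_{k,l}. With distinct colours
  this tests for a monomial, one colour per letter, hence for at most n letters.\<close>

definition contract :: "(nat \<times> nat \<times> nat) list \<Rightarrow> 'v \<Rightarrow> complex" where
  "contract L v = vac_coef (foldr an_pair L v)"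

lemma lin_an_pair: "lin (an_pair x)"
  by (intro linI) (simp_all add: an_pair_def an_add an_scale)

lemma lin_foldr_an_pair: "lin (foldr an_pair L)"
proof (induction L)
  case Nil
  then show ?case by (intro linI) simp_all
next
  case (Cons x L)
  then show ?case
    by (intro linI) (simp_all add: lin_add[OF Cons] lin_scale[OF Cons] lin_add[OF lin_an_pair] lin_scale[OF lin_an_pair])
qed

lemma contract_add: "contract L (u + v) = contract L u + contract L v"
  and contract_scale: "contract L (sc c v) = c * contract L v"
  by (simp_all add: contract_def lin_add[OF lin_foldr_an_pair] lin_scale[OF lin_foldr_an_pair] coef_add coef_scale)

lemma contract_zero [simp]: "contract L 0 = 0"
  using contract_scale[of L 0 0] by simp

lemma contract_sum: "contract L (sum g A) = (\<Sum>i\<in>A. contract L (g i))"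
  by (induction A rule: infinite_finite_induct) (simp_all add: contract_add)

lemma contract_append: "contract (L @ L') v = contract L (foldr an_pair L' v)"
  by (simp add: contract_def)

lemma an_pair_cr:
  assumes "fst x < n" "p \<in> idx" "fst p \<noteq> fst x" "fst p \<noteq> n + fst x"
  shows "an_pair x (cr p v) = cr p (an_pair x v)"
proof -
  obtain i k l where x: "x = (i, k, l)" by (cases x) auto
  have 1: "an (i, k) (cr p v) = - cr p (an (i, k) v)"
    using an_cr[of "(i, k)" p v] assms by (auto simp: x)
  have 2: "an (n + i, l) (cr p y) = - cr p (an (n + i, l) y)" for y
    using an_cr[of "(n + i, l)" p y] assms by (auto simp: x)
  show ?thesis by (simp add: an_pair_def x 1 2 an_minus)
qed

lemma foldr_an_pair_cr:
  assumes "fst ` set L \<subseteq> {..<n}" "i < n" "i \<notin> fst ` set L" "p \<in> idx" "fst p = i \<or> fst p = n + i"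
  shows "foldr an_pair L (cr p v) = cr p (foldr an_pair L v)"
  using assms(1,3)
proof (induction L)
  case (Cons x L)
  then have "an_pair x (cr p (foldr an_pair L v)) = cr p (an_pair x (foldr an_pair L v))"
    using assms(2,4,5) by (intro an_pair_cr) auto
  then show ?case using Cons by simp
qed simp

lemma contract_cr:
  assumes "fst ` set L \<subseteq> {..<n}" "i < n" "i \<notin> fst ` set L" "p \<in> idx" "fst p = i \<or> fst p = n + i"
  shows "contract L (cr p v) = 0"
  unfolding contract_def foldr_an_pair_cr[OF assms] by (rule vac_coef_cr[OF assms(4)])

lemma contract_diff: "contract L (u - v) = contract L u - contract L v"
  by (simp add: contract_def lin_diff[OF lin_foldr_an_pair] coef_diff)

lemma contract_minus: "contract L (- v) = - contract L v"
  using contract_scale[of L "-1" v] by simp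

text \<open>All pairs other than the one of colour i commute with its creators, and the surplus
  terms have a creator in front, which the vacuum coefficient kills.\<close>

lemma contract_contract:
  assumes L: "fst ` set L1 \<subseteq> {..<n}" "fst ` set L2 \<subseteq> {..<n}" "i < n" "i \<notin> fst ` set L1" "i \<notin> fst ` set L2"
  shows "contract (L1 @ (i, q) # L2) (cr (i, fst p) (cr (n + i, snd p) v)) = (if p = q then contract (L1 @ L2) v else 0)"
proof -
  obtain k l k' l' where pq: "p = (k, l)" "q = (k', l')" by (cases p; cases q)
  define u where "u = foldr an_pair L2 v"
  have i: "(i, k) \<in> idx" "(n + i, k) \<in> idx" for k using L(3) by auto
  have 1: "an (i, k') (cr (i, k) y) = (if k' = k then y else 0) - cr (i, k) (an (i, k') y)" for y
    using an_cr[OF i(1) i(1), of k' k y] by simp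
  have 2: "an (n + i, l') (cr (n + i, l) y) = (if l' = l then y else 0) - cr (n + i, l) (an (n + i, l') y)" for y
    using an_cr[OF i(2) i(2), of l' l y] by simp
  have 3: "an (n + i, l') (cr (i, k) y) = - cr (i, k) (an (n + i, l') y)" for y
    using an_cr[OF i(2) i(1), of l' k y] L(3) by simp
  define C where "C = an (n + i, l') (an (i, k') (cr (n + i, l) u))"
  have "foldr an_pair L2 (cr (i, k) (cr (n + i, l) v)) = cr (i, k) (cr (n + i, l) u)"
    using foldr_an_pair_cr[OF L(2,3,5)] i by (simp add: u_def)
  then have "contract (L1 @ (i, q) # L2) (cr (i, fst p) (cr (n + i, snd p) v))
      = contract L1 (an (n + i, l') (an (i, k') (cr (i, k) (cr (n + i, l) u))))"
    by (simp add: pq contract_append an_pair_def)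
  also have "an (n + i, l') (an (i, k') (cr (i, k) (cr (n + i, l) u)))
      = (if k' = k then an (n + i, l') (cr (n + i, l) u) else 0) + cr (i, k) C"
    unfolding 1 C_def by (simp add: lin_diff[OF lin_an] 3)
  also have "contract L1 \<dots> = (if k' = k then contract L1 (an (n + i, l') (cr (n + i, l) u)) else 0)"
    using contract_cr[OF L(1,3,4), of "(i, k)"] i by (simp add: contract_add)
  also have "\<dots> = (if k' = k \<and> l' = l then contract L1 u else 0)"
    unfolding 2 using contract_cr[OF L(1,3,4), of "(n + i, l)"] i by (simp add: contract_diff contract_minus)
  finally show ?thesis by (auto simp: pq u_def contract_append)
qed

lemma contract_qop_notin:
  assumes "fst ` set L \<subseteq> {..<n}" "i < n" "i \<notin> fst ` set L"
  shows "contract L (cr (i, k) (cr (n + i, l) v)) = 0"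
  by (rule contract_cr[OF assms]) (use assms in auto)

text \<open>The value counts the assignments of the letters of \<open>ps\<close> to the colours of L
  that respect the labels. Pairs are even, so no signs enter and nothing cancels.\<close>

lemma contract_mon:
  assumes "distinct (map fst L)" "fst ` set L \<subseteq> {..<n}"
  shows "\<exists>N :: nat. contract L (mon ps) = of_nat N \<and> (N > 0 \<longleftrightarrow> mset (map snd L) = mset ps)"
  using assms
proof (induction ps arbitrary: L)
  case Nil
  show ?case
  proof (cases L rule: rev_cases)
    case Nil
    then show ?thesis by (intro exI[of _ 1]) (simp add: contract_def vac_coef_Om)
  next
    case (snoc L' x)
    then have "an_pair x Om = 0" using Nil by (simp add: an_pair_def an_vac)
    then have "contract L Om = 0" by (simp add: snoc contract_append)
    then show ?thesis by (intro exI[of _ 0]) (simp add: snoc)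
  qed
next
  case (Cons p ps)
  have "\<exists>N :: nat. contract L (cr (i, fst p) (cr (n + i, snd p) (mon ps))) = of_nat N \<and>
      (N > 0 \<longleftrightarrow> (\<exists>L1 L2. L = L1 @ (i, p) # L2 \<and> mset (map snd (L1 @ L2)) = mset ps))" if i: "i < n" for i
  proof (cases "i \<in> fst ` set L")
    case False
    then have "contract L (cr (i, fst p) (cr (n + i, snd p) (mon ps))) = 0"
      using contract_qop_notin[OF Cons.prems(2) i] by blast
    then show ?thesis using False by (intro exI[of _ 0]) force
  next
    case True
    then obtain q where "(i, q) \<in> set L" by force
    then obtain L1 L2 where L: "L = L1 @ (i, q) # L2" using split_list by metis
    have LL: "fst ` set L1 \<subseteq> {..<n}" "fst ` set L2 \<subseteq> {..<n}" "i \<notin> fst ` set L1" "i \<notin> fst ` set L2"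
      "distinct (map fst (L1 @ L2))" "fst ` set (L1 @ L2) \<subseteq> {..<n}"
      using Cons.prems by (auto simp: L)
    have c: "contract L (cr (i, fst p) (cr (n + i, snd p) (mon ps))) = (if p = q then contract (L1 @ L2) (mon ps) else 0)"
      unfolding L by (rule contract_contract[OF LL(1,2) i LL(3,4)])
    have tw: "takeWhile (\<lambda>x. fst x \<noteq> i) (A @ (i, r) # B) = A \<and>
        dropWhile (\<lambda>x. fst x \<noteq> i) (A @ (i, r) # B) = (i, r) # B" if "i \<notin> fst ` set A" for A r B
      using that by (induction A) auto
    \<comment> \<open>Colours are distinct, so colour i has only one position in L.\<close>
    have uniq: "q' = q \<and> L1' = L1 \<and> L2' = L2" if L': "L = L1' @ (i, q') # L2'" for q' L1' L2'
    proof -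
      have "i \<notin> fst ` set L1'" using Cons.prems(1) unfolding L' by auto
      then show ?thesis using tw[of L1' q' L2'] tw[OF LL(3), of q L2] unfolding L'[symmetric] L[symmetric] by simp
    qed
    show ?thesis
    proof (cases "p = q")
      case True
      obtain N :: nat where N: "contract (L1 @ L2) (mon ps) = of_nat N" "N > 0 \<longleftrightarrow> mset (map snd (L1 @ L2)) = mset ps"
        using Cons.IH[OF LL(5,6)] by blast
      show ?thesis
      proof (intro exI[of _ N] conjI)
        show "contract L (cr (i, fst p) (cr (n + i, snd p) (mon ps))) = of_nat N" using c N True by simp
        show "N > 0 \<longleftrightarrow> (\<exists>L1 L2. L = L1 @ (i, p) # L2 \<and> mset (map snd (L1 @ L2)) = mset ps)"
          unfolding N(2) using uniq L True by blast
      qed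
    next
      case False
      then have "\<not> (\<exists>L1 L2. L = L1 @ (i, p) # L2 \<and> mset (map snd (L1 @ L2)) = mset ps)"
        using uniq by blast
      then show ?thesis using c False by (intro exI[of _ 0]) simp
    qed
  qed
  then obtain N :: "nat \<Rightarrow> nat" where N: "\<And>i. i < n \<Longrightarrow> contract L (cr (i, fst p) (cr (n + i, snd p) (mon ps))) = of_nat (N i)"
    "\<And>i. i < n \<Longrightarrow> N i > 0 \<longleftrightarrow> (\<exists>L1 L2. L = L1 @ (i, p) # L2 \<and> mset (map snd (L1 @ L2)) = mset ps)"
    by metis
  show ?case
  proof (intro exI[of _ "\<Sum>i<n. N i"] conjI)
    show "contract L (mon (p # ps)) = of_nat (\<Sum>i<n. N i)"
      by (simp add: qop_def contract_sum N(1))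
    have z: "(\<Sum>i<n. N i) = 0 \<longleftrightarrow> (\<forall>i\<in>{..<n}. N i = 0)" by (rule sum_eq_0_iff) simp
    have "(\<Sum>i<n. N i) > 0 \<longleftrightarrow> (\<exists>i<n. N i > 0)" by (simp only: neq0_conv[symmetric] z) auto
    also have "\<dots> \<longleftrightarrow> mset (map snd L) = mset (p # ps)"
    proof
      assume "\<exists>i<n. N i > 0"
      then obtain i L1 L2 where "L = L1 @ (i, p) # L2" "mset (map snd (L1 @ L2)) = mset ps" using N(2) by blast
      then show "mset (map snd L) = mset (p # ps)" by simp
    next
      assume m: "mset (map snd L) = mset (p # ps)"
      have "set (map snd L) = set (p # ps)" using m by (rule mset_eq_setD)
      then have "p \<in> snd ` set L" by simp
      then obtain i where "(i, p) \<in> set L" by force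
      then obtain L1 L2 where L: "L = L1 @ (i, p) # L2" using split_list by metis
      moreover have "i < n" using Cons.prems(2) by (auto simp: L)
      moreover have "mset (map snd (L1 @ L2)) = mset ps" using m by (simp add: L)
      ultimately show "\<exists>i<n. N i > 0" using N(2) by blast
    qed
    finally show "(\<Sum>i<n. N i) > 0 \<longleftrightarrow> mset (map snd L) = mset (p # ps)" .
  qed
qed

lemma contract_mon_0:
  assumes "distinct (map fst L)" "fst ` set L \<subseteq> {..<n}" "mset (map snd L) \<noteq> mset ps"
  shows "contract L (mon ps) = 0"
  using contract_mon[OF assms(1,2), of ps] assms(3) by auto

lemma contract_span_0:
  assumes "distinct (map fst L)" "fst ` set L \<subseteq> {..<n}" "v \<in> span (mon ` {ps. length ps < length L})"
  shows "contract L v = 0"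
  using assms(3)
proof (induction rule: span_induct_alt)
  case (step c x y)
  then obtain ps where ps: "x = mon ps" "length ps < length L" by auto
  have "mset (map snd L) \<noteq> mset ps"
  proof
    assume "mset (map snd L) = mset ps"
    then have "length (map snd L) = length ps" by (rule mset_eq_length)
    then show False using ps(2) by simp
  qed
  then show ?case using step contract_mon_0[OF assms(1,2)] ps by (simp add: contract_add contract_scale)
qed simp

text \<open>The coefficients c_{k,l} solve (k+1) c_{k+1,l} + (l+1) c_{k,l+1} = 0, the condition for
  vanishing on \<open>der_qv\<close>. The single colour 0 suffices to read off a linear
  term.\<close>

definition linpart :: "nat \<Rightarrow> 'v \<Rightarrow> complex" where
  "linpart K v = (\<Sum>k\<le>K. (-1) ^ k / (fact k * fact (K - k)) * contract [(0, k, K - k)] v)"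

lemma linpart_add: "linpart K (u + v) = linpart K u + linpart K v"
  and linpart_scale: "linpart K (sc c v) = c * linpart K v"
  by (simp_all add: linpart_def contract_add contract_scale algebra_simps sum.distrib sum_distrib_left)

lemma linpart_zero [simp]: "linpart K 0 = 0"
  by (simp add: linpart_def)

lemma linpart_minus: "linpart K (- v) = - linpart K v"
  using linpart_scale[of K "-1" v] by simp

lemma linpart_diff: "linpart K (u - v) = linpart K u - linpart K v"
  using linpart_add[of K u "- v"] by (simp add: linpart_minus)

lemma linpart_qv:
  assumes n: "n \<ge> 1" and K: "k + l = K"
  shows "linpart K (qv (k, l)) = (-1) ^ k / (fact k * fact l)"
proof -
  have "contract [(0, q)] (qv p) = (if p = q then 1 else 0)" for p q
  proof -
    have "contract [(0, q)] (qv p) = (\<Sum>i<n. contract [(0, q)] (cr (i, fst p) (cr (n + i, snd p) Om)))"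
      by (simp add: qv_def qop_def contract_sum)
    also have "\<dots> = (\<Sum>i<n. if i = 0 then if p = q then 1 else 0 else 0)"
    proof (intro sum.cong refl)
      fix i assume i: "i \<in> {..<n}"
      show "contract [(0, q)] (cr (i, fst p) (cr (n + i, snd p) Om)) = (if i = 0 then if p = q then 1 else 0 else 0)"
      proof (cases "i = 0")
        case True
        then show ?thesis using contract_contract[of "[]" "[]" 0 q p Om] n by (simp add: contract_def vac_coef_Om)
      next
        case False
        then show ?thesis using contract_qop_notin[of "[(0, q)]" i] i n by simp
      qed
    qed
    also have "\<dots> = (if p = q then 1 else 0)" using n by (simp add: sum.delta)
    finally show ?thesis .
  qed
  then have "linpart K (qv (k, l)) = (\<Sum>j\<le>K. if j = k then (-1) ^ k / (fact k * fact l) else 0)"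
    unfolding linpart_def by (intro sum.cong refl) (use K in auto)
  then show ?thesis using K by (simp add: sum.delta)
qed

text \<open>In this normalisation the coefficient is symmetric in l and u, which makes the bracket
  terms cancel below.\<close>

lemma shift_coeff_fact: "of_nat (shift_coeff l k u) / fact (u + k + l + 2)
   = (1 / (fact l * fact k * fact u * of_nat (u + l + 2)) :: complex)"
proof -
  have 1: "(of_nat ((u + Suc l) choose Suc l) :: complex) = fact (u + Suc l) / (fact (Suc l) * fact u)"
    by (subst binomial_fact) auto
  have 2: "(of_nat ((u + l + 2 + k) choose k) :: complex) = fact (u + l + 2 + k) / (fact k * fact (u + l + 2))"
    by (subst binomial_fact) auto
  have 3: "(fact (Suc l) :: complex) = of_nat (Suc l) * fact l" by (rule fact_Suc)
  have 4: "(fact (u + l + 2) :: complex) = of_nat (u + l + 2) * fact (u + Suc l)"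
    using fact_Suc[of "u + Suc l", where ?'a = complex] by simp
  have 5: "u + k + l + 2 = u + l + 2 + k" by simp
  have nz: "(of_nat (Suc l) :: complex) \<noteq> 0" "(of_nat (u + l + 2) :: complex) \<noteq> 0"
    by (simp_all only: of_nat_eq_0_iff)
  show ?thesis
    unfolding shift_coeff_def of_nat_mult 1 2 3 4 5 using nz
    by (simp add: divide_simps del: of_nat_Suc of_nat_add)
qed

text \<open>The commutator of the two Wick multiplications, evaluated on the vacuum by means of
  \<open>qop_qA'\<close>.\<close>

definition qbracket :: "nat \<times> nat \<Rightarrow> nat \<times> nat \<Rightarrow> 'v" where
  "qbracket p q = sc (co1 q p) (qv (up1 q p)) + sc (co2 q p) (qv (up2 q p))
     - sc (co1 p q) (qv (up1 p q)) - sc (co2 p q) (qv (up2 p q))"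

text \<open>By the symmetry in \<open>shift_coeff_fact\<close> the first shift of q by p cancels the
  second shift of p by q, and vice versa.\<close>

lemma linpart_qbracket:
  assumes n: "n \<ge> 1"
  shows "linpart (qwt p + qwt q - 2) (qbracket p q) = 0"
proof -
  obtain k l u w where pq: "p = (k, l)" "q = (u, w)" by (cases p; cases q)
  let ?K = "qwt p + qwt q - 2"
  let ?G = "\<lambda>x. (-1) ^ (u + k) / (fact k * fact l * fact u * fact w * of_nat x) :: complex"
  have s: "(-1) ^ (a + a) = (1 :: complex)" for a :: nat by simp
  have shift_coeff: "of_nat (shift_coeff l k u) = fact (u + k + l + 2) / (fact l * fact k * fact u * of_nat (u + l + 2) :: complex)" for l k u
  proof -
    have "(of_nat (shift_coeff l k u) :: complex) = of_nat (shift_coeff l k u) / fact (u + k + l + 2) * fact (u + k + l + 2)"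
      by (simp only: times_divide_eq_left nonzero_mult_div_cancel_right[OF fact_nonzero])
    then show ?thesis unfolding shift_coeff_fact by (simp only: times_divide_eq_left mult_1_left)
  qed
  have g1: "a * (F / (x * y * z * t)) * (b / (F * v)) = a * b / (y * x * z * v * t)"
    and g2: "a * (F / (x * y * z * t)) * (b / (v * F)) = b * a / (x * y * v * z * t)"
    if "F \<noteq> 0" for a b F v x y z t :: complex
    using that by (simp_all add: divide_simps)
  have up1: "co1 (k, l) (u, w) * linpart ?K (qv (up1 (k, l) (u, w)))
      = (-1) ^ (u + k) / (fact k * fact l * fact u * fact w * of_nat (u + l + 2))"
    "co2 (k, l) (u, w) * linpart ?K (qv (up2 (k, l) (u, w)))
      = (-1) ^ (u + k) / (fact k * fact l * fact u * fact w * of_nat (w + k + 2))"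
    if "k + l + u + w + 2 = ?K" for k l u w
  proof -
    have e: "up1 (k, l) (u, w) = (u + k + l + 2, w)" "up2 (k, l) (u, w) = (u, w + k + l + 2)"
      by (simp_all add: up1_def up2_def qwt_def)
    have l1: "linpart ?K (qv (u + k + l + 2, w)) = (-1) ^ (u + k + l + 2) / (fact (u + k + l + 2) * fact w)"
      by (rule linpart_qv[OF n]) (use that in simp)
    have l2: "linpart ?K (qv (u, w + k + l + 2)) = (-1) ^ u / (fact u * fact (w + k + l + 2))"
      by (rule linpart_qv[OF n]) (use that in simp)
    have p1: "(-1) ^ l * (-1) ^ (u + k + l + 2) = ((-1) ^ (u + k) :: complex)"
      by (simp add: power_add mult_ac)
    have c: "w + l + k + 2 = w + k + l + 2" by simp
    show "co1 (k, l) (u, w) * linpart ?K (qv (up1 (k, l) (u, w)))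
        = (-1) ^ (u + k) / (fact k * fact l * fact u * fact w * of_nat (u + l + 2))"
      unfolding e l1 co1_def fst_conv snd_conv shift_coeff p1[symmetric] by (rule g1[OF fact_nonzero])
    show "co2 (k, l) (u, w) * linpart ?K (qv (up2 (k, l) (u, w)))
        = (-1) ^ (u + k) / (fact k * fact l * fact u * fact w * of_nat (w + k + 2))"
      unfolding e l2 co2_def fst_conv snd_conv shift_coeff c power_add by (rule g2[OF fact_nonzero])
  qed
  have K: "k + l + u + w + 2 = ?K" "u + w + k + l + 2 = ?K" by (simp_all add: pq qwt_def)
  have "?G (w + k + 2) = (-1) ^ (k + u) / (fact u * fact w * fact k * fact l * of_nat (k + w + 2))"
    "?G (u + l + 2) = (-1) ^ (k + u) / (fact u * fact w * fact k * fact l * of_nat (l + u + 2))"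
    by (simp_all add: mult_ac add_ac)
  then show ?thesis
    unfolding qbracket_def linpart_diff linpart_add linpart_scale unfolding pq
    using up1[OF K(1)] up1[OF K(2)] by (simp add: pq)
qed

lemma qbracket_span: "qbracket p q \<in> span (qv ` {r. qwt r = qwt p + qwt q})"
  unfolding qbracket_def
  by (intro span_diff span_add span_scale span_base imageI) (auto simp: up1_def up2_def qwt_def)

text \<open>The commutator is a combination of modes (a_(j) b)_(-2-j), each of which is the mode -1
  of its own value on the vacuum.\<close>

lemma qA_commutator: "qA p (qA q v) - qA q (qA p v) = np (qbracket p q) (-1) v"
proof -
  let ?x = "\<lambda>j. np (qv p) (int j) (qv q)"
  obtain N where N: "\<forall>k\<ge>N. np (qv p) k (qv q) = 0" using truncation by blast
  have c: "qA p (qA q v) - qA q (qA p v)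
     = (\<Sum>j<nat N. sc (of_int (-1) gchoose j) (np (?x j) (-1 + -1 - int j) v))" for v
  proof -
    have "Sum_any (\<lambda>j. sc (of_int (-1) gchoose j) (np (?x j) (-1 + -1 - int j) v))
      = (\<Sum>j<nat N. sc (of_int (-1) gchoose j) (np (?x j) (-1 + -1 - int j) v))"
      by (rule Sum_any_eventually) (use N in auto)
    then show ?thesis
      unfolding qA_def using commutator[OF qv_even qv_even, of p "-1" q "-1" v] by simp
  qed
  have m: "np (np x (- 2 - int j) Om) (-1) v = np x (- 2 - int j) v" for x j v
  proof -
    have e: "- 2 - int j = - int (Suc j) - 1" by simp
    have "sc (fact (Suc j)) (np (np x (- int (Suc j) - 1) Om) (-1) v)
        = sc (fact (Suc j)) (np x (- int (Suc j) - 1) v)"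
      using deriv_pow_mode[of "Suc j" x v] unfolding deriv_pow by (simp only: lin_scale[OF nprod_linear_left])
    then show ?thesis unfolding e by (rule scale_left_imp_eq[OF fact_nonzero])
  qed
  have "qbracket p q = qA p (qA q Om) - qA q (qA p Om)"
    using qop_qA'[of q p Om] qop_qA'[of p q Om] qop_commute[of p q Om]
    by (simp add: qbracket_def qA_Om algebra_simps flip: qv_def)
  then show ?thesis unfolding c by (simp add: m del: of_int_minus of_int_1)
qed

section \<open>Reordering Wick words\<close>

definition qword :: "(nat \<times> nat) list \<Rightarrow> 'v" where "qword ps = foldr qA ps Om"

lemma qword_Nil [simp]: "qword [] = Om" and qword_Cons [simp]: "qword (p # ps) = qA p (qword ps)"
  by (simp_all add: qword_def)

lemma qA_mon_span:
  assumes "v \<in> span (mon ` {ps. length ps < m})"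
  shows "qA p v \<in> span (mon ` {ps. length ps < Suc m})"
  using assms lin_qA subspace_span
proof (rule lin_span)
  fix s assume "s \<in> mon ` {ps. length ps < m}"
  then obtain ps where ps: "s = mon ps" "length ps < m" by auto
  have "qA p (mon ps) = mon (p # ps) - (\<Sum>j<length ps. shifts p ps j)"
    by (simp add: qop_mon)
  also have "\<dots> \<in> span (mon ` {ps. length ps < Suc m})"
    unfolding shifts_def
    by (intro span_diff span_sum span_add span_scale span_base imageI) (use ps in auto)
  finally show "qA p s \<in> span (mon ` {ps. length ps < Suc m})" by (simp add: ps)
qed

lemma qword_mon: "qword ps - mon ps \<in> span (mon ` {qs. length qs < length ps})"
proof (induction ps)
  case Nil
  then show ?case by (simp add: span_zero)
next
  case (Cons p ps)
  have "qword (p # ps) - mon (p # ps) = qA p (qword ps - mon ps) - (\<Sum>j<length ps. shifts p ps j)"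
    by (simp add: qop_mon lin_diff[OF lin_qA])
  also have "\<dots> \<in> span (mon ` {qs. length qs < Suc (length ps)})"
    unfolding shifts_def
    by (intro span_diff qA_mon_span Cons span_sum span_add span_scale span_base imageI) auto
  finally show ?case by simp
qed

lemma qword_span: "qword ps \<in> span (mon ` {qs. length qs < Suc (length ps)})"
proof -
  have "(qword ps - mon ps) + mon ps \<in> span (mon ` {qs. length qs < Suc (length ps)})"
  proof (rule span_add)
    show "qword ps - mon ps \<in> span (mon ` {qs. length qs < Suc (length ps)})"
      by (rule subsetD[OF span_mono qword_mon]) auto
    show "mon ps \<in> span (mon ` {qs. length qs < Suc (length ps)})" by (intro span_base imageI) simp
  qed
  then show ?thesis by simp
qed

definition qspan :: "nat \<Rightarrow> 'v set" where "qspan d = span (qv ` {p. qwt p = d})"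

text \<open>The error space for reordering words of length m: shorter words, but in length one only
  vectors with vanishing linear part. At m = 2 only the latter remain.\<close>

definition short_span :: "nat \<Rightarrow> nat \<Rightarrow> 'v set" where
  "short_span m d = span (qword ` {ps. 2 \<le> length ps \<and> length ps < m \<and> wt ps = d} \<union> {y \<in> qspan d. linpart (d - 2) y = 0})"

lemma subspace_short_span: "subspace (short_span m d)"
  by (simp add: short_span_def)

lemma short_span_qword: "2 \<le> length ps \<Longrightarrow> length ps < m \<Longrightarrow> wt ps = d \<Longrightarrow> qword ps \<in> short_span m d"
  unfolding short_span_def by (intro span_base UnI1 imageI) simp

lemma short_span_linpart_0: "y \<in> qspan d \<Longrightarrow> linpart (d - 2) y = 0 \<Longrightarrow> y \<in> short_span m d"
  unfolding short_span_def by (intro span_base UnI2) simp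

lemma qA_qspan:
  assumes "y \<in> qspan d" "m \<ge> 2"
  shows "qA p y \<in> short_span (Suc m) (qwt p + d)"
  using assms(1)[unfolded qspan_def] lin_qA subspace_short_span
proof (rule lin_span)
  fix s assume "s \<in> qv ` {p. qwt p = d}"
  then obtain q where q: "s = qv q" "qwt q = d" by auto
  have "qword [p, q] \<in> short_span (Suc m) (qwt p + d)" by (rule short_span_qword) (use q assms(2) in auto)
  then show "qA p s \<in> short_span (Suc m) (qwt p + d)" by (simp add: q(1) qA_Om)
qed

lemma qA_short_span:
  assumes "y \<in> short_span m d" "m \<ge> 2"
  shows "qA p y \<in> short_span (Suc m) (qwt p + d)"
  using assms(1)[unfolded short_span_def] lin_qA subspace_short_span
proof (rule lin_span)
  fix s assume "s \<in> qword ` {ps. 2 \<le> length ps \<and> length ps < m \<and> wt ps = d} \<union> {y \<in> qspan d. linpart (d - 2) y = 0}"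
  then show "qA p s \<in> short_span (Suc m) (qwt p + d)"
  proof
    assume "s \<in> qword ` {ps. 2 \<le> length ps \<and> length ps < m \<and> wt ps = d}"
    then obtain ps where ps: "s = qword ps" "2 \<le> length ps" "length ps < m" "wt ps = d" by auto
    have "qword (p # ps) \<in> short_span (Suc m) (qwt p + d)" by (rule short_span_qword) (use ps in auto)
    then show ?thesis by (simp add: ps)
  qed (use qA_qspan assms(2) in simp)
qed

text \<open>The difference is the Wick product of \<open>qbracket p q\<close> with the word
  \<open>rs\<close>: words of length at least 2 if \<open>rs\<close> is nonempty, otherwise a linear
  vector to which \<open>linpart_qbracket\<close> applies.\<close>

lemma qword_swap:
  assumes n: "n \<ge> 1"
  shows "qword (p # q # rs) - qword (q # p # rs) \<in> short_span (Suc (Suc (length rs))) (qwt p + (qwt q + wt rs))"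
proof -
  have e: "qword (p # q # rs) - qword (q # p # rs) = np (qbracket p q) (-1) (qword rs)"
    by (simp add: qA_commutator)
  show ?thesis
  proof (cases "rs = []")
    case True
    have "qbracket p q \<in> short_span 2 (qwt p + qwt q)"
      by (rule short_span_linpart_0) (use qbracket_span linpart_qbracket[OF n] in \<open>simp_all add: qspan_def\<close>)
    then show ?thesis unfolding e unfolding True by (simp add: vacuum_right numeral_2_eq_2)
  next
    case False
    have "np x (-1) (qword rs) \<in> short_span (Suc (Suc (length rs))) (qwt p + (qwt q + wt rs))"
      if "x \<in> span (qv ` {r. qwt r = qwt p + qwt q})" for x
      using that nprod_linear_left subspace_short_span
    proof (rule lin_span)
      fix s assume "s \<in> qv ` {r. qwt r = qwt p + qwt q}"
      then obtain r where r: "s = qv r" "qwt r = qwt p + qwt q" by auto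
      have "qword (r # rs) \<in> short_span (Suc (Suc (length rs))) (qwt p + (qwt q + wt rs))"
        by (rule short_span_qword) (use r False in \<open>auto simp: Suc_le_eq\<close>)
      then show "np s (-1) (qword rs) \<in> short_span (Suc (Suc (length rs))) (qwt p + (qwt q + wt rs))"
        by (simp add: r qA_def)
    qed
    then show ?thesis unfolding e using qbracket_span by blast
  qed
qed

lemma wt_mset: "mset ps = mset qs \<Longrightarrow> wt ps = wt qs"
  unfolding wt_def by (metis mset_map sum_mset_sum_list)

lemma qword_reorder:
  assumes n: "n \<ge> 1"
  shows "mset ps = mset qs \<Longrightarrow> qword ps - qword qs \<in> short_span (length ps) (wt ps)"
proof (induction "length ps" arbitrary: ps qs)
  case 0
  then show ?case by (simp add: short_span_def span_zero)
next
  case (Suc m)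
  have same: "qword (p # xs) - qword (p # ys) \<in> short_span (Suc m) (qwt p + wt xs)"
    if "mset xs = mset ys" "length xs = m" for p xs ys
  proof (cases "m \<ge> 2")
    case True
    have "qword xs - qword ys \<in> short_span m (wt xs)" using Suc.hyps(1)[of xs ys] that by simp
    then show ?thesis using qA_short_span[OF _ True, of "qword xs - qword ys" "wt xs" p] by (simp add: lin_diff[OF lin_qA])
  next
    case False
    have "length ys = m" using mset_eq_length[OF that(1)] that(2) by simp
    \<comment> \<open>Words of length at most one are determined by their multiset.\<close>
    then have "xs = ys" using that False
      by (cases xs; cases ys) (auto simp: not_le less_2_cases_iff length_Suc_conv)
    then show ?thesis by (simp add: short_span_def span_zero)
  qed
  obtain p ps' q qs' where pq: "ps = p # ps'" "qs = q # qs'"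
    using Suc mset_eq_length[OF Suc.prems] by (cases ps; cases qs) auto
  have m: "length ps' = m" using Suc pq by simp
  show ?case
  proof (cases "p = q")
    case True
    then show ?thesis using same[of ps' qs' p] Suc.prems m by (simp add: pq)
  next
    case False
    have q: "q \<in> set ps'" using Suc.prems False mset_eq_setD[OF Suc.prems] by (auto simp: pq)
    define rs where "rs = remove1 q ps'"
    have ps': "mset ps' = mset (q # rs)" using q by (simp add: rs_def)
    have qs': "mset (p # rs) = mset qs'"
      using Suc.prems ps' by (simp add: pq)
    have len: "length rs + 1 = m" using mset_eq_length[OF ps'] m by simp
    have w: "wt ps' = qwt q + wt rs" using wt_mset[OF ps'] by simp
    have wts: "wt ps = qwt p + (qwt q + wt rs)" by (simp add: pq w)
    \<comment> \<open>One swap brings the first letter of \<open>qs\<close> to the front; the tails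
      are rearranged before and after it by induction.\<close>
    have "(qword (p # ps') - qword (p # q # rs)) + (qword (p # q # rs) - qword (q # p # rs))
        + (qword (q # p # rs) - qword (q # qs')) \<in> short_span (Suc m) (wt ps)"
    proof (intro subspace_add[OF subspace_short_span])
      show "qword (p # ps') - qword (p # q # rs) \<in> short_span (Suc m) (wt ps)"
        using same[OF ps' m, of p] by (simp add: pq)
      show "qword (p # q # rs) - qword (q # p # rs) \<in> short_span (Suc m) (wt ps)"
        using qword_swap[OF n, of p q rs] len[symmetric] wts by simp
      show "qword (q # p # rs) - qword (q # qs') \<in> short_span (Suc m) (wt ps)"
        using same[OF qs', of q] len wts by (simp add: add.left_commute)
    qed
    then show ?thesis using Suc(2) by (simp add: pq)
  qed
qed

text \<open>One ordering per multiset, so that different words in a combination can be separated by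
  contractions.\<close>

definition rep :: "(nat \<times> nat) multiset \<Rightarrow> (nat \<times> nat) list" where "rep M = (SOME ps. mset ps = M)"

lemma mset_rep: "mset (rep M) = M"
  unfolding rep_def using ex_mset[of M] by (rule someI_ex)

lemma span_image_explicit:
  assumes "x \<in> span (g ` C)"
  obtains F c where "finite F" "F \<subseteq> C" "x = (\<Sum>a\<in>F. sc (c a) (g a))"
proof -
  obtain t r where t: "finite t" "t \<subseteq> g ` C" "x = (\<Sum>a\<in>t. sc (r a) a)"
    using assms unfolding span_explicit by blast
  obtain F where F: "F \<subseteq> C" "inj_on g F" "t = g ` F"
    using t(2) subset_image_inj by metis
  have fin: "finite F" using t(1) F(2,3) finite_imageD by blast
  have "x = (\<Sum>a\<in>F. sc (r (g a)) (g a))"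
    unfolding t(3) F(3) by (simp add: sum.reindex[OF F(2)])
  from that[OF fin F(1) this] show ?thesis .
qed

lemma wt_length: "2 * length ps \<le> wt ps"
  by (induction ps) (auto simp: qwt_def)

text \<open>Words of the top length r are first replaced by representatives of their multisets.
  Since v is linear and the errors are shorter, contractions isolate the coefficients of these words
  and show that they vanish: there are no relations among products of at most n letters.\<close>

lemma short_span_reduce:
  assumes n: "n \<ge> 1" and r: "r \<ge> 2" and v: "v \<in> short_span (Suc r) d" and vq: "v \<in> qspan d" and d: "d \<le> 2 * n + 1"
  shows "v \<in> short_span r d"
proof -
  let ?C = "{ps. length ps = r \<and> wt ps = d \<and> ps = rep (mset ps)}"
  have "\<exists>x\<in>span (qword ` ?C). v - x \<in> short_span r d"
    using v unfolding short_span_def[of "Suc r" d]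
  proof (induction rule: span_induct_alt)
    case base
    then show ?case by (intro bexI[of _ 0]) (simp_all add: span_zero subspace_0[OF subspace_short_span])
  next
    case (step c x y)
    have "\<exists>x'\<in>span (qword ` ?C). x - x' \<in> short_span r d"
    proof (cases "\<exists>ps. x = qword ps \<and> length ps = r \<and> wt ps = d")
      case True
      then obtain ps where ps: "x = qword ps" "length ps = r" "wt ps = d" by blast
      let ?R = "rep (mset ps)"
      have R: "mset ?R = mset ps" by (rule mset_rep)
      have "?R \<in> ?C" using mset_eq_length[OF R] wt_mset[OF R] ps R by simp
      moreover have "qword ps - qword ?R \<in> short_span r d" using qword_reorder[OF n R[symmetric]] ps by simp
      ultimately show ?thesis unfolding ps(1) by (intro bexI[of _ "qword ?R"] span_base imageI)
    next
      case False
      then have "x \<in> qword ` {ps. 2 \<le> length ps \<and> length ps < r \<and> wt ps = d} \<union> {y \<in> qspan d. linpart (d - 2) y = 0}"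
        using step(1) by (auto simp: less_Suc_eq)
      then have "x \<in> short_span r d" unfolding short_span_def by (rule span_base)
      then show ?thesis by (intro bexI[of _ 0]) (simp_all add: span_zero)
    qed
    then obtain x' y' where xy: "x' \<in> span (qword ` ?C)" "x - x' \<in> short_span r d" "y' \<in> span (qword ` ?C)" "y - y' \<in> short_span r d"
      using step by blast
    have e: "sc c x + y - (sc c x' + y') = sc c (x - x') + (y - y')"
      by (simp add: scale_right_diff_distrib)
    show ?case
    proof (intro bexI[of _ "sc c x' + y'"])
      show "sc c x + y - (sc c x' + y') \<in> short_span r d"
        unfolding e by (intro subspace_add[OF subspace_short_span] subspace_scale[OF subspace_short_span] xy)
      show "sc c x' + y' \<in> span (qword ` ?C)" by (intro span_add span_scale xy)
    qed
  qed
  then obtain x where x: "x \<in> span (qword ` ?C)" "v - x \<in> short_span r d" by blast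
  obtain F c where F: "finite F" "F \<subseteq> ?C" "x = (\<Sum>ps\<in>F. sc (c ps) (qword ps))"
    using span_image_explicit[OF x(1)] .
  have qlow: "y \<in> span (mon ` {ps. length ps < r})" if "y \<in> qspan d" for y
  proof -
    have "qv ` {p. qwt p = d} \<subseteq> mon ` {ps. length ps < r}"
    proof (rule image_subsetI)
      fix p assume "p \<in> {p. qwt p = d}"
      show "qv p \<in> mon ` {ps. length ps < r}"
        by (rule image_eqI[of _ _ "[p]"]) (use r in \<open>auto simp: qv_def\<close>)
    qed
    then show ?thesis using that span_mono unfolding qspan_def by blast
  qed
  have low: "y \<in> span (mon ` {ps. length ps < r})" if "y \<in> short_span r d" for y
  proof -
    have "short_span r d \<subseteq> span (mon ` {ps. length ps < r})"
      unfolding short_span_def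
    proof (rule span_minimal[OF _ subspace_span], rule Un_least)
      show "qword ` {ps. 2 \<le> length ps \<and> length ps < r \<and> wt ps = d} \<subseteq> span (mon ` {ps. length ps < r})"
      proof (rule image_subsetI)
        fix ps assume "ps \<in> {ps. 2 \<le> length ps \<and> length ps < r \<and> wt ps = d}"
        then show "qword ps \<in> span (mon ` {ps. length ps < r})"
          by (intro subsetD[OF span_mono qword_span[of ps]]) auto
      qed
      show "{y \<in> qspan d. linpart (d - 2) y = 0} \<subseteq> span (mon ` {ps. length ps < r})" using qlow by blast
    qed
    then show ?thesis using that by blast
  qed
  have "c ps = 0" if ps: "ps \<in> F" for ps
  proof -
    have psC: "length ps = r" "wt ps = d" "ps = rep (mset ps)" using ps F(2) by auto
    define L where "L = zip [0..<r] ps"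
    \<comment> \<open>Each letter has weight at least 2, so weight 2n+1 leaves room for at most n
      letters, and there are enough colours.\<close>
    have "2 * r \<le> 2 * n + 1" using wt_length[of ps] psC d by simp
    then have rn: "r \<le> n" by simp
    have fL: "map fst L = [0..<r]" "map snd L = ps" "length L = r" by (simp_all add: L_def psC(1))
    have L: "distinct (map fst L)" "fst ` set L \<subseteq> {..<n}"
      using rn by (auto simp: fL(1) simp flip: set_map)
    have low0: "contract L y = 0" if "y \<in> span (mon ` {ps. length ps < r})" for y
      by (rule contract_span_0[OF L]) (use that fL(3) in simp)
    have awfn: "contract L (qword qs) = contract L (mon qs)" if "length qs = r" for qs
    proof -
      have "contract L (qword qs - mon qs) = 0" using qword_mon[of qs] that by (intro low0) simp
      then have "contract L ((qword qs - mon qs) + mon qs) = contract L (mon qs)" by (simp only: contract_add add_0_left)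
      then show ?thesis by simp
    qed
    have "contract L x = contract L v - contract L (v - x)" using contract_add[of L x "v - x"] by simp
    also have "\<dots> = 0" using low0[OF qlow[OF vq]] low0[OF low[OF x(2)]] by simp
    finally have "0 = (\<Sum>qs\<in>F. c qs * contract L (qword qs))" unfolding F(3) contract_sum contract_scale by simp
    also have "\<dots> = (\<Sum>qs\<in>F. if qs = ps then c ps * contract L (mon ps) else 0)"
    proof (intro sum.cong refl)
      fix qs assume qs: "qs \<in> F"
      then have qsC: "length qs = r" "qs = rep (mset qs)" using F(2) by auto
      show "c qs * contract L (qword qs) = (if qs = ps then c ps * contract L (mon ps) else 0)"
      proof (cases "qs = ps")
        case False
        then have "mset (map snd L) \<noteq> mset qs" using qsC(2) psC(3) fL(2) by metis
        then show ?thesis using False contract_mon_0[OF L] awfn[OF qsC(1)] by simp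
      qed (simp add: awfn[OF psC(1)])
    qed
    also have "\<dots> = c ps * contract L (mon ps)" using F(1) ps by (simp add: sum.delta)
    finally have "c ps * contract L (mon ps) = 0" by simp
    moreover have "contract L (mon ps) \<noteq> 0"
      using contract_mon[OF L, of ps] fL(2) by auto
    ultimately show ?thesis by simp
  qed
  then have "x = 0" unfolding F(3) by simp
  then show ?thesis using x(2) by simp
qed

text \<open>Lowering m step by step to 2 leaves only linear vectors killed by
  \<open>linpart\<close>. The bound on d is the weight of the last generator h^{2n-1}.\<close>

lemma short_span_linpart:
  assumes n: "n \<ge> 1" and v: "v \<in> short_span m d" "v \<in> qspan d" and d: "d \<le> 2 * n + 1"
  shows "linpart (d - 2) v = 0"
proof -
  have "v \<in> short_span 2 d"
    using v(1)
  proof (induction m)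
    case 0
    then show ?case unfolding short_span_def by (rule subsetD[OF span_mono, rotated]) auto
  next
    case (Suc r)
    show ?case
    proof (cases "r \<ge> 2")
      case True
      then show ?thesis using Suc.IH short_span_reduce[OF n True Suc.prems v(2) d] by blast
    next
      case False
      then show ?thesis using Suc.prems unfolding short_span_def by (elim subsetD[OF span_mono, rotated]) auto
    qed
  qed
  then have "v \<in> span {y \<in> qspan d. linpart (d - 2) y = 0}"
    unfolding short_span_def by (rule subsetD[OF span_mono, rotated]) auto
  then show ?thesis
  proof (induction rule: span_induct_alt)
    case (step c x y)
    then show ?case by (simp add: linpart_add linpart_scale)
  qed simp
qed

lemma der_qspan:
  assumes "v \<in> qspan d"
  shows "der v \<in> qspan (Suc d)"
  unfolding qspan_def using assms[unfolded qspan_def] lin_deriv subspace_span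
proof (rule lin_span)
  fix s assume "s \<in> qv ` {p. qwt p = d}"
  then obtain k l where kl: "s = qv (k, l)" "qwt (k, l) = d" by auto
  show "der s \<in> span (qv ` {p. qwt p = Suc d})"
    unfolding kl(1) der_qv by (intro span_add span_scale span_base imageI) (use kl(2) in \<open>auto simp: qwt_def\<close>)
qed

lemma linpart_der:
  assumes n: "n \<ge> 1" and v: "v \<in> qspan d"
  shows "linpart (d - 1) (der v) = 0"
  using v unfolding qspan_def
proof (induction rule: span_induct_alt)
  case (step c x y)
  then obtain k l where kl: "x = qv (k, l)" "qwt (k, l) = d" by auto
  have "linpart (d - 1) (der x) = of_nat (Suc k) * ((-1) ^ Suc k / (fact (Suc k) * fact l))
      + of_nat (Suc l) * ((-1) ^ k / (fact k * fact (Suc l)))"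
    unfolding kl(1) der_qv linpart_add linpart_scale
    using linpart_qv[OF n, of "Suc k" l "d - 1"] linpart_qv[OF n, of k "Suc l" "d - 1"] kl(2)
    by (simp add: qwt_def del: of_nat_Suc fact_Suc power_Suc)
  also have "\<dots> = 0" by (simp add: divide_simps del: of_nat_Suc)
  finally show ?case using step by (simp add: linpart_add linpart_scale)
qed simp

lemma letter_qspan: "letter p \<in> qspan (qwt p)"
proof -
  have "letter (j, k) \<in> qspan (qwt (j, k))" for j k
  proof (induction k)
    case 0
    have "qv (0, j) \<in> qspan (qwt (j, 0))" unfolding qspan_def by (intro span_base imageI) (simp add: qwt_def)
    then show ?case by (simp add: letter_def h_field_eq qspan_def span_scale)
  next
    case (Suc k)
    then show ?case using der_qspan[OF Suc] by (simp add: letter_der qwt_def)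
  qed
  then show ?thesis by (cases p) simp
qed

text \<open>Each letter is a combination of q's of its weight, and Wick words expand multilinearly
  without change of length.\<close>

lemma hword_qword: "hword xs \<in> span (qword ` {ps. length ps = length xs \<and> wt ps = wt xs})"
proof (induction xs)
  case Nil
  then show ?case by (intro span_base) (auto intro!: image_eqI[of _ _ "[]"])
next
  case (Cons p xs)
  let ?T = "span (qword ` {ps. length ps = length (p # xs) \<and> wt ps = wt (p # xs)})"
  have "np (letter p) (-1) y \<in> ?T" if y: "y \<in> span (qword ` {ps. length ps = length xs \<and> wt ps = wt xs})" for y
    using letter_qspan[unfolded qspan_def] nprod_linear_left subspace_span
  proof (rule lin_span)
    fix s assume "s \<in> qv ` {q. qwt q = qwt p}"
    then obtain q where q: "s = qv q" "qwt q = qwt p" by auto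
    show "np s (-1) y \<in> ?T" using y nprod_linear_right subspace_span
    proof (rule lin_span)
      fix u assume "u \<in> qword ` {ps. length ps = length xs \<and> wt ps = wt xs}"
      then obtain ps where ps: "u = qword ps" "length ps = length xs" "wt ps = wt xs" by auto
      have "qword (q # ps) \<in> ?T" by (intro span_base imageI) (use ps q in auto)
      then show "np s (-1) u \<in> ?T" by (simp add: q ps qA_def)
    qed
  qed
  then show ?case using Cons by simp
qed

lemma graded_span:
  assumes v: "v \<in> span (g ` A)" "v \<in> ws (int d)" and g: "\<And>a. g a \<in> ws (int (deg a))"
  shows "v \<in> span (g ` {a \<in> A. deg a = d})"
proof -
  obtain F c where F: "finite F" "F \<subseteq> A" "v = (\<Sum>a\<in>F. sc (c a) (g a))"
    using span_image_explicit[OF v(1)] .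
  let ?u = "\<lambda>e. \<Sum>a\<in>{a \<in> F. deg a = e}. sc (c a) (g a)"
  have u: "?u e \<in> ws (int e)" for e
    using g by (intro subspace_sum[OF subspace_ws] subspace_scale[OF subspace_ws]) auto
  let ?D = "insert d (deg ` F)"
  have "v = (\<Sum>e\<in>deg ` F. ?u e)" unfolding F(3) by (rule sum.image_gen[OF F(1)])
  also have "\<dots> = (\<Sum>e\<in>?D. ?u e)"
  proof (rule sum.mono_neutral_left)
    show "\<forall>e\<in>?D - deg ` F. ?u e = 0"
    proof
      fix e assume "e \<in> ?D - deg ` F"
      then have "{a \<in> F. deg a = e} = {}" by auto
      then show "?u e = 0" by (simp only: sum.empty)
    qed
  qed (use F(1) in auto)
  finally have s: "v = (\<Sum>e\<in>?D. ?u e)" .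
  have fin: "finite ?D" using F(1) by simp
  have "(\<Sum>e\<in>?D. ?u e - (if e = d then v else 0)) = 0"
    using fin by (simp add: sum_subtractf s[symmetric] sum.delta del: sum.insert)
  moreover have "?u e - (if e = d then v else 0) \<in> ws (int e)" for e
    using u[of e] v(2) by (auto intro: subspace_diff[OF subspace_ws])
  ultimately have "?u d - (if d = d then v else 0) = 0"
    using ws_sum_zero[OF fin, of "\<lambda>e. ?u e - (if e = d then v else 0)" d] by blast
  then have "v = ?u d" by simp
  moreover have "?u d \<in> span (g ` {a \<in> A. deg a = d})"
    by (intro span_sum span_scale span_base imageI) (use F(2) in auto)
  ultimately show ?thesis by simp
qed

text \<open>In weight k+2 a word avoiding the index k has at least two letters or is a single proper
  derivative. Both lie in \<open>short_span\<close>, whereas \<open>linpart\<close> does not vanish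
  on h^k.\<close>

lemma h_notin:
  assumes n: "n \<ge> 1" and k: "k < 2 * n"
  shows "hh k \<notin> span (hword ` {xs. k \<notin> fst ` set xs})"
proof
  assume "hh k \<in> span (hword ` {xs. k \<notin> fst ` set xs})"
  then have "hh k \<in> span (hword ` {xs \<in> {xs. k \<notin> fst ` set xs}. wt xs = k + 2})"
    by (rule graded_span[OF _ h_ws hword_ws])
  moreover have "hword ` {xs \<in> {xs. k \<notin> fst ` set xs}. wt xs = k + 2} \<subseteq> short_span (k + 3) (k + 2)"
  proof (rule image_subsetI)
    fix xs assume "xs \<in> {xs \<in> {xs. k \<notin> fst ` set xs}. wt xs = k + 2}"
    then have xs: "k \<notin> fst ` set xs" "wt xs = k + 2" by auto
    \<comment> \<open>The bound k + 3 merely exceeds the length of every word of weight k +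
      2.\<close>
    show "hword xs \<in> short_span (k + 3) (k + 2)"
    proof (cases "length xs \<ge> 2")
      case True
      have "qword ` {ps. length ps = length xs \<and> wt ps = wt xs} \<subseteq>
          qword ` {ps. 2 \<le> length ps \<and> length ps < k + 3 \<and> wt ps = k + 2} \<union> {y \<in> qspan (k + 2). linpart (k + 2 - 2) y = 0}"
        using True xs(2) wt_length[of xs] by auto
      then show ?thesis unfolding short_span_def using hword_qword[of xs] span_mono by blast
    next
      case False
      then obtain p where p: "xs = [p]" using xs(2) by (cases xs; cases "tl xs") auto
      have "snd p \<noteq> 0"
      proof
        assume "snd p = 0"
        then have "fst p = k" using xs(2) by (simp add: p qwt_def)
        then show False using xs(1) by (simp add: p)
      qed
      then obtain j m where jm: "p = (j, Suc m)" by (cases p; cases "snd p") auto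
      have jm2: "qwt (j, m) = k + 1" using xs(2) by (simp add: p jm qwt_def)
      have "letter (j, m) \<in> qspan (k + 1)" using letter_qspan[of "(j, m)"] jm2 by simp
      from der_qspan[OF this] linpart_der[OF n this]
      have "letter p \<in> short_span (k + 3) (k + 2)"
        by (intro short_span_linpart_0) (simp_all add: jm letter_der)
      then show ?thesis by (simp add: p vacuum_right)
    qed
  qed
  ultimately have "hh k \<in> short_span (k + 3) (k + 2)"
    using span_minimal[of _ "short_span (k + 3) (k + 2)"] by (auto simp: short_span_def)
  moreover have "hh k \<in> qspan (k + 2)" using letter_qspan[of "(k, 0)"] by (simp add: letter_def qwt_def)
  ultimately have "linpart (k + 2 - 2) (hh k) = 0" by (rule short_span_linpart[OF n]) (use k in simp)
  then show False using linpart_qv[OF n, of 0 k k] by (simp add: h_field_eq linpart_scale)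
qed

lemma h_nonzero: "n \<ge> 1 \<Longrightarrow> hh k \<noteq> 0"
  using linpart_qv[of 0 k k] linpart_zero[of k] by (auto simp: h_field_eq)

text \<open>The vectors are nonzero and have pairwise different weights k+2;
  \<open>of_type_W\<close> asks for a list without repetitions.\<close>

lemma inj_h: "n \<ge> 1 \<Longrightarrow> inj hh"
proof (rule injI)
  fix i j assume n: "n \<ge> 1" and ij: "hh i = hh j"
  have "sc (of_int (int (i + 2))) (hh i) = sc (of_int (int (j + 2))) (hh i)"
    using h_ws[of i] h_ws[of j] ij unfolding ws_def by simp
  then have "(of_int (int (i + 2)) :: complex) = of_int (int (j + 2))"
    using h_nonzero[OF n] scale_right_imp_eq by blast
  then show "i = j" by (simp only: of_int_eq_iff)
qed

lemma minimal_strong_generating_set_h: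
  assumes n: "n \<ge> 1"
  shows "minimal_strong_generating_set V W (hh ` {0..2 * n - 1})"
  unfolding minimal_strong_generating_set_def
proof (intro conjI allI impI notI)
  show "strongly_generates V W (hh ` {0..2 * n - 1})" by (rule strongly_generates_h[OF n])
  fix S' assume S': "S' \<subset> hh ` {0..2 * n - 1}" and gen: "strongly_generates V W S'"
  then obtain k where k: "k \<in> {0..2 * n - 1}" "hh k \<notin> S'" by blast
  have "{wick V (map (\<lambda>(a, k). (der ^^ k) a) w) | w. fst ` set w \<subseteq> S'} \<subseteq> hword ` {xs. k \<notin> fst ` set xs}"
  proof
    fix x assume "x \<in> {wick V (map (\<lambda>(a, k). (der ^^ k) a) w) | w. fst ` set w \<subseteq> S'}"
    then obtain w where w: "x = wick V (map (\<lambda>(a, k). (der ^^ k) a) w)" "fst ` set w \<subseteq> S'" by blast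
    \<comment> \<open>Any preimage serves as index: its h lies in S', while h^k does not, so the
      index differs from k.\<close>
    let ?xs = "map (\<lambda>(a, m). (inv_into UNIV hh a, m)) w"
    have hinv: "hh (inv_into UNIV hh a) = a" if "a \<in> S'" for a
      using that S' by (intro f_inv_into_f) auto
    have mem: "a \<in> S'" if "(a, m) \<in> set w" for a m
      using w(2) that by force
    have "map (\<lambda>p. (hh (fst p), snd p)) ?xs = w"
      unfolding map_map by (rule map_idI) (auto simp: hinv mem)
    then have "x = hword ?xs" by (simp only: w(1) hword_eq_wick)
    moreover have "k \<notin> fst ` set ?xs"
    proof
      assume "k \<in> fst ` set ?xs"
      then obtain a m where am: "(a, m) \<in> set w" "k = inv_into UNIV hh a" by auto
      show False using hinv[OF mem[OF am(1)]] mem[OF am(1)] k(2) am(2) by simp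
    qed
    ultimately show "x \<in> hword ` {xs. k \<notin> fst ` set xs}" by blast
  qed
  then have "W \<subseteq> span (hword ` {xs. k \<notin> fst ` set xs})"
    using gen span_mono unfolding strongly_generates_def by blast
  then show False using h_notin[OF n, of k] k(1) n h_W by force
qed

end

theorem theorem4p3:
  fixes V :: "('v :: ab_group_add) vsa" and n :: nat and e f :: "nat \<Rightarrow> 'v"
  assumes "n \<ge> 1"
    and "symplectic_fermion_algebra V n e f"
  shows "minimal_strong_generating_set V (invariants (GL_group V n e f))
           (h_field V n e f ` {0..2 * n - 1})
         \<and> of_type_W V (conformal_vector V n e f) (invariants (GL_group V n e f))
           [2..<2 * n + 2]"
proof -
  interpret symplectic_fermion_algebra V n e f by (rule assms(2))
  note min = minimal_strong_generating_set_h[OF assms(1)]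
  have "of_type_W V Lc W [2..<2 * n + 2]"
    unfolding of_type_W_def
  proof (intro exI[of _ "map hh [0..<2 * n]"] conjI)
    show "distinct (map hh [0..<2 * n])"
      using inj_on_subset[OF inj_h[OF assms(1)] subset_UNIV] by (simp add: distinct_map)
    have "set (map hh [0..<2 * n]) = hh ` {0..2 * n - 1}" using assms(1) by auto
    then show "minimal_strong_generating_set V W (set (map hh [0..<2 * n]))" using min by (simp only:)
    have "has_weight V Lc (hh i) (i + 2)" for i
      using h_ws[of i] by (simp add: has_weight_def ws_def)
    then show "list_all2 (has_weight V Lc) (map hh [0..<2 * n]) [2..<2 * n + 2]"
      by (simp add: list_all2_conv_all_nth add.commute[of 2] del: upt_Suc)
  qed
  then show ?thesis using min by blast
qed

end
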